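(* Consider the multi-stage unconstrained problem, the accelerated mirror descent algorithm with parameters $\gamma=1$, $\theta=1/2$, $\mu\ge0$, $L_2>0$, the seeds and the stochastic conditional gradients described in the context. Assume that for all $\xi\in\Xi$ and $x,x'\in\mathcal X$ $$\frac{\mu}{2}\|x-x'\|^2\le f(x',\xi)-f(x,\xi)-\langle\nabla f(x,\xi),x'-x\rangle\le\frac{L_2}{2}\|x-x'\|^2,$$ that $\|\frac{\partial}{\partial x}f(x,\xi)\|_*\le\tilde L$ for all $x\in\mathcal X$, $\xi\in\Xi$, and that $\mathbb E[D_v(\mathbf x^*,\mathbf x^{(0)})]\le\tilde D^2$. Let $b^2=\sum_{t=1}^Tb_t^2$ and $\sigma^2=\sum_{t=1}^T\sigma_t^2$, where $b_t,\sigma_t$ are the bias and standard-deviation constants of the stochastic conditional gradients given in the context. Let $\overline X_t=X_{t+}^{(L)}$ be the output. (1) If $\mu=0$ and $\|x-x'\|\le D$ for all $x,x'\in\mathcal X$, then $$\mathbb E_{\mathrm{int}}[\mathrm{GapU}(\overline X)]\le\frac{8L_2\tilde D^2}{(L+1)(L+2)}+\frac23(L+3)\Big(\frac{b^2+\sigma^2}{2L_2}+bD\Big).$$ (2) If $\mu>0$, then for $\rho=\big(1+\frac14\sqrt{\mu/L_2}\big)^{-2}\le1-\frac{3}{16}\sqrt{\mu/L_2}$, $$\mathbb E_{\mathrm{int}}[\mathrm{GapU}(\overline X)]\le\rho^L\cdot2L_2\tilde D^2+\frac{b^2+\sigma^2}{2}\Big(\frac3\mu+\frac1{L_2}\Bi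g)\frac1{1-\rho}.$$
   Context: **Problem.** $(\Omega,\mathcal F,\mathbb P)$ is a probability space and $\boldsymbol\xi=(\boldsymbol\xi_1,\dots,\boldsymbol\xi_T)$ with random vectors $\boldsymbol\xi_t:\Omega\to\Xi_t\subset\mathbb R^{k_t}$; $\Xi_1=\{\xi_1\}$ is a singleton. $\Xi_{1:t}=\Xi_1\times\dots\times\Xi_t$, $\Xi=\Xi_{1:T}$, $\mathcal F_t=\sigma(\boldsymbol\xi_{1:t})$. For $S\subset\mathbb R^d$, $\mathcal P_t(S)$ is the set of Borel measurable maps $\Xi_{1:t}\to S$. A policy $X_t\in\mathcal P_t(\mathbb R^{n_t})$ induces $\mathbf x_t(\omega)=X_t(\boldsymbol\xi_{1:t}(\omega))$; symbols without subscript denote $T$-tuples. Let $f(x_{1:T},\xi)=f_1(x_1,\xi_1)+\sum_{t=2}^Tf_t(x_{t-1},x_t,\xi_t)$. The problem is $\inf\mathbb E[f(\mathbf x,\boldsymbol\xi)]$ over $X_t\in\mathcal P_t(\mathcal X_t)$. Standing assumptions, for each $t$ ($n_0=0$): $f_t(\cdot,\cdot,\xi_t)$ is convex and differentiable in $(x_{t-1},x_t)$ for all $\xi_t\in\Xi_t$; $\mathcal X_t\subset\mathbb R^{n_t}$ is nonempty, compact, convex; $f_t$, $\partial f_t/\partial x_{t-1}$, $\partial f_t/\partial x_t$ are jointly Borel measurable; and the problem has a solution $X^*$, with induced $\mathbf x^*$. $\mathrm{GapU}(X)=\mathbb E[f(\mathbf x,\boldsymbol\xi)-f(\mathbf x^*,\boldsymbol\xi)]$.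 $\mathcal X=\prod_t\mathcal X_t$; $\nabla f$ is the gradient in $x=x_{1:T}$. **Geometry.** All spaces carry the Euclidean inner product and the induced norm $\|\cdot\|$ (so $\|\cdot\|_*=\|\cdot\|$). A distance generating function (DGF) for a convex compact $\mathcal Q\subset\mathbb R^{d}$ is a convex continuous $v:\mathcal Q\to\mathbb R$ such that $\mathcal Q^o=\{x\in\mathcal Q:\exists g\in\mathbb R^d,\ x\in\arg\min_{x'\in\mathcal Q}v(x')+\langle g,x'\rangle\}$ is convex and, restricted to $\mathcal Q^o$, $v$ is continuously differentiable with $\langle x'-x,\nabla v(x')-\nabla v(x)\rangle\ge\|x'-x\|^2$. $D_v(y,x)=v(y)-v(x)-\langle\nabla v(x),y-x\rangle$. $v_t$ is a DGF for $\mathcal X_t$ and $v(x_{1:T})=\sum_tv_t(x_t)$. It is assumed that $\nabla v_t(X_t)$ is measurable for every $X_t\in\mathcal P_t(\mathcal X_t^o)$, and that the oracles $G_t^{(l)}$ below, for each fixed realization of the seeds, are measurable on $\Xi_{1:t}$. **Conditional scenario sampler.** A measurable $\widehat{\boldsymbol\xi}_t:\Xi_{1:(t-1)}\times[0,1]\to\Xi_t$ is $\beta_t$-biased if for every $\xi_{1:(t-1)}$, with $U\sim\mathrm{Uniform}([0,1])$, the law of $\widehat{\boldsymbol\xi}_t(\xi_{1:(t-1)},U)$ is within total variation distance $\beta_t$ of the conditional law of $\boldsymbol\xi_t$ given $\boldsymbol\xi_{1:(t-1)}=\xi_{1:(t-1)}$, where $TV(P,Q)=\sup_A|P(A)-Q(A)|$.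 Such samplers are given for $t=2,\dots,T$. **Stochastic conditional gradients.** For policies $X_s\in\mathcal P_s(\mathcal X_s)$, $u\in[0,1]$, $2\le t\le T-1$ and $\hat\xi_{t+1}=\widehat{\boldsymbol\xi}_{t+1}(\xi_{1:t},u)$, $$G_t(\xi_{1:t},u;X)=\tfrac{\partial f_t}{\partial x_t}\big(X_{t-1}(\xi_{1:(t-1)}),X_t(\xi_{1:t}),\xi_t\big)+\tfrac{\partial f_{t+1}}{\partial x_t}\big(X_t(\xi_{1:t}),X_{t+1}(\xi_{1:t},\hat\xi_{t+1}),\hat\xi_{t+1}\big);$$ for $t=1$ the first term is $\frac{\partial f_1}{\partial x_1}(X_1(\xi_1),\xi_1)$; for $t=T$ only the first term is present. Let $G_t^*(\xi_{1:t};X)=\mathbb E[\frac{\partial}{\partial x_t}f(\mathbf x,\boldsymbol\xi)\mid\boldsymbol\xi_{1:t}=\xi_{1:t}]$. Let $\mathsf{Lip}_t$ be such that $\|\frac{\partial}{\partial x_t}f\|_*\le\mathsf{Lip}_t$ on $\mathcal X\times\Xi$; $b_t=2\beta_{t+1}\mathsf{Lip}_t$ ($b_T=0$), and $\sigma_t\le2\mathsf{Lip}_t$ is a constant such that, with $U\sim\mathrm{Uniform}([0,1])$, for all policies $X$ and all $\xi\in\Xi$: $\|\mathbb E[G_t(\xi_{1:t},U;X)]-G_t^*(\xi_{1:t};X)\|_*\le b_t$ and $\mathbb E[\|G_t(\xi_{1:t},U;X)-\mathbb E[G_t(\xi_{1:t},U;X)]\|_*^2]\le\sigma_t^2$. **Seeds.**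 On a separate probability space $(\Omega_{\mathrm{int}},\mathcal F_{\mathrm{int}},\mathbb P_{\mathrm{int}})$ with expectation $\mathbb E_{\mathrm{int}}$ (independent of $\Omega$), $\boldsymbol\zeta_{t,l}$, $1\le t\le T$, $0\le l\le L$, are i.i.d. $\mathrm{Uniform}([0,1])$. **Algorithm.** Given deterministic $X_t^{(0)}\in\mathcal P_t(\mathcal X_t^o)$, parameters $\gamma\ge0,\mu\ge0,L_2>0,\theta\in[0,1]$ and a realization $\zeta=\boldsymbol\zeta(\omega_{\mathrm{int}})$. Set $\alpha_0=A_0=1$. For $l=0,1,\dots,L$: let $\alpha_{l+1}>0$ satisfy $(1+\gamma)L_2+(1-\theta)\mu A_l=\frac{(1+\gamma)L_2\alpha_{l+1}^2}{A_l+\alpha_{l+1}}$, $A_{l+1}=A_l+\alpha_{l+1}$, $\tau_l=\alpha_{l+1}/A_{l+1}$; and for all $t$ and $\xi\in\Xi$ let $G_t^{(l)}(\xi_{1:t})=G_t(\xi_{1:t},\zeta_{t,l};X^{(l)})$ and (all functions evaluated at $\xi_{1:t}$) $$X_{t+}^{(l)}=\arg\min_{x_t\in\mathcal X_t}\langle G_t^{(l)},x_t-X_t^{(l)}\rangle+\tfrac{(1+\gamma)L_2}{2}\|x_t-X_t^{(l)}\|^2,$$ $$X_{t-}^{(l)}=\arg\min_{x_t\in\mathcal X_t}(1+\gamma)L_2D_{v_t}(x_t,X_t^{(0)})+\sum_{l'=0}^l\alpha_{l'}\Big(\langle G_t^{(l')},x_t-X_t^{(l')}\rangle+\tfrac{(1-\theta)\mu}{2}\|x_t-X_t^{(l')}\|^2\Big),$$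 $$X_t^{(l+1)}=\tau_lX_{t-}^{(l)}+(1-\tau_l)X_{t+}^{(l)}.$$ The output is $\overline X_t=X_{t+}^{(L)}$, depending on $\omega_{\mathrm{int}}$ through $\zeta$; $\mathrm{GapU}(\overline X)$ is viewed as a random variable on $\Omega_{\mathrm{int}}$.
   Formalization: In (2), the inequality ρ ≤ 1 − (3/16)√(μ/L₂) is claimed only when 𝒳 has at least two points; for a one-point 𝒳 the curvature condition is vacuous and the inequality can fail (e.g. μ = 25 L₂). The gap bound itself is unrestricted. *)

theory Defs
  imports "HOL-Probability.Probability"
begin

section \<open>Multi-stage stochastic programs\<close>

text \<open>
  The stage dimensions vary with the stage index, so the space of the stage-\<open>t\<close> decisions
  (the Euclidean space of dimension \<open>n t\<close>) is a linear subspace \<open>dspace P t\<close>, of arbitrary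
  dimension, of one ambient Euclidean space \<open>'x\<close> and carries the induced inner product.
  The sets \<open>supp P t\<close> are arbitrary subsets of one ambient Euclidean space \<open>'z\<close>; only
  their Borel structure is used, so that differing dimensions are covered by embedding.
  A \<open>T\<close>-tuple is a function on \<open>{1..T}\<close>.
\<close>

record ('w, 'z, 'x) msp =
  horizon :: nat
  base :: "'w measure"
  noise :: "nat \<Rightarrow> 'w \<Rightarrow> 'z"
  supp :: "nat \<Rightarrow> 'z set"
  dspace :: "nat \<Rightarrow> 'x set"
  cost :: "nat \<Rightarrow> 'x \<Rightarrow> 'x \<Rightarrow> 'z \<Rightarrow> real"
  feas :: "nat \<Rightarrow> 'x set"

definition supp_alg :: "('w, 'z::euclidean_space, 'x) msp \<Rightarrow> nat \<Rightarrow> 'z measure" where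
  "supp_alg P t = restrict_space borel (supp P t)"

text \<open>The measurable space of histories up to stage \<open>t\<close>; for \<open>t = horizon P\<close>, the path space.\<close>

definition hist :: "('w, 'z::euclidean_space, 'x) msp \<Rightarrow> nat \<Rightarrow> (nat \<Rightarrow> 'z) measure" where
  "hist P t = PiM {1..t} (supp_alg P)"

definition trunc :: "nat \<Rightarrow> (nat \<Rightarrow> 'z) \<Rightarrow> nat \<Rightarrow> 'z" where
  "trunc t \<xi> = restrict \<xi> {1..t}"

definition scenario :: "('w, 'z, 'x) msp \<Rightarrow> 'w \<Rightarrow> nat \<Rightarrow> 'z" where
  "scenario P \<omega> = (\<lambda>t\<in>{1..horizon P}. noise P t \<omega>)"

definition policies ::
  "('w, 'z::euclidean_space, 'x::euclidean_space) msp \<Rightarrow> nat \<Rightarrow> 'x set \<Rightarrow> ((nat \<Rightarrow> 'z) \<Rightarrow> 'x) set" where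
  "policies P t S = measurable (hist P t) (restrict_space borel S)"

definition feasible_policy ::
  "('w, 'z::euclidean_space, 'x::euclidean_space) msp \<Rightarrow> (nat \<Rightarrow> (nat \<Rightarrow> 'z) \<Rightarrow> 'x) \<Rightarrow> bool" where
  "feasible_policy P X \<longleftrightarrow> (\<forall>t\<in>{1..horizon P}. X t \<in> policies P t (feas P t))"

definition induced :: "(nat \<Rightarrow> (nat \<Rightarrow> 'z) \<Rightarrow> 'x) \<Rightarrow> (nat \<Rightarrow> 'z) \<Rightarrow> nat \<Rightarrow> 'x" where
  "induced X \<xi> t = X t (trunc t \<xi>)"

definition feas_tuples :: "('w, 'z, 'x) msp \<Rightarrow> (nat \<Rightarrow> 'x) set" where
  "feas_tuples P = PiE {1..horizon P} (feas P)"

text \<open>Since the stage-0 space is \<open>{0}\<close>, the first cost has the dummy first argument \<open>0\<close>.\<close>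

definition objective ::
  "('w, 'z, 'x::euclidean_space) msp \<Rightarrow> (nat \<Rightarrow> 'x) \<Rightarrow> (nat \<Rightarrow> 'z) \<Rightarrow> real" where
  "objective P x \<xi> =
     cost P 1 0 (x 1) (\<xi> 1) + (\<Sum>t = 2..horizon P. cost P t (x (t - 1)) (x t) (\<xi> t))"

definition tnorm :: "('w, 'z, 'x::euclidean_space) msp \<Rightarrow> (nat \<Rightarrow> 'x) \<Rightarrow> real" where
  "tnorm P x = L2_set (\<lambda>t. norm (x t)) {1..horizon P}"

text \<open>The gradient of a function on the linear subspace \<open>E\<close>; it is unique as an element of \<open>E\<close>.\<close>

definition grad_on :: "'x::euclidean_space set \<Rightarrow> ('x \<Rightarrow> real) \<Rightarrow> 'x \<Rightarrow> 'x" where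
  "grad_on E g x = (THE d. d \<in> E \<and> (g has_derivative (\<lambda>h. d \<bullet> h)) (at x within E))"

definition dcost_prev ::
  "('w, 'z, 'x::euclidean_space) msp \<Rightarrow> nat \<Rightarrow> 'x \<Rightarrow> 'x \<Rightarrow> 'z \<Rightarrow> 'x" where
  "dcost_prev P t x y z = grad_on (dspace P (t - 1)) (\<lambda>x'. cost P t x' y z) x"

definition dcost_cur ::
  "('w, 'z, 'x::euclidean_space) msp \<Rightarrow> nat \<Rightarrow> 'x \<Rightarrow> 'x \<Rightarrow> 'z \<Rightarrow> 'x" where
  "dcost_cur P t x y z = grad_on (dspace P t) (\<lambda>y'. cost P t x y' z) y"

text \<open>The block of the gradient of the objective belonging to the decision of stage \<open>t\<close>.\<close>

definition dobj ::
  "('w, 'z, 'x::euclidean_space) msp \<Rightarrow> nat \<Rightarrow> (nat \<Rightarrow> 'x) \<Rightarrow> (nat \<Rightarrow> 'z) \<Rightarrow> 'x" where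
  "dobj P t x \<xi> = grad_on (dspace P t) (\<lambda>y. objective P (x(t := y)) \<xi>) (x t)"

definition joint_alg ::
  "('w, 'z::euclidean_space, 'x::euclidean_space) msp \<Rightarrow> nat \<Rightarrow> ('x \<times> 'x \<times> 'z) measure" where
  "joint_alg P t =
     restrict_space borel (dspace P (t - 1)) \<Otimes>\<^sub>M restrict_space borel (dspace P t) \<Otimes>\<^sub>M supp_alg P t"

text \<open>
  An optimal policy has a finite optimal value; policies for which the expectation does not
  exist are not compared (there are none if the gradient of the objective is bounded).
\<close>

definition optimal_policy ::
  "('w, 'z::euclidean_space, 'x::euclidean_space) msp \<Rightarrow> (nat \<Rightarrow> (nat \<Rightarrow> 'z) \<Rightarrow> 'x) \<Rightarrow> bool" where
  "optimal_policy P Xs \<longleftrightarrow>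
     feasible_policy P Xs \<and>
     integrable (base P) (\<lambda>\<omega>. objective P (induced Xs (scenario P \<omega>)) (scenario P \<omega>)) \<and>
     (\<forall>X. feasible_policy P X \<longrightarrow>
        integrable (base P) (\<lambda>\<omega>. objective P (induced X (scenario P \<omega>)) (scenario P \<omega>)) \<longrightarrow>
        (\<integral>\<omega>. objective P (induced Xs (scenario P \<omega>)) (scenario P \<omega>) \<partial>base P)
          \<le> (\<integral>\<omega>. objective P (induced X (scenario P \<omega>)) (scenario P \<omega>) \<partial>base P))"

definition standing ::
  "('w, 'z::euclidean_space, 'x::euclidean_space) msp \<Rightarrow> (nat \<Rightarrow> (nat \<Rightarrow> 'z) \<Rightarrow> 'x) \<Rightarrow> bool" where
  "standing P Xs \<longleftrightarrow>
     prob_space (base P) \<and> 1 \<le> horizon P \<and>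
     (\<forall>t\<in>{1..horizon P}. noise P t \<in> measurable (base P) (supp_alg P t)) \<and>
     is_singleton (supp P 1) \<and>
     dspace P 0 = {0} \<and>
     (\<forall>t\<in>{1..horizon P}.
        subspace (dspace P t) \<and>
        feas P t \<subseteq> dspace P t \<and> feas P t \<noteq> {} \<and> compact (feas P t) \<and> convex (feas P t) \<and>
        (\<forall>z\<in>supp P t.
           convex_on (dspace P (t - 1) \<times> dspace P t) (\<lambda>(x, y). cost P t x y z) \<and>
           (\<lambda>(x, y). cost P t x y z) differentiable_on (dspace P (t - 1) \<times> dspace P t)) \<and>
        (\<lambda>(x, y, z). cost P t x y z) \<in> borel_measurable (joint_alg P t) \<and>
        (\<lambda>(x, y, z). dcost_prev P t x y z) \<in> borel_measurable (joint_alg P t) \<and>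
        (\<lambda>(x, y, z). dcost_cur P t x y z) \<in> borel_measurable (joint_alg P t)) \<and>
     optimal_policy P Xs"

definition gapU ::
  "('w, 'z, 'x::euclidean_space) msp \<Rightarrow> (nat \<Rightarrow> (nat \<Rightarrow> 'z) \<Rightarrow> 'x) \<Rightarrow> (nat \<Rightarrow> (nat \<Rightarrow> 'z) \<Rightarrow> 'x) \<Rightarrow> real" where
  "gapU P Xs X =
     (\<integral>\<omega>. objective P (induced X (scenario P \<omega>)) (scenario P \<omega>)
           - objective P (induced Xs (scenario P \<omega>)) (scenario P \<omega>) \<partial>base P)"


section \<open>Distance generating functions\<close>

definition dgf_dom :: "'x::euclidean_space set \<Rightarrow> 'x set \<Rightarrow> ('x \<Rightarrow> real) \<Rightarrow> 'x set" where
  "dgf_dom E K v = {x \<in> K. \<exists>g\<in>E. is_arg_min (\<lambda>x'. v x' + g \<bullet> x') (\<lambda>x'. x' \<in> K) x}"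

text \<open>
  \<open>dv\<close> is the gradient of the restriction of \<open>v\<close> to \<open>dgf_dom E K v\<close>. It is unique up to
  components orthogonal to the affine hull of \<open>K\<close>, and these do not influence the Bregman divergence.
\<close>

definition is_dgf ::
  "'x::euclidean_space set \<Rightarrow> 'x set \<Rightarrow> ('x \<Rightarrow> real) \<Rightarrow> ('x \<Rightarrow> 'x) \<Rightarrow> bool" where
  "is_dgf E K v dv \<longleftrightarrow>
     convex_on K v \<and> continuous_on K v \<and> convex (dgf_dom E K v) \<and>
     (\<forall>x\<in>dgf_dom E K v. dv x \<in> E \<and>
        (v has_derivative (\<lambda>h. dv x \<bullet> h)) (at x within dgf_dom E K v)) \<and>
     continuous_on (dgf_dom E K v) dv \<and>
     (\<forall>x\<in>dgf_dom E K v. \<forall>x'\<in>dgf_dom E K v.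
        (x' - x) \<bullet> (dv x' - dv x) \<ge> (norm (x' - x))\<^sup>2)"

definition bregman :: "('x::euclidean_space \<Rightarrow> real) \<Rightarrow> ('x \<Rightarrow> 'x) \<Rightarrow> 'x \<Rightarrow> 'x \<Rightarrow> real" where
  "bregman v dv y x = v y - v x - dv x \<bullet> (y - x)"

text \<open>The Bregman divergence of the separable function \<open>x \<mapsto> \<Sum>t. v t (x t)\<close> on tuples.\<close>

definition bregman_tuple ::
  "('w, 'z, 'x::euclidean_space) msp \<Rightarrow> (nat \<Rightarrow> 'x \<Rightarrow> real) \<Rightarrow> (nat \<Rightarrow> 'x \<Rightarrow> 'x)
     \<Rightarrow> (nat \<Rightarrow> 'x) \<Rightarrow> (nat \<Rightarrow> 'x) \<Rightarrow> real" where
  "bregman_tuple P v dv y x =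
     (\<Sum>t = 1..horizon P. v t (y t)) - (\<Sum>t = 1..horizon P. v t (x t))
       - (\<Sum>t = 1..horizon P. dv t (x t) \<bullet> (y t - x t))"

definition dgf_setup ::
  "('w, 'z::euclidean_space, 'x::euclidean_space) msp \<Rightarrow> (nat \<Rightarrow> 'x \<Rightarrow> real) \<Rightarrow> (nat \<Rightarrow> 'x \<Rightarrow> 'x) \<Rightarrow> bool" where
  "dgf_setup P v dv \<longleftrightarrow>
     (\<forall>t\<in>{1..horizon P}.
        is_dgf (dspace P t) (feas P t) (v t) (dv t) \<and>
        (\<forall>X\<in>policies P t (dgf_dom (dspace P t) (feas P t) (v t)).
           (\<lambda>s. dv t (X s)) \<in> borel_measurable (hist P t)))"


section \<open>Conditional laws and conditional scenario samplers\<close>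

definition unif01 :: "real measure" where
  "unif01 = restrict_space lborel {0..1}"

definition hist_sigma :: "('w, 'z::euclidean_space, 'x) msp \<Rightarrow> nat \<Rightarrow> 'w measure" where
  "hist_sigma P t = vimage_algebra (space (base P)) (\<lambda>\<omega>. trunc t (scenario P \<omega>)) (hist P t)"

text \<open>
  \<open>Q t s\<close> is a version, fixed for every history \<open>s\<close>, of the conditional law of the whole path
  given that the history up to stage \<open>t\<close> equals \<open>s\<close>. All conditional laws and conditional
  expectations given a value of the history refer to this version.
\<close>

definition cond_law ::
  "('w, 'z::euclidean_space, 'x) msp \<Rightarrow> (nat \<Rightarrow> (nat \<Rightarrow> 'z) \<Rightarrow> (nat \<Rightarrow> 'z) measure) \<Rightarrow> bool" where
  "cond_law P Q \<longleftrightarrow>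
     (\<forall>t\<in>{1..horizon P}.
        Q t \<in> measurable (hist P t) (prob_algebra (hist P (horizon P))) \<and>
        (\<forall>B\<in>sets (hist P (horizon P)). AE \<omega> in base P.
           measure (Q t (trunc t (scenario P \<omega>))) B
             = real_cond_exp (base P) (hist_sigma P t) (\<lambda>\<omega>'. indicator B (scenario P \<omega>')) \<omega>))"

definition tv_dist :: "'a measure \<Rightarrow> 'a measure \<Rightarrow> real" where
  "tv_dist M N = (SUP A\<in>sets M. \<bar>measure M A - measure N A\<bar>)"

definition biased_sampler ::
  "('w, 'z::euclidean_space, 'x) msp \<Rightarrow> (nat \<Rightarrow> (nat \<Rightarrow> 'z) \<Rightarrow> (nat \<Rightarrow> 'z) measure)
     \<Rightarrow> nat \<Rightarrow> real \<Rightarrow> ((nat \<Rightarrow> 'z) \<Rightarrow> real \<Rightarrow> 'z) \<Rightarrow> bool" where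
  "biased_sampler P Q t \<beta> smp \<longleftrightarrow>
     case_prod smp \<in> measurable (hist P (t - 1) \<Otimes>\<^sub>M unif01) (supp_alg P t) \<and>
     (\<forall>s\<in>space (hist P (t - 1)).
        tv_dist (distr unif01 (supp_alg P t) (smp s))
                (distr (Q (t - 1) s) (supp_alg P t) (\<lambda>\<xi>. \<xi> t)) \<le> \<beta>)"


section \<open>Stochastic conditional gradients\<close>

definition scg ::
  "('w, 'z, 'x::euclidean_space) msp \<Rightarrow> (nat \<Rightarrow> (nat \<Rightarrow> 'z) \<Rightarrow> real \<Rightarrow> 'z)
     \<Rightarrow> (nat \<Rightarrow> (nat \<Rightarrow> 'z) \<Rightarrow> 'x) \<Rightarrow> nat \<Rightarrow> (nat \<Rightarrow> 'z) \<Rightarrow> real \<Rightarrow> 'x" where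
  "scg P smp X t s u =
     dcost_cur P t (if t = 1 then 0 else X (t - 1) (trunc (t - 1) s)) (X t s) (s t) +
     (if t < horizon P
      then let z = smp (t + 1) s u
           in dcost_prev P (t + 1) (X t s) (X (t + 1) (s(t + 1 := z))) z
      else 0)"

definition cond_grad ::
  "('w, 'z, 'x::euclidean_space) msp \<Rightarrow> (nat \<Rightarrow> (nat \<Rightarrow> 'z) \<Rightarrow> (nat \<Rightarrow> 'z) measure)
     \<Rightarrow> (nat \<Rightarrow> (nat \<Rightarrow> 'z) \<Rightarrow> 'x) \<Rightarrow> nat \<Rightarrow> (nat \<Rightarrow> 'z) \<Rightarrow> 'x" where
  "cond_grad P Q X t s = (\<integral>\<xi>. dobj P t (induced X \<xi>) \<xi> \<partial>Q t s)"

definition bias_const :: "('w, 'z, 'x) msp \<Rightarrow> (nat \<Rightarrow> real) \<Rightarrow> (nat \<Rightarrow> real) \<Rightarrow> nat \<Rightarrow> real" where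
  "bias_const P \<beta> Lip t = (if t = horizon P then 0 else 2 * \<beta> (t + 1) * Lip t)"

definition scg_constants ::
  "('w, 'z::euclidean_space, 'x::euclidean_space) msp
     \<Rightarrow> (nat \<Rightarrow> (nat \<Rightarrow> 'z) \<Rightarrow> (nat \<Rightarrow> 'z) measure) \<Rightarrow> (nat \<Rightarrow> (nat \<Rightarrow> 'z) \<Rightarrow> real \<Rightarrow> 'z)
     \<Rightarrow> (nat \<Rightarrow> real) \<Rightarrow> (nat \<Rightarrow> real) \<Rightarrow> (nat \<Rightarrow> real) \<Rightarrow> bool" where
  "scg_constants P Q smp \<beta> Lip \<sigma> \<longleftrightarrow>
     (\<forall>t\<in>{1..horizon P}.
        (\<forall>x\<in>feas_tuples P. \<forall>\<xi>\<in>space (hist P (horizon P)). norm (dobj P t x \<xi>) \<le> Lip t) \<and>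
        \<sigma> t \<le> 2 * Lip t \<and>
        (\<forall>X \<xi>. feasible_policy P X \<and> \<xi> \<in> space (hist P (horizon P)) \<longrightarrow>
           norm ((\<integral>u. scg P smp X t (trunc t \<xi>) u \<partial>unif01) - cond_grad P Q X t (trunc t \<xi>))
             \<le> bias_const P \<beta> Lip t \<and>
           (\<integral>u. (norm (scg P smp X t (trunc t \<xi>) u
                     - (\<integral>u'. scg P smp X t (trunc t \<xi>) u' \<partial>unif01)))\<^sup>2 \<partial>unif01) \<le> (\<sigma> t)\<^sup>2))"


section \<open>Accelerated mirror descent\<close>

definition seeds :: "'v measure \<Rightarrow> nat \<Rightarrow> nat \<Rightarrow> (nat \<Rightarrow> nat \<Rightarrow> 'v \<Rightarrow> real) \<Rightarrow> bool" where
  "seeds M T L \<zeta> \<longleftrightarrow>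
     prob_space.indep_vars M (\<lambda>_. unif01) (\<lambda>(t, l). \<zeta> t l) ({1..T} \<times> {0..L}) \<and>
     (\<forall>t\<in>{1..T}. \<forall>l\<in>{0..L}. distr M unif01 (\<zeta> t l) = unif01)"

definition amd_steps ::
  "real \<Rightarrow> real \<Rightarrow> real \<Rightarrow> real \<Rightarrow> nat \<Rightarrow> (nat \<Rightarrow> real) \<Rightarrow> (nat \<Rightarrow> real) \<Rightarrow> bool" where
  "amd_steps \<gamma> \<theta> \<mu> L2 L \<alpha> A \<longleftrightarrow>
     \<alpha> 0 = 1 \<and> A 0 = 1 \<and>
     (\<forall>l\<le>L. \<alpha> (l + 1) > 0 \<and>
        (1 + \<gamma>) * L2 + (1 - \<theta>) * \<mu> * A l = (1 + \<gamma>) * L2 * (\<alpha> (l + 1))\<^sup>2 / (A l + \<alpha> (l + 1)) \<and>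
        A (l + 1) = A l + \<alpha> (l + 1))"

text \<open>
  A run of the algorithm for the seed realization \<open>z\<close>: \<open>X l t\<close>, \<open>Xp l t\<close>, \<open>Xm l t\<close> are the
  stage-\<open>t\<close> policies \<open>X\<close>, \<open>X+\<close>, \<open>X-\<close> of iteration \<open>l\<close>. All of them are
  determined on the histories up to stage \<open>t\<close> since the two minimizers are unique.
\<close>

definition amd_run ::
  "('w, 'z::euclidean_space, 'x::euclidean_space) msp \<Rightarrow> (nat \<Rightarrow> (nat \<Rightarrow> 'z) \<Rightarrow> real \<Rightarrow> 'z)
     \<Rightarrow> (nat \<Rightarrow> 'x \<Rightarrow> real) \<Rightarrow> (nat \<Rightarrow> 'x \<Rightarrow> 'x)
     \<Rightarrow> real \<Rightarrow> real \<Rightarrow> real \<Rightarrow> real \<Rightarrow> nat \<Rightarrow> (nat \<Rightarrow> real) \<Rightarrow> (nat \<Rightarrow> real)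
     \<Rightarrow> (nat \<Rightarrow> (nat \<Rightarrow> 'z) \<Rightarrow> 'x) \<Rightarrow> (nat \<Rightarrow> nat \<Rightarrow> real)
     \<Rightarrow> (nat \<Rightarrow> nat \<Rightarrow> (nat \<Rightarrow> 'z) \<Rightarrow> 'x) \<Rightarrow> (nat \<Rightarrow> nat \<Rightarrow> (nat \<Rightarrow> 'z) \<Rightarrow> 'x)
     \<Rightarrow> (nat \<Rightarrow> nat \<Rightarrow> (nat \<Rightarrow> 'z) \<Rightarrow> 'x) \<Rightarrow> bool" where
  "amd_run P smp v dv \<gamma> \<theta> \<mu> L2 L \<alpha> A X0 z X Xp Xm \<longleftrightarrow>
     (let G = (\<lambda>l t s. scg P smp (X l) t s (z t l)) in
      (\<forall>t\<in>{1..horizon P}. \<forall>s\<in>space (hist P t).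
         X 0 t s = X0 t s \<and>
         (\<forall>l\<le>L.
            is_arg_min
              (\<lambda>x. G l t s \<bullet> (x - X l t s) + (1 + \<gamma>) * L2 / 2 * (norm (x - X l t s))\<^sup>2)
              (\<lambda>x. x \<in> feas P t) (Xp l t s) \<and>
            is_arg_min
              (\<lambda>x. (1 + \<gamma>) * L2 * bregman (v t) (dv t) x (X0 t s) +
                (\<Sum>l' = 0..l. \<alpha> l' *
                   (G l' t s \<bullet> (x - X l' t s) + (1 - \<theta>) * \<mu> / 2 * (norm (x - X l' t s))\<^sup>2)))
              (\<lambda>x. x \<in> feas P t) (Xm l t s) \<and>
            X (l + 1) t s =
              (\<alpha> (l + 1) / A (l + 1)) *\<^sub>R Xm l t s + (1 - \<alpha> (l + 1) / A (l + 1)) *\<^sub>R Xp l t s)))"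

end

theory Submission
  imports Defs
begin

text \<open>
  The algorithm is an accelerated gradient method in the space of policies, where the inner product of
  two policies is the expected inner product of the decisions that they induce. In this space the
  stage-\<open>t\<close> block of the gradient of the expected cost is the conditional mean, given the history up to
  stage \<open>t\<close>, of the block of the pathwise gradient. The oracle reproduces this conditional mean up to a
  bias and a noise. Its difference to the pathwise gradient itself is not small, so that the proof has
  to decide with care where to work path by path and where to take expectations.

  For a fixed path and fixed seeds, two inequalities that are linear in the gradients are added. The
  first, \<open>stage_regret\<close>, is the estimate sequence argument: it uses only that the two steps of the
  algorithm are minimizers and that a distance generating function is strongly convex, and it speaks of
  the oracle's gradients. The second, \<open>accelerated_telescoping\<close>, uses only the curvature bounds, and it
  speaks of the pathwise gradients. In the sum (\<open>pathwise_bound\<close>), \<open>A L\<close> times the optimality gap on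
  the path is at most \<open>2 * L2\<close> times the initial divergence plus terms that pair the error of the
  oracle with three directions: \<open>Xstar - X\<close>, \<open>X - X+\<close>, and \<open>X+\<close> of the last iteration minus the
  current \<open>X\<close>. As \<open>\<gamma> = 1\<close> and \<open>\<theta> = 1/2\<close> leave some of the smoothness and some of the strong
  convexity unspent, each term also contains the squared norm of its direction, with coefficient
  \<open>- \<mu> / 4\<close>, \<open>- L2 / 2\<close> and \<open>- \<mu> / 2\<close>, respectively.

  Expectations then remove the parts of the error that are not small. The directions at stage \<open>t\<close> are
  functions of the history, so in the mean over the path the pathwise gradient may be replaced by its
  conditional mean (\<open>disintegration\<close>, \<open>err_integral\<close>). The first and the third direction do not depend
  on the seeds of the current iteration; redrawing these seeds (\<open>resampling\<close>) shows that the noise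
  contributes nothing in the mean over the seeds, and only the bias remains. It costs at most \<open>b * D\<close>,
  or, by Young's inequality, a multiple of \<open>b\<^sup>2 / \<mu>\<close>. The second direction does depend on the current
  seeds, and there Young's inequality against the term in \<open>L2 / 2\<close> leaves the mean square of the error,
  which is at most \<open>b\<^sup>2 + \<sigma>\<^sup>2\<close>. Dividing by \<open>A L\<close> gives the two rates, since \<open>A\<close> grows
  quadratically for \<open>\<mu> = 0\<close> and at least like \<open>\<rho> ^ (- l)\<close> for \<open>\<mu> > 0\<close>.

  The mean over the seeds presupposes that the iterates are measurable jointly in the seeds and the
  history. They are therefore constructed anew as an explicit function of the vector of seeds, from
  continuous projections and proximal maps, and \<open>run_unique\<close> identifies every run with this function.
\<close>

section \<open>Two elementary inequalities\<close>

text \<open>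
  Turns an inequality along a segment into a first-order condition at its end point.
\<close>

lemma nonneg_by_limit:
  fixes p r :: real
  assumes "\<And>s. 0 < s \<Longrightarrow> s \<le> 1 \<Longrightarrow> 0 \<le> p + s * r"
  shows "0 \<le> p"
proof (rule tendsto_lowerbound)
  show "((\<lambda>s. p + s * r) \<longlongrightarrow> p) (at_right 0)"
    by (auto intro!: tendsto_eq_intros)
  show "\<forall>\<^sub>F s in at_right 0. 0 \<le> p + s * r"
    unfolding eventually_at_right_field by (intro exI[of _ 1]) (use assms in auto)
qed simp

lemma young_inner:
  fixes d w :: "'a::real_inner"
  assumes "c > 0"
  shows "d \<bullet> w - c * (norm w)\<^sup>2 \<le> (norm d)\<^sup>2 / (4 * c)"
proof -
  have "d \<bullet> w \<le> norm d * norm w" by (rule norm_cauchy_schwarz)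
  moreover have "0 \<le> (norm d - 2 * c * norm w)\<^sup>2 / (4 * c)" using assms by simp
  moreover have "(norm d - 2 * c * norm w)\<^sup>2 / (4 * c)
      = (norm d)\<^sup>2 / (4 * c) - norm d * norm w + c * (norm w)\<^sup>2"
    using assms by (simp add: field_simps power2_eq_square)
  ultimately show ?thesis by linarith
qed

section \<open>Growth of the step sizes\<close>

lemma amd_stepsD:
  assumes "amd_steps 1 (1/2) \<mu> L2 L \<alpha> A"
  shows "\<alpha> 0 = 1" "A 0 = 1"
    and "\<And>l. l \<le> L \<Longrightarrow> \<alpha> (Suc l) > 0"
    and "\<And>l. l \<le> L \<Longrightarrow> A (Suc l) = A l + \<alpha> (Suc l)"
    and "\<And>l. l \<le> L \<Longrightarrow> 2 * L2 + \<mu> / 2 * A l = 2 * L2 * (\<alpha> (Suc l))\<^sup>2 / A (Suc l)"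
  using assms unfolding amd_steps_def by auto

lemma amd_steps_sum:
  assumes "amd_steps 1 (1/2) \<mu> L2 L \<alpha> A" "l \<le> Suc L"
  shows "(\<Sum>l'=0..l. \<alpha> l') = A l" and "A l \<ge> 1" and "\<alpha> l > 0"
proof -
  note st = amd_stepsD[OF assms(1)]
  have "l \<le> Suc L \<Longrightarrow> (\<Sum>l'=0..l. \<alpha> l') = A l \<and> A l \<ge> 1 \<and> \<alpha> l > 0"
  proof (induction l)
    case (Suc l) then show ?case using st(3)[of l] st(4)[of l] by auto
  qed (use st in auto)
  then show "(\<Sum>l'=0..l. \<alpha> l') = A l" "A l \<ge> 1" "\<alpha> l > 0" using assms(2) by auto
qed

text \<open>
  For \<open>\<mu> = 0\<close> the step equation becomes \<open>(\<alpha> (Suc l))\<^sup>2 = A (Suc l) = (\<alpha> l)\<^sup>2 + \<alpha> (Suc l)\<close>, so each step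
  increases \<open>\<alpha>\<close> by at least \<open>1/2\<close> and at most \<open>1\<close>.
\<close>

lemma amd_steps_quadratic:
  assumes "amd_steps 1 (1/2) 0 L2 L \<alpha> A" "L2 > 0" "l \<le> Suc L"
  shows "A l = (\<alpha> l)\<^sup>2 \<and> 1 + real l / 2 \<le> \<alpha> l \<and> \<alpha> l \<le> real l + 1"
  using assms(3)
proof (induction l)
  case 0 then show ?case using amd_stepsD[OF assms(1)] by simp
next
  case (Suc l)
  then have IH: "A l = (\<alpha> l)\<^sup>2" "1 + real l / 2 \<le> \<alpha> l" "\<alpha> l \<le> real l + 1" and l: "l \<le> L" by auto
  note st = amd_stepsD[OF assms(1)]
  have pos: "A (Suc l) > 0" using amd_steps_sum(2)[OF assms(1) Suc.prems] by simp
  have sq: "A (Suc l) = (\<alpha> (Suc l))\<^sup>2"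
    using st(5)[OF l] assms(2) pos by (simp add: field_simps)
  have eq: "(\<alpha> (Suc l))\<^sup>2 = (\<alpha> l)\<^sup>2 + \<alpha> (Suc l)" using st(4)[OF l] sq IH(1) by simp
  have p: "\<alpha> (Suc l) > 0" using st(3)[OF l] .
  have "\<alpha> l + 1/2 \<le> \<alpha> (Suc l)"
  proof (rule ccontr)
    assume "\<not> ?thesis"
    then have "\<bar>\<alpha> (Suc l) - 1/2\<bar> < \<alpha> l" using p IH(2) by (auto simp: abs_less_iff)
    then have "(\<alpha> (Suc l) - 1/2)\<^sup>2 < (\<alpha> l)\<^sup>2"
      by (metis abs_ge_zero abs_le_square_iff abs_of_nonneg dual_order.strict_trans1 not_less
          order.strict_implies_order)
    then show False using eq by (simp add: power2_eq_square algebra_simps)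
  qed
  moreover have "\<alpha> (Suc l) \<le> \<alpha> l + 1"
  proof (rule ccontr)
    assume c: "\<not> ?thesis"
    then have "(\<alpha> l + 1) * \<alpha> l < \<alpha> (Suc l) * (\<alpha> (Suc l) - 1)"
      using IH(2) by (intro mult_strict_mono) auto
    then show False using eq IH(2) by (simp add: power2_eq_square algebra_simps)
  qed
  ultimately show ?case using IH sq by (simp add: field_simps)
qed

text \<open>
  \<open>A l\<close> grows like a square, so that its sum is about \<open>l / 3\<close> times \<open>A l\<close>. The larger factor here leaves
  room for an induction that needs only \<open>\<alpha> l \<le> l + 1\<close> and the monotonicity of \<open>\<alpha>\<close>.
\<close>

lemma amd_steps_quadratic_sum:
  assumes "amd_steps 1 (1/2) 0 L2 L \<alpha> A" "L2 > 0" "l \<le> L"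
  shows "(\<Sum>l'=0..l. A l') \<le> 2/3 * (real l + 3) * A l"
  using assms(3)
proof (induction l)
  case 0 then show ?case using amd_stepsD[OF assms(1)] by simp
next
  case (Suc l)
  note st = amd_stepsD[OF assms(1)]
  have q: "A l = (\<alpha> l)\<^sup>2" "1 + real l / 2 \<le> \<alpha> l" "\<alpha> l \<le> real l + 1"
    using amd_steps_quadratic[OF assms(1,2), of l] Suc by auto
  have q': "A (Suc l) = (\<alpha> (Suc l))\<^sup>2"
    using amd_steps_quadratic[OF assms(1,2), of "Suc l"] Suc by auto
  have A': "A (Suc l) = A l + \<alpha> (Suc l)" using st(4)[of l] Suc by simp
  have "\<alpha> l \<le> \<alpha> (Suc l)"
    using power2_le_imp_le[of "\<alpha> l" "\<alpha> (Suc l)"] q(1) q' A' st(3)[of l] Suc.prems by linarith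
  then have "\<alpha> l * \<alpha> l \<le> (2 * real l + 5) * \<alpha> (Suc l)"
    using q(2,3) by (intro mult_mono) auto
  then have "A l \<le> (2 * real l + 5) * \<alpha> (Suc l)" using q(1) by (simp add: power2_eq_square)
  moreover have "(\<Sum>l'=0..l. A l') \<le> 2/3 * (real l + 3) * A l" using Suc by simp
  ultimately show ?case using A' by (simp add: algebra_simps)
qed

text \<open>
  Let \<open>x\<close> and \<open>y\<close> be the square roots of \<open>A l\<close> and \<open>A (Suc l)\<close>, and let \<open>k = 1/4 * sqrt (\<mu> / L2)\<close>.
  The step equation gives \<open>2 * k * x * y \<le> y\<^sup>2 - x\<^sup>2\<close>, so \<open>y / x\<close> is at least the positive root of
  \<open>r\<^sup>2 - 2 * k * r - 1\<close>, which is at least \<open>1 + k\<close>.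
\<close>

lemma amd_steps_geometric:
  assumes st: "amd_steps 1 (1/2) \<mu> L2 L \<alpha> A" and "L2 > 0" "\<mu> > 0"
    and \<rho>: "\<rho> = 1 / (1 + 1/4 * sqrt (\<mu> / L2))\<^sup>2" and "l \<le> L"
  shows "A l \<le> \<rho> * A (Suc l)"
proof -
  define k where "k = 1/4 * sqrt (\<mu> / L2)"
  have k: "k > 0" "\<mu> = 16 * k\<^sup>2 * L2" using assms(2,3) by (simp_all add: k_def power_mult_distrib field_simps)
  note s = amd_stepsD[OF st]
  have p: "A l \<ge> 1" "A (Suc l) \<ge> 1" using amd_steps_sum(2)[OF st] \<open>l \<le> L\<close> by auto
  have a: "\<alpha> (Suc l) = A (Suc l) - A l" "\<alpha> (Suc l) > 0" using s(4)[of l] s(3)[of l] \<open>l \<le> L\<close> by auto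
  have "2 * L2 * A (Suc l) + \<mu> / 2 * A l * A (Suc l) = 2 * L2 * (A (Suc l) - A l)\<^sup>2"
    using s(5)[of l] p a \<open>l \<le> L\<close> by (simp add: field_simps)
  then have "2 * L2 * (A (Suc l) + 4 * k\<^sup>2 * A l * A (Suc l)) = 2 * L2 * (A (Suc l) - A l)\<^sup>2"
    using k by (simp add: algebra_simps)
  then have e: "A (Suc l) + 4 * k\<^sup>2 * A l * A (Suc l) = (A (Suc l) - A l)\<^sup>2" using assms(2) by simp
  define x y where "x = sqrt (A l)" and "y = sqrt (A (Suc l))"
  have xy: "x > 0" "y > 0" "A l = x\<^sup>2" "A (Suc l) = y\<^sup>2" "x < y"
    using p a by (simp_all add: x_def y_def)
  have "(2 * k * x * y)\<^sup>2 \<le> (y\<^sup>2 - x\<^sup>2)\<^sup>2"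
  proof -
    have "(2 * k * x * y)\<^sup>2 = 4 * k\<^sup>2 * x\<^sup>2 * y\<^sup>2" by (simp add: power_mult_distrib)
    then show ?thesis using e zero_le_power2[of y] unfolding xy(3,4) by linarith
  qed
  then have "2 * k * x * y \<le> y\<^sup>2 - x\<^sup>2"
    by (rule power2_le_imp_le) (use xy in auto)
  moreover have "2 * k * x * x \<le> 2 * k * x * y" using xy k by simp
  ultimately have "y\<^sup>2 \<ge> x\<^sup>2 + 2 * k * x * y" by simp
  have "(1 + k) * x \<le> y"
  proof (rule ccontr)
    assume c: "\<not> ?thesis"
    \<comment> \<open>the quadratic \<open>y\<^sup>2 - 2 k x y - x\<^sup>2\<close> increases in \<open>y \<ge> k x\<close> and is negative at \<open>(1 + k) x\<close>\<close>
    have "(y - k * x)\<^sup>2 \<ge> x\<^sup>2 + k\<^sup>2 * x\<^sup>2" using \<open>y\<^sup>2 \<ge> _\<close> by (simp add: power2_eq_square algebra_simps)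
    moreover have "0 \<le> k\<^sup>2 * x\<^sup>2" by simp
    ultimately have "(y - k * x)\<^sup>2 \<ge> x\<^sup>2" by linarith
    moreover have "\<bar>y - k * x\<bar> < x"
    proof -
      have "0 < x\<^sup>2" using xy by simp
      then have "2 * k * x * y < y * y" using \<open>y\<^sup>2 \<ge> _\<close> unfolding power2_eq_square by linarith
      then have "2 * k * x < y" using xy by simp
      then show ?thesis using c xy k by (simp add: algebra_simps abs_less_iff)
    qed
    ultimately show False using power_strict_mono[of "\<bar>y - k * x\<bar>" x 2] by simp
  qed
  then have "((1 + k) * x)\<^sup>2 \<le> y\<^sup>2" using xy k by (intro power_mono) auto
  then have "(1 + k)\<^sup>2 * x\<^sup>2 \<le> y\<^sup>2" by (simp only: power_mult_distrib)
  moreover have "(1 + k)\<^sup>2 > 0" using k by simp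
  ultimately show ?thesis unfolding \<rho> k_def[symmetric] xy by (simp add: pos_le_divide_eq mult.commute)
qed

lemma amd_steps_geometric_sum:
  assumes st: "amd_steps 1 (1/2) \<mu> L2 L \<alpha> A" and "L2 > 0" "\<mu> > 0"
    and \<rho>: "\<rho> = 1 / (1 + 1/4 * sqrt (\<mu> / L2))\<^sup>2"
  shows "0 < \<rho>" "\<rho> < 1" and "1 \<le> \<rho> ^ L * A L" and "(1 - \<rho>) * (\<Sum>l=0..L. A l) \<le> A L"
proof -
  have k: "sqrt (\<mu> / L2) > 0" using assms by simp
  then have "(1 + 1/4 * sqrt (\<mu> / L2))\<^sup>2 > 1" by (intro one_less_power) auto
  moreover define q where "q = (1 + 1/4 * sqrt (\<mu> / L2))\<^sup>2"
  ultimately have "q > 1" "\<rho> = 1 / q" by (simp_all add: \<rho>)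
  then show r: "0 < \<rho>" "\<rho> < 1" by simp_all
  have g: "l \<le> L \<Longrightarrow> 1 \<le> \<rho> ^ l * A l \<and> (1 - \<rho>) * (\<Sum>l'=0..l. A l') \<le> A l" for l
  proof (induction l)
    case 0 then show ?case using amd_stepsD[OF st] r by simp
  next
    case (Suc l)
    have g: "A l \<le> \<rho> * A (Suc l)" using amd_steps_geometric[OF assms, of l] Suc by simp
    then have "\<rho> ^ l * A l \<le> \<rho> ^ l * (\<rho> * A (Suc l))" using r by (intro mult_left_mono) auto
    then have "1 \<le> \<rho> ^ Suc l * A (Suc l)" using Suc by (simp add: mult_ac)
    moreover have "(1 - \<rho>) * (\<Sum>l'=0..Suc l. A l') \<le> \<rho> * A (Suc l) + (1 - \<rho>) * A (Suc l)"
      using Suc g by (simp add: ring_distribs)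
    ultimately show ?case by (simp add: algebra_simps)
  qed
  show "1 \<le> \<rho> ^ L * A L" "(1 - \<rho>) * (\<Sum>l=0..L. A l) \<le> A L" using g[of L] by auto
qed

section \<open>Proximal steps\<close>

text \<open>
  The segment from \<open>x\<close> to \<open>y\<close> stays in the convex set \<open>dgf_dom E K v\<close>. By the monotonicity of \<open>dv\<close>, the
  derivative of \<open>v\<close> along it exceeds its initial value at time \<open>s\<close> by at least \<open>s * (norm (y - x))\<^sup>2\<close>;
  integrate.
\<close>

lemma dgf_bregman_ge:
  assumes dgf: "is_dgf E K v dv" and x: "x \<in> dgf_dom E K v" and y: "y \<in> dgf_dom E K v"
  shows "bregman v dv y x \<ge> 1/2 * (norm (y - x))\<^sup>2"
proof -
  let ?D = "dgf_dom E K v"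
  define p where "p s = x + s *\<^sub>R (y - x)" for s :: real
  have cv: "convex ?D" and der: "\<And>x. x \<in> ?D \<Longrightarrow> (v has_derivative (\<lambda>h. dv x \<bullet> h)) (at x within ?D)"
    and mono: "\<And>x x'. x \<in> ?D \<Longrightarrow> x' \<in> ?D \<Longrightarrow> (x' - x) \<bullet> (dv x' - dv x) \<ge> (norm (x' - x))\<^sup>2"
    using dgf unfolding is_dgf_def by auto
  have pD: "p s \<in> ?D" if "s \<in> {0..1}" for s
    using convexD_alt[OF cv x y, of s] that by (simp add: p_def algebra_simps)
  define \<phi> where "\<phi> s = v (p s) - s * (dv x \<bullet> (y - x)) - s\<^sup>2 / 2 * (norm (y - x))\<^sup>2" for s
  have d: "(\<phi> has_real_derivative (dv (p s) \<bullet> (y - x) - dv x \<bullet> (y - x) - s * (norm (y - x))\<^sup>2))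
      (at s within {0..1})" if s: "s \<in> {0..1}" for s
  proof -
    have "(p has_derivative (\<lambda>h. h *\<^sub>R (y - x))) (at s within {0..1})"
      unfolding p_def by (auto intro!: derivative_eq_intros)
    moreover have "(v has_derivative (\<lambda>h. dv (p s) \<bullet> h)) (at (p s) within p ` {0..1})"
      by (rule has_derivative_subset[OF der[OF pD[OF s]]]) (use pD in auto)
    ultimately have "((\<lambda>s. v (p s)) has_derivative (\<lambda>h. dv (p s) \<bullet> (h *\<^sub>R (y - x)))) (at s within {0..1})"
      by (rule has_derivative_in_compose)
    then have "((\<lambda>s. v (p s)) has_real_derivative (dv (p s) \<bullet> (y - x))) (at s within {0..1})"
      unfolding has_field_derivative_def by (simp add: mult.commute[of _ "dv (p s) \<bullet> (y - x)"])
    then show ?thesis unfolding \<phi>_def by (auto intro!: derivative_eq_intros)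
  qed
  have "\<phi> 0 \<le> \<phi> 1"
  proof (rule DERIV_nonneg_imp_increasing_open[of 0 1])
    show "continuous_on {0..1} \<phi>" by (rule DERIV_continuous_on[OF d])
    fix s :: real assume s: "0 < s" "s < 1"
    have "(\<phi> has_real_derivative (dv (p s) \<bullet> (y - x) - dv x \<bullet> (y - x) - s * (norm (y - x))\<^sup>2)) (at s)"
      using d[of s] s at_within_Icc_at[of 0 s 1] by simp
    moreover have "p s - x = s *\<^sub>R (y - x)" by (simp add: p_def)
    then have "s * ((y - x) \<bullet> (dv (p s) - dv x)) \<ge> s\<^sup>2 * (norm (y - x))\<^sup>2"
      using mono[OF x pD[of s]] s by (simp add: power_mult_distrib)
    then have "s * (dv (p s) \<bullet> (y - x) - dv x \<bullet> (y - x) - s * (norm (y - x))\<^sup>2) \<ge> 0"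
      by (simp add: inner_diff_left inner_diff_right inner_commute power2_eq_square[of s] algebra_simps)
    ultimately show "\<exists>y. (\<phi> has_real_derivative y) (at s) \<and> 0 \<le> y"
      using s by (auto simp: zero_le_mult_iff)
  qed simp
  then show ?thesis by (simp add: \<phi>_def p_def bregman_def)
qed

lemma dgf_strongly_convex:
  assumes dgf: "is_dgf E K v dv" and x: "x \<in> dgf_dom E K v" and y: "y \<in> dgf_dom E K v"
    and s: "0 \<le> s" "s \<le> 1"
  shows "v (x + s *\<^sub>R (y - x)) \<le> (1 - s) * v x + s * v y - s * (1 - s) / 2 * (norm (y - x))\<^sup>2"
proof -
  define p where "p = x + s *\<^sub>R (y - x)"
  have cv: "convex (dgf_dom E K v)" using dgf unfolding is_dgf_def by auto
  have p: "p \<in> dgf_dom E K v"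
    using convexD_alt[OF cv x y, of s] s by (simp add: p_def algebra_simps)
  have 1: "v x - v p + s * (dv p \<bullet> (y - x)) \<ge> 1/2 * s\<^sup>2 * (norm (y - x))\<^sup>2"
    using dgf_bregman_ge[OF dgf p x] by (simp add: bregman_def p_def power_mult_distrib)
  have yp: "y - p = (1 - s) *\<^sub>R (y - x)" by (simp add: p_def algebra_simps)
  have 2: "v y - v p - (1 - s) * (dv p \<bullet> (y - x)) \<ge> 1/2 * (1 - s)\<^sup>2 * (norm (y - x))\<^sup>2"
    using dgf_bregman_ge[OF dgf p y] s by (simp add: bregman_def yp power_mult_distrib)
  have "(1 - s) * (v x - v p + s * (dv p \<bullet> (y - x))) + s * (v y - v p - (1 - s) * (dv p \<bullet> (y - x)))
     \<ge> (1 - s) * (1/2 * s\<^sup>2 * (norm (y - x))\<^sup>2) + s * (1/2 * (1 - s)\<^sup>2 * (norm (y - x))\<^sup>2)"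
    using 1 2 s by (intro add_mono mult_left_mono) auto
  then show ?thesis unfolding p_def[symmetric] by (simp add: field_simps power2_eq_square)
qed

text \<open>
  Up to a constant, the objective that defines \<open>X-\<close>: the linear term collects all gradients, and the
  quadratic term all the terms in \<open>\<mu>\<close>.
\<close>

definition prox_obj :: "('x::euclidean_space \<Rightarrow> real) \<Rightarrow> real \<Rightarrow> real \<Rightarrow> 'x \<Rightarrow> 'x \<Rightarrow> real" where
  "prox_obj v M c a x = M * v x + a \<bullet> x + c / 2 * (norm x)\<^sup>2"

lemma norm_segment_sq:
  fixes x y :: "'a::real_inner"
  shows "(norm (x + s *\<^sub>R (y - x)))\<^sup>2
    = (1 - s) * (norm x)\<^sup>2 + s * (norm y)\<^sup>2 - s * (1 - s) * (norm (y - x))\<^sup>2"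
  unfolding power2_norm_eq_inner
  by (simp add: inner_add_left inner_add_right inner_diff_left inner_diff_right inner_commute algebra_simps)

text \<open>
  Since \<open>v\<close> is convex, a minimizer remains one when the quadratic is replaced by its linearization there;
  what is left is a linear perturbation of \<open>M * v\<close>.
\<close>

lemma prox_in_dgf_dom:
  assumes dgf: "is_dgf E K v dv" and E: "subspace E" "K \<subseteq> E" and K: "convex K"
    and M: "M > 0" and a: "a \<in> E"
    and x: "is_arg_min (prox_obj v M c a) (\<lambda>x. x \<in> K) x"
  shows "x \<in> dgf_dom E K v"
proof -
  have xK: "x \<in> K" and min: "\<And>y. y \<in> K \<Longrightarrow> prox_obj v M c a x \<le> prox_obj v M c a y"
    using x by (auto simp: is_arg_min_linorder)
  have cv: "convex_on K v" using dgf unfolding is_dgf_def by auto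
  define g where "g = (1 / M) *\<^sub>R (a + c *\<^sub>R x)"
  have gE: "g \<in> E" unfolding g_def using E xK a by (intro subspace_scale subspace_add) auto
  have "v x + g \<bullet> x \<le> v y + g \<bullet> y" if y: "y \<in> K" for y
  proof -
    have "0 \<le> M * (v y - v x) + (a + c *\<^sub>R x) \<bullet> (y - x)"
    proof (rule nonneg_by_limit)
      fix s :: real assume s: "0 < s" "s \<le> 1"
      define p where "p = x + s *\<^sub>R (y - x)"
      have pK: "p \<in> K" using convexD_alt[OF K xK y, of s] s by (simp add: p_def algebra_simps)
      have "v p \<le> (1 - s) * v x + s * v y"
        using convex_onD[OF cv, of s x y] s xK y by (simp add: p_def algebra_simps)
      then have "M * v p \<le> M * ((1 - s) * v x + s * v y)" using M by simp
      moreover have "M * v x + a \<bullet> x + c / 2 * (norm x)\<^sup>2 \<le> M * v p + a \<bullet> p + c / 2 * (norm p)\<^sup>2"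
        using min[OF pK] by (simp add: prox_obj_def)
      moreover have "c / 2 * (norm p)\<^sup>2 = c / 2 * (norm x)\<^sup>2 + s * (c * (x \<bullet> (y - x))) + s * (s * (c / 2 * (norm (y - x))\<^sup>2))"
        unfolding p_def power2_norm_eq_inner
        by (simp add: inner_add_left inner_add_right inner_diff_left inner_diff_right inner_commute algebra_simps)
      ultimately have "0 \<le> s * (M * (v y - v x) + (a + c *\<^sub>R x) \<bullet> (y - x) + s * (c / 2 * (norm (y - x))\<^sup>2))"
        by (simp add: p_def inner_add_left inner_add_right algebra_simps)
      then show "0 \<le> M * (v y - v x) + (a + c *\<^sub>R x) \<bullet> (y - x) + s * (c / 2 * (norm (y - x))\<^sup>2)"
        using s by (simp add: zero_le_mult_iff)
    qed
    then have "0 \<le> (M * (v y - v x) + (a + c *\<^sub>R x) \<bullet> (y - x)) / M" using M by simp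
    then show ?thesis using M by (simp add: g_def add_divide_distrib inner_diff_right algebra_simps diff_divide_distrib)
  qed
  then show ?thesis unfolding dgf_dom_def using gE xK by (auto simp: is_arg_min_linorder)
qed

text \<open>
  \<open>v\<close> is strongly convex on \<open>dgf_dom E K v\<close>, which contains the minimizer. The estimate results from
  comparing \<open>x\<close> with points on the segment to \<open>y\<close> that tend to \<open>x\<close>.
\<close>

lemma prox_growth:
  assumes dgf: "is_dgf E K v dv" and E: "subspace E" "K \<subseteq> E" and K: "convex K"
    and M: "M > 0" and a: "a \<in> E"
    and x: "is_arg_min (prox_obj v M c a) (\<lambda>x. x \<in> K) x"
    and y: "y \<in> dgf_dom E K v"
  shows "prox_obj v M c a x + (M + c) / 2 * (norm (y - x))\<^sup>2 \<le> prox_obj v M c a y"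
proof -
  have xD: "x \<in> dgf_dom E K v" by (rule prox_in_dgf_dom[OF assms(1-7)])
  have yK: "y \<in> K" using y by (simp add: dgf_dom_def)
  have xK: "x \<in> K" and min: "\<And>y. y \<in> K \<Longrightarrow> prox_obj v M c a x \<le> prox_obj v M c a y"
    using x by (auto simp: is_arg_min_linorder)
  have "0 \<le> (prox_obj v M c a y - prox_obj v M c a x - (M + c) / 2 * (norm (y - x))\<^sup>2)"
  proof (rule nonneg_by_limit)
    fix s :: real assume s: "0 < s" "s \<le> 1"
    define p where "p = x + s *\<^sub>R (y - x)"
    have pK: "p \<in> K" using convexD_alt[OF K xK yK, of s] s by (simp add: p_def algebra_simps)
    have "M * v p \<le> M * ((1 - s) * v x + s * v y - s * (1 - s) / 2 * (norm (y - x))\<^sup>2)"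
      unfolding p_def using dgf_strongly_convex[OF dgf xD y, of s] s M by (intro mult_left_mono) auto
    moreover have "prox_obj v M c a x \<le> M * v p + a \<bullet> p + c / 2 * (norm p)\<^sup>2"
      using min[OF pK] by (simp add: prox_obj_def)
    moreover have "(norm p)\<^sup>2 = (1 - s) * (norm x)\<^sup>2 + s * (norm y)\<^sup>2 - s * (1 - s) * (norm (y - x))\<^sup>2"
      unfolding p_def by (rule norm_segment_sq)
    moreover have "a \<bullet> p = (1 - s) * (a \<bullet> x) + s * (a \<bullet> y)"
      by (simp add: p_def inner_add_right inner_diff_right algebra_simps)
    ultimately have "0 \<le> s * ((prox_obj v M c a y - prox_obj v M c a x - (M + c) / 2 * (norm (y - x))\<^sup>2)
        + s * ((M + c) / 2 * (norm (y - x))\<^sup>2))"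
      unfolding prox_obj_def by (simp add: field_simps)
    then show "0 \<le> (prox_obj v M c a y - prox_obj v M c a x - (M + c) / 2 * (norm (y - x))\<^sup>2)
        + s * ((M + c) / 2 * (norm (y - x))\<^sup>2)"
      using s by (simp add: zero_le_mult_iff)
  qed
  then show ?thesis by simp
qed

text \<open>
  Insert each of the two minimizers into the growth estimate of the other one and add. This yields
  uniqueness of the proximal point, and its continuity and hence measurability in the slope.
\<close>

lemma prox_lipschitz:
  assumes dgf: "is_dgf E K v dv" and E: "subspace E" "K \<subseteq> E" and K: "convex K"
    and M: "M > 0" "c \<ge> 0" and a: "a \<in> E" "a' \<in> E"
    and x: "is_arg_min (prox_obj v M c a) (\<lambda>x. x \<in> K) x"
    and x': "is_arg_min (prox_obj v M c a') (\<lambda>x. x \<in> K) x'"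
  shows "M * norm (x - x') \<le> norm (a - a')"
proof -
  note g = prox_growth[OF dgf E K M(1)] and d = prox_in_dgf_dom[OF dgf E K M(1)]
  have "(M + c) * (norm (x - x'))\<^sup>2 \<le> (a' - a) \<bullet> (x - x')"
    using g[OF a(1) x d[OF a(2) x']] g[OF a(2) x' d[OF a(1) x]]
    by (simp add: prox_obj_def inner_diff_left inner_diff_right norm_minus_commute field_simps)
  also have "\<dots> \<le> norm (a - a') * norm (x - x')"
    using norm_cauchy_schwarz[of "a' - a" "x - x'"] by (simp add: norm_minus_commute)
  finally have "((M + c) * norm (x - x')) * norm (x - x') \<le> norm (a - a') * norm (x - x')"
    by (simp add: power2_eq_square mult_ac)
  then have "(M + c) * norm (x - x') \<le> norm (a - a')"
    by (cases "x = x'") auto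
  moreover have "M * norm (x - x') \<le> (M + c) * norm (x - x')" using M by (intro mult_right_mono) auto
  ultimately show ?thesis by linarith
qed

definition prox :: "'x::euclidean_space set \<Rightarrow> ('x \<Rightarrow> real) \<Rightarrow> real \<Rightarrow> real \<Rightarrow> 'x \<Rightarrow> 'x" where
  "prox K v M c a = (SOME x. is_arg_min (prox_obj v M c a) (\<lambda>x. x \<in> K) x)"

lemma prox_is_arg_min:
  assumes "continuous_on K v" "compact K" "K \<noteq> {}"
  shows "is_arg_min (prox_obj v M c a) (\<lambda>x. x \<in> K) (prox K v M c a)"
  unfolding prox_def
proof (rule someI_ex)
  have "continuous_on K (prox_obj v M c a)"
    unfolding prox_obj_def by (intro continuous_intros assms)
  from continuous_attains_inf[OF assms(2,3) this]
  show "\<exists>x. is_arg_min (prox_obj v M c a) (\<lambda>x. x \<in> K) x" by (auto simp: is_arg_min_linorder)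
qed

lemma prox_unique:
  assumes dgf: "is_dgf E K v dv" and E: "subspace E" "K \<subseteq> E" and K: "convex K" "compact K"
    and M: "M > 0" "c \<ge> 0" and a: "a \<in> E"
    and x: "is_arg_min (prox_obj v M c a) (\<lambda>x. x \<in> K) x"
  shows "x = prox K v M c a"
proof -
  have "continuous_on K v" using dgf by (simp add: is_dgf_def)
  moreover have "K \<noteq> {}" using x by (auto simp: is_arg_min_linorder)
  ultimately have "is_arg_min (prox_obj v M c a) (\<lambda>x. x \<in> K) (prox K v M c a)"
    using K(2) by (intro prox_is_arg_min) auto
  from prox_lipschitz[OF dgf E K(1) M a a x this] M show ?thesis by (simp add: mult_le_0_iff)
qed

lemma continuous_on_prox:
  assumes dgf: "is_dgf E K v dv" and E: "subspace E" "K \<subseteq> E" and K: "convex K" "compact K" "K \<noteq> {}"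
    and M: "M > 0" "c \<ge> 0"
  shows "continuous_on E (prox K v M c)"
proof (rule continuous_on_subset[OF _ order_refl], unfold continuous_on_iff, intro ballI allI impI)
  fix a e :: real and a0 assume a0: "a0 \<in> E" and e: "0 < e"
  have am: "is_arg_min (prox_obj v M c a) (\<lambda>x. x \<in> K) (prox K v M c a)" for a
    using dgf K by (intro prox_is_arg_min) (auto simp: is_dgf_def)
  have "dist (prox K v M c a') (prox K v M c a0) < e" if "a' \<in> E" "dist a' a0 < M * e" for a'
  proof -
    have "M * norm (prox K v M c a' - prox K v M c a0) < M * e"
      using prox_lipschitz[OF dgf E K(1) M that(1) a0 am am] that(2) by (simp add: dist_norm)
    then show ?thesis using M by (simp add: dist_norm)
  qed
  then show "\<exists>d>0. \<forall>x'\<in>E. dist x' a0 < d \<longrightarrow> dist (prox K v M c x') (prox K v M c a0) < e"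
    using M e by (intro exI[of _ "M * e"]) auto
qed

lemma complete_square:
  fixes c g y :: "'a::real_inner"
  assumes "M > 0"
  shows "M / 2 * (norm ((c - (1 / M) *\<^sub>R g) - y))\<^sup>2
      = g \<bullet> (y - c) + M / 2 * (norm (y - c))\<^sup>2 + (norm g)\<^sup>2 / (2 * M)"
  unfolding power2_norm_eq_inner using assms
  by (simp add: inner_diff_left inner_diff_right inner_add_left inner_add_right inner_commute field_simps)

lemma gradient_step_closest_point:
  assumes K: "convex K" "closed K" and M: "M > 0"
    and x: "is_arg_min (\<lambda>x. g \<bullet> (x - c) + M / 2 * (norm (x - c))\<^sup>2) (\<lambda>x. x \<in> K) x"
  shows "x = closest_point K (c - (1 / M) *\<^sub>R g)"
proof (rule closest_point_unique[OF K])
  show "x \<in> K" using x by (simp add: is_arg_min_linorder)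
  show "\<forall>z\<in>K. dist (c - (1 / M) *\<^sub>R g) x \<le> dist (c - (1 / M) *\<^sub>R g) z"
  proof
    fix z assume "z \<in> K"
    then have "M / 2 * (norm ((c - (1 / M) *\<^sub>R g) - x))\<^sup>2 \<le> M / 2 * (norm ((c - (1 / M) *\<^sub>R g) - z))\<^sup>2"
      unfolding complete_square[OF M] using x by (auto simp: is_arg_min_linorder)
    then show "dist (c - (1 / M) *\<^sub>R g) x \<le> dist (c - (1 / M) *\<^sub>R g) z"
      using M by (simp add: dist_norm)
  qed
qed

lemma gradient_step_is_arg_min:
  assumes K: "closed K" "K \<noteq> {}" and M: "M > 0"
  shows "is_arg_min (\<lambda>x. g \<bullet> (x - c) + M / 2 * (norm (x - c))\<^sup>2) (\<lambda>x. x \<in> K)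
    (closest_point K (c - (1 / M) *\<^sub>R g))"
proof -
  let ?p = "closest_point K (c - (1 / M) *\<^sub>R g)"
  have "?p \<in> K" using K by (rule closest_point_in_set)
  moreover have "g \<bullet> (?p - c) + M / 2 * (norm (?p - c))\<^sup>2 \<le> g \<bullet> (y - c) + M / 2 * (norm (y - c))\<^sup>2"
    if "y \<in> K" for y
  proof -
    have "dist (c - (1 / M) *\<^sub>R g) ?p \<le> dist (c - (1 / M) *\<^sub>R g) y"
      using K(1) that by (rule closest_point_le)
    then have "M / 2 * (norm ((c - (1 / M) *\<^sub>R g) - ?p))\<^sup>2 \<le> M / 2 * (norm ((c - (1 / M) *\<^sub>R g) - y))\<^sup>2"
      using M by (simp add: dist_norm)
    then show ?thesis unfolding complete_square[OF M] by simp
  qed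
  ultimately show ?thesis by (simp add: is_arg_min_linorder)
qed

section \<open>Regret of one stage\<close>

text \<open>
  The whole past of a run enters the step to \<open>X-\<close> through the slope only.
\<close>

lemma prox_obj_expand:
  fixes x :: "nat \<Rightarrow> 'x::euclidean_space"
  assumes "(\<Sum>j=0..l. \<alpha> j) = Al"
  shows "\<exists>k. \<forall>y. M * bregman v dv y x0 + (\<Sum>j=0..l. \<alpha> j * (g j \<bullet> (y - x j) + m / 2 * (norm (y - x j))\<^sup>2))
    = prox_obj v M (m * Al) ((\<Sum>j=0..l. \<alpha> j *\<^sub>R (g j - m *\<^sub>R x j)) - M *\<^sub>R dv x0) y + k"
proof -
  have e: "\<alpha> j * (g j \<bullet> (y - x j) + m / 2 * (norm (y - x j))\<^sup>2)
    = (\<alpha> j *\<^sub>R (g j - m *\<^sub>R x j)) \<bullet> y + \<alpha> j * (m / 2 * (norm y)\<^sup>2)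
      + \<alpha> j * (m / 2 * (norm (x j))\<^sup>2 - g j \<bullet> x j)" for j y
    unfolding power2_norm_eq_inner
    by (simp add: inner_diff_left inner_diff_right inner_commute algebra_simps)
  have "M * bregman v dv y x0 + (\<Sum>j=0..l. \<alpha> j * (g j \<bullet> (y - x j) + m / 2 * (norm (y - x j))\<^sup>2))
    = prox_obj v M (m * Al) ((\<Sum>j=0..l. \<alpha> j *\<^sub>R (g j - m *\<^sub>R x j)) - M *\<^sub>R dv x0) y
      + (M * (dv x0 \<bullet> x0 - v x0) + (\<Sum>j=0..l. \<alpha> j * (m / 2 * (norm (x j))\<^sup>2 - g j \<bullet> x j)))" for y
    unfolding e sum.distrib inner_sum_left[symmetric] sum_distrib_right[symmetric] assms
    by (simp add: prox_obj_def bregman_def inner_diff_left inner_diff_right inner_add_left algebra_simps)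
  then show ?thesis by blast
qed

lemma is_arg_min_add_const:
  fixes f :: "'a \<Rightarrow> real"
  assumes "\<And>y. f y = h y + k"
  shows "is_arg_min f S x \<longleftrightarrow> is_arg_min h S x"
  by (simp add: is_arg_min_linorder assms)

text \<open>
  \<open>\<psi> l\<close> is the model whose minimizer is \<open>xm l\<close>, and the partial sums of the left-hand side up to \<open>l\<close>
  stay below its minimum. In the step to \<open>Suc l\<close> the gradient step is compared with the point
  \<open>w = t *\<^sub>R xm (Suc l) + (1 - t) *\<^sub>R xp l\<close>, where \<open>t = \<alpha> (Suc l) / A (Suc l)\<close>. It differs from
  \<open>x (Suc l)\<close> by \<open>t *\<^sub>R (xm (Suc l) - xm l)\<close>, and the step equation is such that the quadratic cost of
  this difference equals the growth of \<open>\<psi> l\<close> from \<open>xm l\<close> to \<open>xm (Suc l)\<close>.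
\<close>

lemma stage_regret:
  fixes g x xp xm :: "nat \<Rightarrow> 'x::euclidean_space" and dv :: "'x \<Rightarrow> 'x"
    and \<alpha> A :: "nat \<Rightarrow> real" and v :: "'x \<Rightarrow> real" and m M :: real
  defines "\<psi> \<equiv> \<lambda>l y. M * bregman v dv y (x 0)
      + (\<Sum>j=0..l. \<alpha> j * (g j \<bullet> (y - x j) + m / 2 * (norm (y - x j))\<^sup>2))"
  assumes dgf: "is_dgf E K v dv" and E: "subspace E" "K \<subseteq> E" and K: "convex K"
    and M: "M > 0" and m: "m \<ge> 0"
    and A0: "\<alpha> 0 = 1" "A 0 = 1"
    and st: "\<And>l. l < L \<Longrightarrow> \<alpha> (Suc l) > 0 \<and> A (Suc l) = A l + \<alpha> (Suc l) \<and> A l > 0 \<and>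
       M + m * A l = M * (\<alpha> (Suc l))\<^sup>2 / A (Suc l)"
    and sumA: "\<And>l. l \<le> L \<Longrightarrow> (\<Sum>j=0..l. \<alpha> j) = A l"
    and gE: "\<And>l. l \<le> L \<Longrightarrow> g l \<in> E"
    and x0: "x 0 \<in> dgf_dom E K v" and xK: "\<And>l. l \<le> L \<Longrightarrow> x l \<in> K"
    and xp: "\<And>l. l \<le> L \<Longrightarrow>
      is_arg_min (\<lambda>y. g l \<bullet> (y - x l) + M / 2 * (norm (y - x l))\<^sup>2) (\<lambda>y. y \<in> K) (xp l)"
    and xm: "\<And>l. l \<le> L \<Longrightarrow> is_arg_min (\<psi> l) (\<lambda>y. y \<in> K) (xm l)"
    and xs: "\<And>l. l < L \<Longrightarrow> x (Suc l) = (\<alpha> (Suc l) / A (Suc l)) *\<^sub>R xm l + (1 - \<alpha> (Suc l) / A (Suc l)) *\<^sub>R xp l"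
    and y: "y \<in> K"
  shows "(\<Sum>l=0..L. A l * (g l \<bullet> (xp l - x l) + M / 2 * (norm (xp l - x l))\<^sup>2))
      - (\<Sum>l<L. A l * (g (Suc l) \<bullet> (xp l - x (Suc l))))
    \<le> M * bregman v dv y (x 0) + (\<Sum>l=0..L. \<alpha> l * (g l \<bullet> (y - x l) + m / 2 * (norm (y - x l))\<^sup>2))"
proof -
  have dvE: "dv (x 0) \<in> E" using dgf x0 by (simp add: is_dgf_def)
  define a where "a l = (\<Sum>j=0..l. \<alpha> j *\<^sub>R (g j - m *\<^sub>R x j)) - M *\<^sub>R dv (x 0)" for l
  have aE: "a l \<in> E" if "l \<le> L" for l
    unfolding a_def using E gE xK dvE that
    by (intro subspace_diff subspace_sum subspace_scale) auto
  have "\<exists>k. \<forall>y. \<psi> l y = prox_obj v M (m * A l) (a l) y + k" if "l \<le> L" for l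
    using prox_obj_expand[OF sumA[OF that]] unfolding \<psi>_def a_def by blast
  then have "\<exists>k. \<forall>l\<in>{..L}. \<forall>y. \<psi> l y = prox_obj v M (m * A l) (a l) y + k l"
    by (intro bchoice) auto
  then obtain k where \<psi>: "\<And>l y. l \<le> L \<Longrightarrow> \<psi> l y = prox_obj v M (m * A l) (a l) y + k l" by blast
  have am: "is_arg_min (prox_obj v M (m * A l) (a l)) (\<lambda>y. y \<in> K) (xm l)" if "l \<le> L" for l
    using xm[OF that] is_arg_min_add_const[of "\<psi> l", OF \<psi>[OF that]] by simp
  note xmD = prox_in_dgf_dom[OF dgf E K M aE am]
  have grow: "\<psi> l (xm l) + (M + m * A l) / 2 * (norm (y - xm l))\<^sup>2 \<le> \<psi> l y"
    if "l \<le> L" "y \<in> dgf_dom E K v" for l y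
    using prox_growth[OF dgf E K M aE[OF that(1)] am[OF that(1)] that(2)] by (simp add: \<psi> that)
  have xpK: "xp l \<in> K" and xmK: "xm l \<in> K" if "l \<le> L" for l
    using xp[OF that] xm[OF that] by (auto simp: is_arg_min_linorder)
  have base: "g 0 \<bullet> (xp 0 - x 0) + M / 2 * (norm (xp 0 - x 0))\<^sup>2 \<le> \<psi> 0 (xm 0)"
  proof -
    have "g 0 \<bullet> (xp 0 - x 0) + M / 2 * (norm (xp 0 - x 0))\<^sup>2
        \<le> g 0 \<bullet> (xm 0 - x 0) + M / 2 * (norm (xm 0 - x 0))\<^sup>2"
      using xp[of 0] xmK[of 0] by (simp add: is_arg_min_linorder)
    moreover have "M * (1/2 * (norm (xm 0 - x 0))\<^sup>2) \<le> M * bregman v dv (xm 0) (x 0)"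
      using dgf_bregman_ge[OF dgf x0 xmD[of 0]] M by (intro mult_left_mono) auto
    moreover have "0 \<le> m / 2 * (norm (xm 0 - x 0))\<^sup>2" using m by simp
    ultimately show ?thesis using A0 by (simp add: \<psi>_def)
  qed
  have step: "A (Suc l) * (g (Suc l) \<bullet> (xp (Suc l) - x (Suc l)) + M / 2 * (norm (xp (Suc l) - x (Suc l)))\<^sup>2)
      - A l * (g (Suc l) \<bullet> (xp l - x (Suc l))) + \<psi> l (xm l) \<le> \<psi> (Suc l) (xm (Suc l))"
    if l: "l < L" for l
  proof -
    define t where "t = \<alpha> (Suc l) / A (Suc l)"
    define w where "w = t *\<^sub>R xm (Suc l) + (1 - t) *\<^sub>R xp l"
    have p: "A (Suc l) > 0" "\<alpha> (Suc l) > 0" "A l > 0" "A (Suc l) = A l + \<alpha> (Suc l)"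
      and q: "M + m * A l = M * (\<alpha> (Suc l))\<^sup>2 / A (Suc l)"
      using st[OF l] by auto
    have t: "0 \<le> t" "t \<le> 1" using p by (simp_all add: t_def)
    have At: "A (Suc l) * t = \<alpha> (Suc l)" "A (Suc l) * (1 - t) = A l"
      using p by (simp_all add: t_def field_simps)
    have "w \<in> K" unfolding w_def using convexD[OF K, of "xm (Suc l)" "xp l" t "1 - t"] t xmK xpK l by simp
    then have "g (Suc l) \<bullet> (xp (Suc l) - x (Suc l)) + M / 2 * (norm (xp (Suc l) - x (Suc l)))\<^sup>2
       \<le> g (Suc l) \<bullet> (w - x (Suc l)) + M / 2 * (norm (w - x (Suc l)))\<^sup>2"
      using xp[of "Suc l"] l by (simp add: is_arg_min_linorder)
    then have 1: "A (Suc l) * (g (Suc l) \<bullet> (xp (Suc l) - x (Suc l)) + M / 2 * (norm (xp (Suc l) - x (Suc l)))\<^sup>2)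
       \<le> A (Suc l) * (g (Suc l) \<bullet> (w - x (Suc l)) + M / 2 * (norm (w - x (Suc l)))\<^sup>2)"
      using p by (intro mult_left_mono) auto
    have wx: "w - x (Suc l) = t *\<^sub>R (xm (Suc l) - xm l)"
      by (simp add: w_def xs[OF l] t_def algebra_simps)
    have 2: "A (Suc l) * (M / 2 * (norm (w - x (Suc l)))\<^sup>2) = (M + m * A l) / 2 * (norm (xm (Suc l) - xm l))\<^sup>2"
    proof -
      have "A (Suc l) * (M / 2 * (norm (w - x (Suc l)))\<^sup>2)
        = A (Suc l) * M / 2 * (\<alpha> (Suc l) / A (Suc l))\<^sup>2 * (norm (xm (Suc l) - xm l))\<^sup>2"
        unfolding wx t_def norm_scaleR power_mult_distrib power2_abs by simp
      also have "A (Suc l) * M / 2 * (\<alpha> (Suc l) / A (Suc l))\<^sup>2 = (M + m * A l) / 2"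
        unfolding q using p(1) by (simp add: power2_eq_square)
      finally show ?thesis .
    qed
    have "w - x (Suc l) = t *\<^sub>R (xm (Suc l) - x (Suc l)) + (1 - t) *\<^sub>R (xp l - x (Suc l))"
      by (simp add: w_def algebra_simps)
    then have "A (Suc l) * (g (Suc l) \<bullet> (w - x (Suc l)))
      = (A (Suc l) * t) * (g (Suc l) \<bullet> (xm (Suc l) - x (Suc l)))
        + (A (Suc l) * (1 - t)) * (g (Suc l) \<bullet> (xp l - x (Suc l)))"
      by (simp only: inner_add_right inner_scaleR_right distrib_left mult.assoc)
    then have 3: "A (Suc l) * (g (Suc l) \<bullet> (w - x (Suc l)))
      = \<alpha> (Suc l) * (g (Suc l) \<bullet> (xm (Suc l) - x (Suc l))) + A l * (g (Suc l) \<bullet> (xp l - x (Suc l)))"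
      unfolding At .
    have 4: "\<psi> l (xm l) + (M + m * A l) / 2 * (norm (xm (Suc l) - xm l))\<^sup>2 \<le> \<psi> l (xm (Suc l))"
      using grow[of l "xm (Suc l)"] xmD[of "Suc l"] l by simp
    have 5: "\<psi> (Suc l) (xm (Suc l)) = \<psi> l (xm (Suc l)) + \<alpha> (Suc l) * (g (Suc l) \<bullet> (xm (Suc l) - x (Suc l)))
       + \<alpha> (Suc l) * (m / 2 * (norm (xm (Suc l) - x (Suc l)))\<^sup>2)"
      by (simp add: \<psi>_def distrib_left)
    have 6: "0 \<le> \<alpha> (Suc l) * (m / 2 * (norm (xm (Suc l) - x (Suc l)))\<^sup>2)" using p m by simp
    show ?thesis using 1 2 3 4 5 6 by (simp add: distrib_left)
  qed
  have "n \<le> L \<Longrightarrow> (\<Sum>l=0..n. A l * (g l \<bullet> (xp l - x l) + M / 2 * (norm (xp l - x l))\<^sup>2))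
      - (\<Sum>l<n. A l * (g (Suc l) \<bullet> (xp l - x (Suc l)))) \<le> \<psi> n (xm n)" for n
  proof (induction n)
    case 0 then show ?case using base A0 by simp
  next
    case (Suc n) then show ?case using step[of n] by simp
  qed
  from this[of L] xm[of L] y have "(\<Sum>l=0..L. A l * (g l \<bullet> (xp l - x l) + M / 2 * (norm (xp l - x l))\<^sup>2))
      - (\<Sum>l<L. A l * (g (Suc l) \<bullet> (xp l - x (Suc l)))) \<le> \<psi> L y"
    by (force simp: is_arg_min_linorder)
  then show ?thesis by (simp add: \<psi>_def)
qed

text \<open>
  \<open>fp\<close>, \<open>fx\<close> and \<open>fy\<close> are the costs of \<open>X+\<close>, of \<open>X\<close> and of the comparison policy, and \<open>I1\<close>, \<open>I2\<close>,
  \<open>I3\<close> the first-order models of their differences. The increments of the weights \<open>A\<close> being \<open>\<alpha>\<close>,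
  the gap of iteration \<open>Suc l\<close> splits into the gap of iteration \<open>l\<close> and a new comparison with \<open>fy\<close>.
\<close>

lemma accelerated_telescoping:
  fixes fp fx I1 I2 I3 \<alpha> A :: "nat \<Rightarrow> real"
  assumes p: "\<And>l. l \<le> L \<Longrightarrow> fp l \<le> fx l + I1 l"
    and x: "\<And>l. l < L \<Longrightarrow> fx (Suc l) + I2 l \<le> fp l"
    and y: "\<And>l. l \<le> L \<Longrightarrow> fx l + I3 l \<le> fy"
    and A0: "A 0 = \<alpha> 0" and A: "\<And>l. l < L \<Longrightarrow> A (Suc l) = A l + \<alpha> (Suc l)"
    and nn: "\<And>l. l \<le> L \<Longrightarrow> 0 \<le> \<alpha> l" "\<And>l. l \<le> L \<Longrightarrow> 0 \<le> A l"
  shows "A L * (fp L - fy) \<le> (\<Sum>l=0..L. A l * I1 l) - (\<Sum>l=0..L. \<alpha> l * I3 l) - (\<Sum>l<L. A l * I2 l)"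
proof -
  have "n \<le> L \<Longrightarrow> A n * (fp n - fy) \<le> (\<Sum>l=0..n. A l * I1 l) - (\<Sum>l=0..n. \<alpha> l * I3 l) - (\<Sum>l<n. A l * I2 l)" for n
  proof (induction n)
    case 0
    have "A 0 * (fp 0 - fy) \<le> A 0 * (I1 0 - I3 0)"
      using p[of 0] y[of 0] nn(2)[of 0] by (intro mult_left_mono) auto
    then show ?case using A0 by (simp add: right_diff_distrib)
  next
    case (Suc n)
    have "A (Suc n) * (fp (Suc n) - fy) \<le> A (Suc n) * (fx (Suc n) + I1 (Suc n) - fy)"
      using p[of "Suc n"] nn(2)[of "Suc n"] Suc.prems by (intro mult_left_mono) auto
    also have "\<dots> = A (Suc n) * I1 (Suc n) + A n * (fx (Suc n) - fy) + \<alpha> (Suc n) * (fx (Suc n) - fy)"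
      using A[of n] Suc.prems by (simp add: algebra_simps)
    also have "\<dots> \<le> A (Suc n) * I1 (Suc n) + A n * (fp n - I2 n - fy) + \<alpha> (Suc n) * (- I3 (Suc n))"
      using x[of n] y[of "Suc n"] nn(1)[of "Suc n"] nn(2)[of n] Suc.prems
      by (intro add_mono mult_left_mono order_refl) auto
    finally show ?case using Suc by (simp add: algebra_simps)
  qed
  then show ?thesis by simp
qed

section \<open>Gradients on subspaces\<close>

text \<open>
  Riesz representation within the subspace: project the vector that represents the functional on the
  whole space.
\<close>

lemma subspace_functional:
  fixes E :: "'x::euclidean_space set"
  assumes E: "subspace E" and f: "linear f"
  obtains d where "d \<in> E" "\<And>h. h \<in> E \<Longrightarrow> f h = d \<bullet> h"
proof -
  define d0 where "d0 = (\<Sum>i\<in>Basis. f i *\<^sub>R i)"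
  have d0: "f h = d0 \<bullet> h" for h
  proof -
    have "f h = f (\<Sum>i\<in>Basis. (h \<bullet> i) *\<^sub>R i)" by (simp add: euclidean_representation)
    also have "\<dots> = (\<Sum>i\<in>Basis. (h \<bullet> i) * f i)" using f by (simp add: linear_sum linear_scale)
    also have "\<dots> = d0 \<bullet> h" by (simp add: d0_def inner_sum_left inner_commute[of h] mult.commute)
    finally show ?thesis .
  qed
  obtain d e where "d \<in> span E" and e: "\<And>w. w \<in> span E \<Longrightarrow> orthogonal e w" and "d0 = d + e"
    using orthogonal_subspace_decomp_exists[of E d0] by metis
  moreover have "span E = E" using E by (simp add: span_eq_iff)
  ultimately show ?thesis using that[of d] by (simp add: d0 orthogonal_def inner_add_left)
qed

lemma grad_on_eqI:
  assumes E: "subspace E" and x: "x \<in> E" and d: "d \<in> E"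
    and der: "(g has_derivative (\<lambda>h. d \<bullet> h)) (at x within E)"
  shows "grad_on E g x = d"
  unfolding grad_on_def
proof (rule the_equality)
  fix d' assume d': "d' \<in> E \<and> (g has_derivative (\<lambda>h. d' \<bullet> h)) (at x within E)"
  define k where "k = d' - d"
  have k: "k \<in> E" unfolding k_def using E d d' by (intro subspace_diff) auto
  have line: "((\<lambda>s. g (x + s *\<^sub>R k)) has_derivative (\<lambda>s. e \<bullet> (s *\<^sub>R k))) (at 0)"
    if "(g has_derivative (\<lambda>h. e \<bullet> h)) (at x within E)" for e
  proof (rule has_derivative_in_compose[where f="\<lambda>s. x + s *\<^sub>R k"])
    show "((\<lambda>s. x + s *\<^sub>R k) has_derivative (\<lambda>s. s *\<^sub>R k)) (at 0)"
      by (auto intro!: derivative_eq_intros)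
    show "(g has_derivative (\<lambda>h. e \<bullet> h)) (at (x + 0 *\<^sub>R k) within range (\<lambda>s. x + s *\<^sub>R k))"
    proof -
      have "range (\<lambda>s. x + s *\<^sub>R k) \<subseteq> E"
        using E x k by (auto intro!: subspace_add subspace_scale)
      then show ?thesis using has_derivative_subset[OF that] by simp
    qed
  qed
  have "(\<lambda>s. d' \<bullet> (s *\<^sub>R k)) = (\<lambda>s. d \<bullet> (s *\<^sub>R k))"
    using has_derivative_unique line d' der by blast
  then have "d' \<bullet> k = d \<bullet> k" by (auto dest: fun_cong[where x=1])
  then have "k \<bullet> k = 0" by (simp add: k_def inner_diff_left inner_diff_right)
  then show "d' = d" by (simp add: k_def)
qed (use assms in auto)

text \<open>
  The limit in the derivative within \<open>E\<close> involves increments from \<open>E\<close> only, so the derivative may be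
  represented by an element of \<open>E\<close>.
\<close>

lemma grad_on_works:
  assumes E: "subspace E" and x: "x \<in> E" and f: "(g has_derivative f) (at x within E)"
  shows "grad_on E g x \<in> E \<and> (g has_derivative (\<lambda>h. grad_on E g x \<bullet> h)) (at x within E)"
proof -
  have "linear f" using f by (rule has_derivative_linear)
  then obtain d where d: "d \<in> E" "\<And>h. h \<in> E \<Longrightarrow> f h = d \<bullet> h" using subspace_functional[OF E] by blast
  have "(g has_derivative (\<lambda>h. d \<bullet> h)) (at x within E)"
    unfolding has_derivative_within
  proof (intro conjI)
    show "bounded_linear (\<lambda>h. d \<bullet> h)" by (rule bounded_linear_inner_right)
    have "((\<lambda>y. (1 / norm (y - x)) *\<^sub>R (g y - (g x + f (y - x)))) \<longlongrightarrow> 0) (at x within E)"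
      using f unfolding has_derivative_within by blast
    moreover have "\<forall>\<^sub>F y in at x within E. (1 / norm (y - x)) *\<^sub>R (g y - (g x + f (y - x)))
         = (1 / norm (y - x)) *\<^sub>R (g y - (g x + d \<bullet> (y - x)))"
      unfolding eventually_at_filter using d(2) E x by (auto simp: subspace_diff)
    ultimately show "((\<lambda>y. (1 / norm (y - x)) *\<^sub>R (g y - (g x + d \<bullet> (y - x)))) \<longlongrightarrow> 0) (at x within E)"
      by (rule Lim_transform_eventually)
  qed
  with d(1) grad_on_eqI[OF E x d(1)] show ?thesis by simp
qed

section \<open>Histories\<close>

lemma space_supp_alg [simp]: "space (supp_alg P t) = supp P t"
  by (simp add: supp_alg_def space_restrict_space)

lemma space_hist: "space (hist P t) = PiE {1..t} (supp P)"
  by (simp add: hist_def space_PiM)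

lemma trunc_measurable: "t \<le> t' \<Longrightarrow> trunc t \<in> measurable (hist P t') (hist P t)"
  unfolding hist_def trunc_def[abs_def] by (rule measurable_restrict_subset) auto

lemma trunc_space: "t \<le> t' \<Longrightarrow> s \<in> space (hist P t') \<Longrightarrow> trunc t s \<in> space (hist P t)"
  using measurable_space[OF trunc_measurable] .

lemma trunc_trunc: "t \<le> t' \<Longrightarrow> trunc t (trunc t' s) = trunc t s"
  by (auto simp: trunc_def restrict_def fun_eq_iff)

lemma trunc_apply: "j \<in> {1..t} \<Longrightarrow> trunc t s j = s j"
  by (simp add: trunc_def)

lemma component_measurable: "j \<in> {1..t} \<Longrightarrow> (\<lambda>s. s j) \<in> measurable (hist P t) (supp_alg P j)"
  unfolding hist_def by (rule measurable_component_singleton)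

lemma extend_measurable:
  "(\<lambda>(s, z). s(Suc t := z)) \<in> measurable (hist P t \<Otimes>\<^sub>M supp_alg P (Suc t)) (hist P (Suc t))"
proof -
  have "{1..Suc t} = insert (Suc t) {1..t}" by auto
  then show ?thesis unfolding hist_def using measurable_add_dim[of "Suc t" "{1..t}" "supp_alg P"] by simp
qed

section \<open>The stochastic program\<close>

text \<open>
  The parameter \<open>p\<close> will be the vector of seeds. Joint measurability is what allows the two
  expectations, over the path and over the seeds, to be exchanged.
\<close>

definition jointly_feasible where
  "jointly_feasible N P X \<longleftrightarrow> (\<forall>t\<in>{1..horizon P}.
     (\<lambda>(p, s). X p t s) \<in> measurable (N \<Otimes>\<^sub>M hist P t) (restrict_space borel (feas P t)))"

locale msp_problem =
  fixes P :: "('w, 'z::euclidean_space, 'x::euclidean_space) msp"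
    and Xstar :: "nat \<Rightarrow> (nat \<Rightarrow> 'z) \<Rightarrow> 'x"
  assumes standing: "standing P Xstar"
begin

abbreviation "T \<equiv> horizon P"
abbreviation "cost_of X \<xi> \<equiv> objective P (induced X \<xi>) \<xi>"
abbreviation "grad_of t X \<xi> \<equiv> dobj P t (induced X \<xi>) \<xi>"

lemma prob_base: "prob_space (base P)"
  and horizon_ge: "1 \<le> T"
  and noise_measurable: "t \<in> {1..T} \<Longrightarrow> noise P t \<in> measurable (base P) (supp_alg P t)"
  and dspace0: "dspace P 0 = {0}"
  and optimal: "optimal_policy P Xstar"
  using standing unfolding standing_def by auto

sublocale base: prob_space "base P" by (rule prob_base)

lemma dspace_subspace: "t \<le> T \<Longrightarrow> subspace (dspace P t)"
proof (cases "t = 0")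
  case False
  then show "t \<le> T \<Longrightarrow> subspace (dspace P t)" using standing unfolding standing_def by auto
qed (simp add: dspace0 subspace_0)

lemma feas_facts:
  assumes "t \<in> {1..T}"
  shows "feas P t \<subseteq> dspace P t" "feas P t \<noteq> {}" "compact (feas P t)" "convex (feas P t)" "closed (feas P t)"
  using assms standing compact_imp_closed unfolding standing_def by blast+

lemma cost_facts:
  assumes "t \<in> {1..T}"
  shows "z \<in> supp P t \<Longrightarrow> (\<lambda>(x, y). cost P t x y z) differentiable_on (dspace P (t - 1) \<times> dspace P t)"
    and "(\<lambda>(x, y, z). cost P t x y z) \<in> borel_measurable (joint_alg P t)"
    and "(\<lambda>(x, y, z). dcost_prev P t x y z) \<in> borel_measurable (joint_alg P t)"
    and "(\<lambda>(x, y, z). dcost_cur P t x y z) \<in> borel_measurable (joint_alg P t)"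
  using assms standing unfolding standing_def by blast+

lemma Xstar_feasible: "feasible_policy P Xstar"
  and Xstar_integrable: "integrable (base P) (\<lambda>\<omega>. objective P (induced Xstar (scenario P \<omega>)) (scenario P \<omega>))"
  using optimal unfolding optimal_policy_def by auto

lemma scenario_measurable: "scenario P \<in> measurable (base P) (hist P T)"
  unfolding scenario_def[abs_def] hist_def
  by (rule measurable_restrict) (use noise_measurable in auto)

lemma scenario_space: "\<omega> \<in> space (base P) \<Longrightarrow> scenario P \<omega> \<in> space (hist P T)"
  using measurable_space[OF scenario_measurable] .

text \<open>
  Any realization of the noise supplies admissible values for the later stages.
\<close>

lemma extend_history:
  assumes t: "t \<le> T" and s: "s \<in> space (hist P t)"
  obtains \<xi> where "\<xi> \<in> space (hist P T)" "trunc t \<xi> = s"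
proof -
  obtain \<omega> where "\<omega> \<in> space (base P)" using base.not_empty by blast
  then have \<eta>: "scenario P \<omega> \<in> PiE {1..T} (supp P)" using scenario_space by (simp add: space_hist)
  define \<xi> where "\<xi> = (\<lambda>j\<in>{1..T}. if j \<le> t then s j else scenario P \<omega> j)"
  have "\<xi> \<in> space (hist P T)"
    using \<eta> s t unfolding \<xi>_def space_hist by (auto simp: PiE_iff)
  moreover have "trunc t \<xi> = s"
    using s t unfolding \<xi>_def space_hist trunc_def by (fastforce simp: PiE_iff extensional_def fun_eq_iff)
  ultimately show ?thesis using that by blast
qed

lemma objective_alt:
  "objective P x \<xi> = (\<Sum>t = 1..T. cost P t (if t = 1 then 0 else x (t - 1)) (x t) (\<xi> t))"
proof -
  have "{1..T} = insert 1 {2..T}" using horizon_ge by auto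
  then show ?thesis unfolding objective_def by simp
qed

lemma objective_cong:
  assumes "\<And>t. t \<in> {1..T} \<Longrightarrow> x t = y t"
  shows "objective P x \<xi> = objective P y \<xi>"
  unfolding objective_alt
proof (intro sum.cong refl)
  fix t assume t: "t \<in> {1..T}"
  have "(if t = 1 then 0 else x (t - 1)) = (if t = 1 then 0 else y (t - 1))"
  proof (cases "t = 1")
    case False
    then have "t - 1 \<in> {1..T}" using t by auto
    then show ?thesis using assms by simp
  qed simp
  then show "cost P t (if t = 1 then 0 else x (t - 1)) (x t) (\<xi> t)
      = cost P t (if t = 1 then 0 else y (t - 1)) (y t) (\<xi> t)"
    using assms[OF t] by simp
qed

lemma dobj_cong:
  assumes "\<And>t. t \<in> {1..T} \<Longrightarrow> x t = y t" "t \<in> {1..T}"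
  shows "dobj P t x \<xi> = dobj P t y \<xi>"
proof -
  have "objective P (x(t := w)) \<xi> = objective P (y(t := w)) \<xi>" for w
    by (rule objective_cong) (use assms in auto)
  then show ?thesis using assms by (simp add: dobj_def)
qed

lemma dcost_cur_works:
  assumes t: "t \<in> {1..T}" and x: "x \<in> dspace P (t - 1)" and y: "y \<in> dspace P t" and z: "z \<in> supp P t"
  shows "dcost_cur P t x y z \<in> dspace P t \<and>
    ((\<lambda>y'. cost P t x y' z) has_derivative (\<lambda>h. dcost_cur P t x y z \<bullet> h)) (at y within dspace P t)"
proof -
  obtain f where f: "((\<lambda>(x, y). cost P t x y z) has_derivative f) (at (x, y) within dspace P (t - 1) \<times> dspace P t)"
    using cost_facts(1)[OF t z] x y unfolding differentiable_on_def differentiable_def by blast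
  have "((\<lambda>y'. (x, y')) has_derivative (\<lambda>h. (0, h))) (at y within dspace P t)"
    by (auto intro!: derivative_eq_intros)
  moreover have "((\<lambda>(x, y). cost P t x y z) has_derivative f) (at (x, y) within (\<lambda>y'. (x, y')) ` dspace P t)"
    by (rule has_derivative_subset[OF f]) (use x in auto)
  ultimately have "((\<lambda>y'. case (x, y') of (x, y) \<Rightarrow> cost P t x y z) has_derivative (\<lambda>h. f (0, h))) (at y within dspace P t)"
    by (rule has_derivative_in_compose)
  then show ?thesis unfolding dcost_cur_def
    using grad_on_works[OF dspace_subspace y] t by simp
qed

lemma dcost_prev_works:
  assumes t: "t \<in> {1..T}" and x: "x \<in> dspace P (t - 1)" and y: "y \<in> dspace P t" and z: "z \<in> supp P t"
  shows "dcost_prev P t x y z \<in> dspace P (t - 1) \<and>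
    ((\<lambda>x'. cost P t x' y z) has_derivative (\<lambda>h. dcost_prev P t x y z \<bullet> h)) (at x within dspace P (t - 1))"
proof -
  obtain f where f: "((\<lambda>(x, y). cost P t x y z) has_derivative f) (at (x, y) within dspace P (t - 1) \<times> dspace P t)"
    using cost_facts(1)[OF t z] x y unfolding differentiable_on_def differentiable_def by blast
  have "((\<lambda>x'. (x', y)) has_derivative (\<lambda>h. (h, 0))) (at x within dspace P (t - 1))"
    by (auto intro!: derivative_eq_intros)
  moreover have "((\<lambda>(x, y). cost P t x y z) has_derivative f) (at (x, y) within (\<lambda>x'. (x', y)) ` dspace P (t - 1))"
    by (rule has_derivative_subset[OF f]) (use y in auto)
  ultimately have "((\<lambda>x'. case (x', y) of (x, y) \<Rightarrow> cost P t x y z) has_derivative (\<lambda>h. f (h, 0))) (at x within dspace P (t - 1))"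
    by (rule has_derivative_in_compose)
  moreover have "t - 1 \<le> T" using t by auto
  ultimately show ?thesis unfolding dcost_prev_def
    using grad_on_works[OF dspace_subspace x] by simp
qed

definition in_dspaces :: "(nat \<Rightarrow> 'x) \<Rightarrow> bool" where
  "in_dspaces x \<longleftrightarrow> (\<forall>t\<in>{1..T}. x t \<in> dspace P t)"

text \<open>
  The decision of stage \<open>t\<close> enters the costs of the stages \<open>t\<close> and \<open>Suc t\<close> and no others.
\<close>

lemma dobj_eq:
  assumes t: "t \<in> {1..T}" and \<xi>: "\<xi> \<in> space (hist P T)" and x: "in_dspaces x"
  shows "dobj P t x \<xi> = dcost_cur P t (if t = 1 then 0 else x (t - 1)) (x t) (\<xi> t)
      + (if t < T then dcost_prev P (Suc t) (x t) (x (Suc t)) (\<xi> (Suc t)) else 0)"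
    and "dobj P t x \<xi> \<in> dspace P t"
proof -
  have xs: "x j \<in> dspace P j" if "j \<in> {1..T}" for j using x that by (simp add: in_dspaces_def)
  have prev: "(if j = 1 then 0 else x (j - 1)) \<in> dspace P (j - 1)" if "j \<in> {1..T}" for j
  proof (cases "j = 1")
    case True then show ?thesis by (simp add: dspace0)
  next
    case False
    then have "j - 1 \<in> {1..T}" using that by auto
    then show ?thesis using xs[of "j - 1"] False by simp
  qed
  have zs: "\<xi> j \<in> supp P j" if "j \<in> {1..T}" for j using \<xi> that by (auto simp: space_hist PiE_iff)
  define d where "d j = (if j = t then dcost_cur P t (if t = 1 then 0 else x (t - 1)) (x t) (\<xi> t)
     else if j = Suc t then dcost_prev P (Suc t) (x t) (x (Suc t)) (\<xi> (Suc t)) else 0)" for j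
  have dj: "d j \<in> dspace P t \<and>
     ((\<lambda>y. cost P j (if j = 1 then 0 else (x(t := y)) (j - 1)) ((x(t := y)) j) (\<xi> j))
        has_derivative (\<lambda>h. d j \<bullet> h)) (at (x t) within dspace P t)" if j: "j \<in> {1..T}" for j
  proof -
    consider "j = t" | "j = Suc t" | "j \<noteq> t" "j \<noteq> Suc t" by blast
    then show ?thesis
    proof cases
      case 1
      then have "(\<lambda>y. cost P j (if j = 1 then 0 else (x(t := y)) (j - 1)) ((x(t := y)) j) (\<xi> j))
         = (\<lambda>y. cost P t (if t = 1 then 0 else x (t - 1)) y (\<xi> t))" using t by (auto simp: fun_eq_iff)
      then show ?thesis using dcost_cur_works[OF t prev[OF t] xs[OF t] zs[OF t]] 1 by (simp add: d_def)
    next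
      case 2
      then have "(\<lambda>y. cost P j (if j = 1 then 0 else (x(t := y)) (j - 1)) ((x(t := y)) j) (\<xi> j))
         = (\<lambda>y. cost P (Suc t) y (x (Suc t)) (\<xi> (Suc t)))" using t by (auto simp: fun_eq_iff)
      then show ?thesis using dcost_prev_works[of j "x t" "x j" "\<xi> j"] xs[OF t] xs[OF j] zs[OF j] j 2
        by (simp add: d_def)
    next
      case 3
      then have "(\<lambda>y. cost P j (if j = 1 then 0 else (x(t := y)) (j - 1)) ((x(t := y)) j) (\<xi> j))
         = (\<lambda>y. cost P j (if j = 1 then 0 else x (j - 1)) (x j) (\<xi> j))" using j by (auto simp: fun_eq_iff)
      moreover have "0 \<in> dspace P t" using dspace_subspace[of t] t by (simp add: subspace_def)
      ultimately show ?thesis using 3 by (simp add: d_def)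
    qed
  qed
  have "((\<lambda>y. objective P (x(t := y)) \<xi>) has_derivative (\<lambda>h. \<Sum>j = 1..T. d j \<bullet> h)) (at (x t) within dspace P t)"
    unfolding objective_alt by (intro has_derivative_sum) (use dj in auto)
  then have der: "((\<lambda>y. objective P (x(t := y)) \<xi>) has_derivative (\<lambda>h. (\<Sum>j = 1..T. d j) \<bullet> h)) (at (x t) within dspace P t)"
    by (simp add: inner_sum_left)
  have mem: "(\<Sum>j = 1..T. d j) \<in> dspace P t"
    using dj dspace_subspace[of t] t by (intro subspace_sum) auto
  have eq: "dobj P t x \<xi> = (\<Sum>j = 1..T. d j)"
    unfolding dobj_def using grad_on_eqI[OF _ xs[OF t] mem der] dspace_subspace t by simp
  have "(\<Sum>j = 1..T. d j) = (\<Sum>j = 1..T. if j = t then d t else 0) + (\<Sum>j = 1..T. if j = Suc t then d (Suc t) else 0)"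
    unfolding sum.distrib[symmetric] by (intro sum.cong) (auto simp: d_def)
  also have "\<dots> = d t + (if t < T then d (Suc t) else 0)"
    using t by (simp add: sum.delta)
  finally show "dobj P t x \<xi> = dcost_cur P t (if t = 1 then 0 else x (t - 1)) (x t) (\<xi> t)
      + (if t < T then dcost_prev P (Suc t) (x t) (x (Suc t)) (\<xi> (Suc t)) else 0)"
    unfolding eq by (simp add: d_def)
  show "dobj P t x \<xi> \<in> dspace P t" using mem eq by simp
qed

lemma policy_value:
  assumes "feasible_policy P X" "t \<in> {1..T}" "s \<in> space (hist P t)"
  shows "X t s \<in> feas P t"
proof -
  have "X t \<in> measurable (hist P t) (restrict_space borel (feas P t))"
    using assms unfolding feasible_policy_def policies_def by auto
  from measurable_space[OF this assms(3)] show ?thesis by (simp add: space_restrict_space)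
qed

lemma induced_value:
  assumes "feasible_policy P X" "t \<in> {1..T}" "\<xi> \<in> space (hist P T)"
  shows "induced X \<xi> t \<in> feas P t"
  unfolding induced_def using assms by (intro policy_value trunc_space) auto

lemma induced_in_dspaces:
  assumes "feasible_policy P X" "\<xi> \<in> space (hist P T)"
  shows "in_dspaces (induced X \<xi>)"
  unfolding in_dspaces_def using induced_value[OF assms(1) _ assms(2)] feas_facts(1) by blast

lemma restrict_induced_feas_tuples:
  assumes "feasible_policy P X" "\<xi> \<in> space (hist P T)"
  shows "restrict (induced X \<xi>) {1..T} \<in> feas_tuples P"
  unfolding feas_tuples_def using induced_value[OF assms(1) _ assms(2)] by auto

text \<open>
  Continue the history by the sampled value, and then arbitrarily. Through this identity the oracle
  inherits the bound on the pathwise gradient and lies in the space of the stage's decisions.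
\<close>

lemma scg_eq_dobj:
  assumes X: "feasible_policy P X" and t: "t \<in> {1..T}" and s: "s \<in> space (hist P t)"
    and z: "t < T \<Longrightarrow> smp (Suc t) s u \<in> supp P (Suc t)"
  obtains \<xi> where "\<xi> \<in> space (hist P T)" "scg P smp X t s u = dobj P t (induced X \<xi>) \<xi>"
proof (cases "t < T")
  case True
  let ?z = "smp (Suc t) s u"
  have "s(Suc t := ?z) \<in> space (hist P (Suc t))"
    using s z[OF True] unfolding space_hist by (auto simp: PiE_iff extensional_def)
  then obtain \<xi> where \<xi>: "\<xi> \<in> space (hist P T)" "trunc (Suc t) \<xi> = s(Suc t := ?z)"
    using extend_history[of "Suc t"] True by auto
  have tr: "trunc t \<xi> = s"
    using arg_cong[OF \<xi>(2), of "trunc t"] s unfolding trunc_trunc[OF le_SucI[OF order_refl]]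
    by (auto simp: trunc_def space_hist PiE_iff extensional_def fun_eq_iff)
  have "trunc (t - 1) \<xi> = trunc (t - 1) s" using trunc_trunc[of "t - 1" t \<xi>] tr by simp
  moreover have "\<xi> t = s t" using tr t trunc_apply[of t t \<xi>] by simp
  moreover have "\<xi> (Suc t) = ?z" using \<xi>(2) trunc_apply[of "Suc t" "Suc t" \<xi>] by simp
  ultimately have "scg P smp X t s u = dobj P t (induced X \<xi>) \<xi>"
    unfolding scg_def Let_def dobj_eq(1)[OF t \<xi>(1) induced_in_dspaces[OF X \<xi>(1)]]
    using True tr \<xi>(2) by (simp add: induced_def)
  then show ?thesis using that \<xi>(1) by blast
next
  case False
  obtain \<xi> where \<xi>: "\<xi> \<in> space (hist P T)" "trunc t \<xi> = s"
    using extend_history[OF _ s] t by auto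
  have "trunc (t - 1) \<xi> = trunc (t - 1) s" using trunc_trunc[of "t - 1" t \<xi>] \<xi> by simp
  moreover have "\<xi> t = s t" using \<xi> t trunc_apply[of t t \<xi>] by simp
  ultimately have "scg P smp X t s u = dobj P t (induced X \<xi>) \<xi>"
    unfolding scg_def Let_def dobj_eq(1)[OF t \<xi>(1) induced_in_dspaces[OF X \<xi>(1)]]
    using False \<xi> by (simp add: induced_def)
  then show ?thesis using that \<xi>(1) by blast
qed

section \<open>Joint measurability in seeds and histories\<close>

lemma measurable_cost_compose:
  fixes F :: "'x \<Rightarrow> 'x \<Rightarrow> 'z \<Rightarrow> 'b::topological_space"
  assumes F: "(\<lambda>(x, y, z). F x y z) \<in> borel_measurable (joint_alg P t)"
    and a: "a \<in> measurable N (restrict_space borel (dspace P (t - 1)))"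
    and b: "b \<in> measurable N (restrict_space borel (dspace P t))"
    and c: "c \<in> measurable N (supp_alg P t)"
  shows "(\<lambda>q. F (a q) (b q) (c q)) \<in> borel_measurable N"
proof -
  have "(\<lambda>q. (a q, b q, c q)) \<in> measurable N (joint_alg P t)"
    unfolding joint_alg_def using a b c by (intro measurable_Pair)
  from measurable_compose[OF this F] show ?thesis by simp
qed

lemma feas_to_dspace:
  assumes "t \<in> {1..T}" "f \<in> measurable N (restrict_space borel (feas P t))"
  shows "f \<in> measurable N (restrict_space borel (dspace P t))"
  using assms(2) feas_facts(1)[OF assms(1)] unfolding measurable_restrict_space2_iff by blast

lemma jointly_feasible_compose:
  assumes X: "jointly_feasible N P X" and t: "t \<in> {1..T}"
    and p: "p \<in> measurable N' N" and s: "s \<in> measurable N' (hist P t)"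
  shows "(\<lambda>q. X (p q) t (s q)) \<in> measurable N' (restrict_space borel (feas P t))"
proof -
  have "(\<lambda>(p, s). X p t s) \<in> measurable (N \<Otimes>\<^sub>M hist P t) (restrict_space borel (feas P t))"
    using X t unfolding jointly_feasible_def by blast
  from measurable_compose[OF measurable_Pair[OF p s] this] show ?thesis by simp
qed

lemma jointly_feasible_policy:
  assumes X: "jointly_feasible N P X" and p: "p \<in> space N"
  shows "feasible_policy P (X p)"
  unfolding feasible_policy_def policies_def
  using jointly_feasible_compose[OF X, where p="\<lambda>_. p" and s="\<lambda>s. s"] p by auto

text \<open>
  Parameter, history and seed are functions of one variable \<open>q\<close>, so that the seed may be a component of
  the parameter or a separate variable.
\<close>

lemma scg_jointly_measurable:
  assumes X: "jointly_feasible N P X" and t: "t \<in> {1..T}"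
    and smp: "t < T \<Longrightarrow> case_prod (smp (Suc t)) \<in> measurable (hist P t \<Otimes>\<^sub>M unif01) (supp_alg P (Suc t))"
    and p: "p \<in> measurable N' N" and s: "s \<in> measurable N' (hist P t)" and u: "u \<in> measurable N' unif01"
  shows "(\<lambda>q. scg P smp (X (p q)) t (s q) (u q)) \<in> borel_measurable N'"
proof -
  note Xc = jointly_feasible_compose[OF X]
  have 1: "(\<lambda>q. if t = 1 then 0 else X (p q) (t - 1) (trunc (t - 1) (s q)))
     \<in> measurable N' (restrict_space borel (dspace P (t - 1)))"
  proof (cases "t = 1")
    case True then show ?thesis by (simp add: dspace0 space_restrict_space)
  next
    case False
    then have t1: "t - 1 \<in> {1..T}" using t by auto
    have "(\<lambda>q. trunc (t - 1) (s q)) \<in> measurable N' (hist P (t - 1))"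
      using measurable_compose[OF s trunc_measurable] by simp
    from feas_to_dspace[OF t1 Xc[OF t1 p this]] False show ?thesis by simp
  qed
  have 2: "(\<lambda>q. X (p q) t (s q)) \<in> measurable N' (restrict_space borel (dspace P t))"
    by (rule feas_to_dspace[OF t Xc[OF t p s]])
  have 3: "(\<lambda>q. s q t) \<in> measurable N' (supp_alg P t)"
    using t by (intro measurable_compose[OF s component_measurable]) auto
  have 4: "(\<lambda>q. dcost_cur P t (if t = 1 then 0 else X (p q) (t - 1) (trunc (t - 1) (s q))) (X (p q) t (s q)) (s q t))
     \<in> borel_measurable N'"
    by (rule measurable_cost_compose[OF cost_facts(4)[OF t] 1 2 3])
  show ?thesis
  proof (cases "t < T")
    case True
    then have t': "Suc t \<in> {1..T}" by auto
    have 5: "(\<lambda>q. smp (Suc t) (s q) (u q)) \<in> measurable N' (supp_alg P (Suc t))"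
      using measurable_compose[OF measurable_Pair[OF s u] smp[OF True]] by simp
    have 6: "(\<lambda>q. (s q)(Suc t := smp (Suc t) (s q) (u q))) \<in> measurable N' (hist P (Suc t))"
      using measurable_compose[OF measurable_Pair[OF s 5] extend_measurable] by simp
    have 7: "(\<lambda>q. dcost_prev P (Suc t) (X (p q) t (s q))
        (X (p q) (Suc t) ((s q)(Suc t := smp (Suc t) (s q) (u q)))) (smp (Suc t) (s q) (u q))) \<in> borel_measurable N'"
      by (rule measurable_cost_compose[OF cost_facts(3)[OF t'] _ feas_to_dspace[OF t' Xc[OF t' p 6]] 5])
        (simp add: 2)
    show ?thesis unfolding scg_def Let_def using True borel_measurable_add[OF 4 7] by simp
  next
    case False
    then show ?thesis unfolding scg_def Let_def using 4 by simp
  qed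
qed

lemma induced_jointly_measurable:
  assumes X: "jointly_feasible N P X" and t: "t \<in> {1..T}"
    and p: "p \<in> measurable N' N" and s: "s \<in> measurable N' (hist P T)"
  shows "(\<lambda>q. induced (X (p q)) (s q) t) \<in> measurable N' (restrict_space borel (feas P t))"
  unfolding induced_def
  by (rule jointly_feasible_compose[OF X t p measurable_compose[OF s trunc_measurable]]) (use t in auto)

lemma prev_jointly_measurable:
  assumes X: "jointly_feasible N P X" and t: "t \<in> {1..T}"
    and p: "p \<in> measurable N' N" and s: "s \<in> measurable N' (hist P T)"
  shows "(\<lambda>q. if t = 1 then 0 else induced (X (p q)) (s q) (t - 1))
     \<in> measurable N' (restrict_space borel (dspace P (t - 1)))"
proof (cases "t = 1")
  case True then show ?thesis by (simp add: dspace0 space_restrict_space)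
next
  case False
  then have t1: "t - 1 \<in> {1..T}" using t by auto
  from feas_to_dspace[OF t1 induced_jointly_measurable[OF X t1 p s]] False show ?thesis by simp
qed

lemma objective_jointly_measurable:
  assumes X: "jointly_feasible N P X"
    and p: "p \<in> measurable N' N" and s: "s \<in> measurable N' (hist P T)"
  shows "(\<lambda>q. cost_of (X (p q)) (s q)) \<in> borel_measurable N'"
  unfolding objective_alt
proof (rule borel_measurable_sum)
  fix t assume t: "t \<in> {1..T}"
  have "(\<lambda>q. s q t) \<in> measurable N' (supp_alg P t)"
    by (rule measurable_compose[OF s component_measurable[OF t]])
  then show "(\<lambda>q. cost P t (if t = 1 then 0 else induced (X (p q)) (s q) (t - 1)) (induced (X (p q)) (s q) t) (s q t))
     \<in> borel_measurable N'"
    using measurable_cost_compose[OF cost_facts(2)[OF t] prev_jointly_measurable[OF X t p s]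
      feas_to_dspace[OF t induced_jointly_measurable[OF X t p s]]] by simp
qed

lemma dobj_jointly_measurable:
  assumes X: "jointly_feasible N P X" and t: "t \<in> {1..T}"
    and p: "p \<in> measurable N' N" and s: "s \<in> measurable N' (hist P T)"
  shows "(\<lambda>q. grad_of t (X (p q)) (s q)) \<in> borel_measurable N'"
proof -
  note ind = feas_to_dspace[OF _ induced_jointly_measurable[OF X _ p s]]
  have comp: "(\<lambda>q. s q j) \<in> measurable N' (supp_alg P j)" if "j \<in> {1..T}" for j
    by (rule measurable_compose[OF s component_measurable[OF that]])
  have 1: "(\<lambda>q. dcost_cur P t (if t = 1 then 0 else induced (X (p q)) (s q) (t - 1)) (induced (X (p q)) (s q) t) (s q t))
     \<in> borel_measurable N'"
    by (rule measurable_cost_compose[OF cost_facts(4)[OF t] prev_jointly_measurable[OF X t p s] ind[OF t t] comp[OF t]])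
  have 2: "(\<lambda>q. if t < T then dcost_prev P (Suc t) (induced (X (p q)) (s q) t) (induced (X (p q)) (s q) (Suc t)) (s q (Suc t))
     else 0) \<in> borel_measurable N'"
  proof (cases "t < T")
    case True
    then have t': "Suc t \<in> {1..T}" by auto
    show ?thesis using True
      measurable_cost_compose[OF cost_facts(3)[OF t'] _ ind[OF t' t'] comp[OF t']] ind[OF t t] by simp
  qed simp
  have "grad_of t (X (p q)) (s q)
    = dcost_cur P t (if t = 1 then 0 else induced (X (p q)) (s q) (t - 1)) (induced (X (p q)) (s q) t) (s q t)
      + (if t < T then dcost_prev P (Suc t) (induced (X (p q)) (s q) t) (induced (X (p q)) (s q) (Suc t)) (s q (Suc t)) else 0)"
    if "q \<in> space N'" for q
    using dobj_eq(1)[OF t _ induced_in_dspaces] jointly_feasible_policy[OF X measurable_space[OF p that]]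
      measurable_space[OF s that] by blast
  then show ?thesis using borel_measurable_add[OF 1 2] by (simp cong: measurable_cong)
qed

end

section \<open>Conditional laws\<close>

text \<open>
  Transporting \<open>K x\<close> to the product space by \<open>Pair x\<close> makes the integrand independent of \<open>x\<close>.
\<close>

lemma integral_kernel_measurable:
  fixes f :: "'a \<Rightarrow> 'b \<Rightarrow> 'c::{banach, second_countable_topology}"
  assumes f: "(\<lambda>(x, y). f x y) \<in> borel_measurable (M \<Otimes>\<^sub>M N)"
    and K: "K \<in> measurable M (subprob_algebra N)"
  shows "(\<lambda>x. \<integral>y. f x y \<partial>K x) \<in> borel_measurable M"
proof -
  let ?D = "\<lambda>x. distr (K x) (M \<Otimes>\<^sub>M N) (Pair x)"
  have "?D \<in> measurable M (subprob_algebra (M \<Otimes>\<^sub>M N))"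
    by (rule measurable_distr2[OF _ K]) simp
  from measurable_compose[OF this integral_measurable_subprob_algebra[OF f]]
  have "(\<lambda>x. \<integral>q. (case q of (x, y) \<Rightarrow> f x y) \<partial>?D x) \<in> borel_measurable M" .
  moreover have "(\<integral>q. (case q of (x, y) \<Rightarrow> f x y) \<partial>?D x) = (\<integral>y. f x y \<partial>K x)" if x: "x \<in> space M" for x
  proof -
    have "sets (K x) = sets N" by (rule sets_kernel[OF K x])
    then have "Pair x \<in> measurable (K x) (M \<Otimes>\<^sub>M N)" using x measurable_cong_sets by fastforce
    from integral_distr[OF this f] show ?thesis by simp
  qed
  ultimately show ?thesis by (simp cong: measurable_cong)
qed

context msp_problem
begin

definition law :: "(nat \<Rightarrow> 'z) measure" where
  "law = distr (base P) (hist P T) (scenario P)"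

lemma sets_law [simp, measurable_cong]: "sets law = sets (hist P T)"
  and space_law [simp]: "space law = space (hist P T)"
  by (simp_all add: law_def)

lemma prob_law: "prob_space law"
  unfolding law_def by (rule base.prob_space_distr[OF scenario_measurable])

sublocale law: prob_space law by (rule prob_law)

lemma integral_law:
  fixes f :: "_ \<Rightarrow> real"
  shows "f \<in> borel_measurable (hist P T) \<Longrightarrow> (\<integral>\<omega>. f (scenario P \<omega>) \<partial>base P) = (\<integral>\<xi>. f \<xi> \<partial>law)"
  unfolding law_def by (rule integral_distr[OF scenario_measurable, symmetric])

lemma trunc_scenario_measurable:
  "t \<le> T \<Longrightarrow> (\<lambda>\<omega>. trunc t (scenario P \<omega>)) \<in> measurable (base P) (hist P t)"
  by (rule measurable_compose[OF scenario_measurable trunc_measurable])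

lemma hist_sigma_subalgebra:
  assumes "t \<le> T"
  shows "finite_measure_subalgebra (base P) (hist_sigma P t)"
proof (unfold_locales, unfold subalgebra_def, intro conjI)
  show "space (hist_sigma P t) = space (base P)" by (simp add: hist_sigma_def)
  show "sets (hist_sigma P t) \<subseteq> sets (base P)"
    unfolding hist_sigma_def
    by (rule sets_image_in_sets[OF refl trunc_scenario_measurable[OF assms]])
qed

lemma cond_law_kernel:
  assumes Q: "cond_law P Q" and t: "t \<in> {1..T}"
  shows "Q t \<in> measurable (hist P t) (subprob_algebra (hist P T))"
    and "s \<in> space (hist P t) \<Longrightarrow> prob_space (Q t s)"
    and "s \<in> space (hist P t) \<Longrightarrow> sets (Q t s) = sets (hist P T)"
proof -
  have q: "Q t \<in> measurable (hist P t) (prob_algebra (hist P T))"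
    using Q t unfolding cond_law_def by blast
  then show "Q t \<in> measurable (hist P t) (subprob_algebra (hist P T))"
    by (rule measurable_prob_algebraD)
  show "s \<in> space (hist P t) \<Longrightarrow> prob_space (Q t s)" "s \<in> space (hist P t) \<Longrightarrow> sets (Q t s) = sets (hist P T)"
    using measurable_space[OF q] by (auto simp: space_prob_algebra)
qed

text \<open>
  Integrate the almost sure identity that defines the conditional law over the event that the history
  lies in \<open>A\<close>.
\<close>

lemma cond_law_rectangle:
  assumes Q: "cond_law P Q" and t: "t \<in> {1..T}"
    and A: "A \<in> sets (hist P t)" and B: "B \<in> sets (hist P T)"
  shows "(\<integral>\<omega>. indicator A (trunc t (scenario P \<omega>)) * measure (Q t (trunc t (scenario P \<omega>))) B \<partial>base P)
    = measure (base P) {\<omega>\<in>space (base P). trunc t (scenario P \<omega>) \<in> A \<and> scenario P \<omega> \<in> B}"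
proof -
  have tT: "t \<le> T" using t by simp
  interpret fs: finite_measure_subalgebra "base P" "hist_sigma P t" by (rule hist_sigma_subalgebra[OF tT])
  let ?\<tau> = "\<lambda>\<omega>. trunc t (scenario P \<omega>)"
  define C where "C = ?\<tau> -` A \<inter> space (base P)"
  have C: "C \<in> sets (hist_sigma P t)" unfolding C_def hist_sigma_def by (rule in_vimage_algebra[OF A])
  have ind: "integrable (base P) (\<lambda>\<omega>. indicator B (scenario P \<omega>) :: real)"
    using scenario_measurable B by (intro base.integrable_const_bound[where B=1]) (auto simp: indicator_def)
  have ae: "AE \<omega> in base P. measure (Q t (?\<tau> \<omega>)) B
      = real_cond_exp (base P) (hist_sigma P t) (\<lambda>\<omega>. indicator B (scenario P \<omega>)) \<omega>"
    using Q t B unfolding cond_law_def by blast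
  have mQ: "(\<lambda>\<omega>. measure (Q t (?\<tau> \<omega>)) B) \<in> borel_measurable (base P)"
    by (rule measurable_compose[OF measurable_compose[OF trunc_scenario_measurable[OF tT] cond_law_kernel(1)[OF Q t]]
       measurable_measure_subprob_algebra[OF B]])
  have "(\<integral>\<omega>. indicator A (?\<tau> \<omega>) * measure (Q t (?\<tau> \<omega>)) B \<partial>base P)
     = (\<integral>\<omega>\<in>C. real_cond_exp (base P) (hist_sigma P t) (\<lambda>\<omega>. indicator B (scenario P \<omega>)) \<omega> \<partial>base P)"
    unfolding set_lebesgue_integral_def
  proof (rule integral_cong_AE)
    have "(\<lambda>\<omega>. indicator A (?\<tau> \<omega>) :: real) \<in> borel_measurable (base P)"
      using trunc_scenario_measurable[OF tT] A by measurable
    then show "(\<lambda>\<omega>. indicator A (?\<tau> \<omega>) * measure (Q t (?\<tau> \<omega>)) B) \<in> borel_measurable (base P)"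
      using mQ by (rule borel_measurable_times)
    have "C \<in> sets (base P)" using C fs.subalg by (auto simp: subalgebra_def)
    then show "(\<lambda>\<omega>. indicator C \<omega> *\<^sub>R real_cond_exp (base P) (hist_sigma P t) (\<lambda>\<omega>. indicator B (scenario P \<omega>)) \<omega>)
       \<in> borel_measurable (base P)" by measurable
    show "AE \<omega> in base P. indicator A (?\<tau> \<omega>) * measure (Q t (?\<tau> \<omega>)) B =
         indicator C \<omega> *\<^sub>R real_cond_exp (base P) (hist_sigma P t) (\<lambda>\<omega>. indicator B (scenario P \<omega>)) \<omega>"
      using ae AE_space by eventually_elim (auto simp: C_def indicator_def)
  qed
  also have "\<dots> = (\<integral>\<omega>\<in>C. indicator B (scenario P \<omega>) \<partial>base P)"
    by (rule fs.real_cond_exp_intA[OF ind C, symmetric])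
  also have "\<dots> = (\<integral>\<omega>. indicator {\<omega>\<in>space (base P). ?\<tau> \<omega> \<in> A \<and> scenario P \<omega> \<in> B} \<omega> \<partial>base P)"
    unfolding set_lebesgue_integral_def by (rule Bochner_Integration.integral_cong) (auto simp: C_def indicator_def)
  also have "\<dots> = measure (base P) {\<omega>\<in>space (base P). ?\<tau> \<omega> \<in> A \<and> scenario P \<omega> \<in> B}"
  proof -
    have "{\<omega>\<in>space (base P). ?\<tau> \<omega> \<in> A \<and> scenario P \<omega> \<in> B} \<in> sets (base P)"
      using trunc_scenario_measurable[OF tT] scenario_measurable A B by measurable
    then show ?thesis by simp
  qed
  finally show ?thesis .
qed

text \<open>
  The joint law of history and path, and the law that results when the path is drawn afresh from the
  conditional law given the history, agree on rectangles and are therefore equal.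
\<close>

lemma disintegration:
  fixes H :: "(nat \<Rightarrow> 'z) \<Rightarrow> (nat \<Rightarrow> 'z) \<Rightarrow> real"
  assumes Q: "cond_law P Q" and t: "t \<in> {1..T}"
    and H: "(\<lambda>(s, \<xi>). H s \<xi>) \<in> borel_measurable (hist P t \<Otimes>\<^sub>M hist P T)"
    and bd: "\<And>s \<xi>. s \<in> space (hist P t) \<Longrightarrow> \<xi> \<in> space (hist P T) \<Longrightarrow> \<bar>H s \<xi>\<bar> \<le> C"
  shows "(\<integral>\<xi>. (\<integral>\<xi>'. H (trunc t \<xi>) \<xi>' \<partial>Q t (trunc t \<xi>)) \<partial>law) = (\<integral>\<xi>. H (trunc t \<xi>) \<xi> \<partial>law)"
proof -
  have tT: "t \<le> T" using t by simp
  let ?N = "hist P t \<Otimes>\<^sub>M hist P T" and ?\<tau> = "\<lambda>\<omega>. trunc t (scenario P \<omega>)"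
  note \<tau> = trunc_scenario_measurable[OF tT]
  note ker = cond_law_kernel[OF Q t]
  have \<tau>s: "?\<tau> \<omega> \<in> space (hist P t)" if "\<omega> \<in> space (base P)" for \<omega> using measurable_space[OF \<tau> that] .
  define K where "K \<omega> = distr (Q t (?\<tau> \<omega>)) ?N (\<lambda>\<xi>. (?\<tau> \<omega>, \<xi>))" for \<omega>
  have K: "K \<in> measurable (base P) (subprob_algebra ?N)"
    unfolding K_def
  proof (rule measurable_distr2)
    show "(\<lambda>(\<omega>, \<xi>). (?\<tau> \<omega>, \<xi>)) \<in> measurable (base P \<Otimes>\<^sub>M hist P T) ?N"
      using \<tau> by measurable
    show "(\<lambda>\<omega>. Q t (?\<tau> \<omega>)) \<in> measurable (base P) (subprob_algebra (hist P T))"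
      by (rule measurable_compose[OF \<tau> ker(1)])
  qed
  have pair: "(\<lambda>\<xi>. (?\<tau> \<omega>, \<xi>)) \<in> measurable (Q t (?\<tau> \<omega>)) ?N" if "\<omega> \<in> space (base P)" for \<omega>
    unfolding measurable_cong_sets[OF ker(3)[OF \<tau>s[OF that]] refl] by (rule measurable_Pair1'[OF \<tau>s[OF that]])
  have pK: "prob_space (K \<omega>)" if "\<omega> \<in> space (base P)" for \<omega>
    unfolding K_def by (rule prob_space.prob_space_distr[OF ker(2)[OF \<tau>s[OF that]] pair[OF that]])
  interpret bK: prob_space "base P \<bind> K"
    using pK by (intro base.prob_space_bind[OF _ K]) auto
  have gm: "(\<lambda>\<omega>. (?\<tau> \<omega>, scenario P \<omega>)) \<in> measurable (base P) ?N"
    using \<tau> scenario_measurable by measurable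
  define D where "D = distr (base P) ?N (\<lambda>\<omega>. (?\<tau> \<omega>, scenario P \<omega>))"
  interpret D: prob_space D unfolding D_def by (rule base.prob_space_distr[OF gm])
  have sK: "sets (base P \<bind> K) = sets ?N"
    by (rule sets_bind) (auto simp: K_def base.not_empty)
  have eq: "base P \<bind> K = D"
  proof (rule measure_eqI_generator_eq[OF Int_stable_pair_measure_generator[of "hist P t" "hist P T"]])
    let ?E = "{a \<times> b |a b. a \<in> sets (hist P t) \<and> b \<in> sets (hist P T)}"
    show "?E \<subseteq> Pow (space (hist P t) \<times> space (hist P T))"
      using sets.sets_into_space by blast
    show "sets (base P \<bind> K) = sigma_sets (space (hist P t) \<times> space (hist P T)) ?E"
      unfolding sK sets_pair_measure ..
    show "sets D = sigma_sets (space (hist P t) \<times> space (hist P T)) ?E"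
      unfolding D_def sets_distr sets_pair_measure ..
    show "range (\<lambda>_::nat. space (hist P t) \<times> space (hist P T)) \<subseteq> ?E" by blast
    show "(\<Union>i::nat. space (hist P t) \<times> space (hist P T)) = space (hist P t) \<times> space (hist P T)" by simp
    show "emeasure (base P \<bind> K) (space (hist P t) \<times> space (hist P T)) \<noteq> \<infinity>" by simp
  next
    fix X assume "X \<in> {a \<times> b |a b. a \<in> sets (hist P t) \<and> b \<in> sets (hist P T)}"
    then obtain A B where X: "X = A \<times> B" and A: "A \<in> sets (hist P t)" and B: "B \<in> sets (hist P T)" by auto
    have XN: "X \<in> sets ?N" unfolding X using A B by simp
    have "measure (base P \<bind> K) X = (\<integral>\<omega>. measure (K \<omega>) X \<partial>base P)"
      by (rule base.measure_bind[OF K XN])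
    also have "\<dots> = (\<integral>\<omega>. indicator A (?\<tau> \<omega>) * measure (Q t (?\<tau> \<omega>)) B \<partial>base P)"
    proof (rule Bochner_Integration.integral_cong[OF refl])
      fix \<omega> assume \<omega>: "\<omega> \<in> space (base P)"
      have "B \<subseteq> space (Q t (?\<tau> \<omega>))"
        using sets.sets_into_space[OF B] sets_eq_imp_space_eq[OF ker(3)[OF \<tau>s[OF \<omega>]]] by simp
      then have "(\<lambda>\<xi>. (?\<tau> \<omega>, \<xi>)) -` X \<inter> space (Q t (?\<tau> \<omega>)) = (if ?\<tau> \<omega> \<in> A then B else {})"
        unfolding X by auto
      then show "measure (K \<omega>) X = indicator A (?\<tau> \<omega>) * measure (Q t (?\<tau> \<omega>)) B"
        unfolding K_def measure_distr[OF pair[OF \<omega>] XN] by simp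
    qed
    also have "\<dots> = measure D X"
      unfolding cond_law_rectangle[OF Q t A B] D_def measure_distr[OF gm XN]
      by (rule arg_cong[where f="measure (base P)"]) (auto simp: X)
    finally show "emeasure (base P \<bind> K) X = emeasure D X"
      by (simp add: bK.emeasure_eq_measure D.emeasure_eq_measure)
  qed
  have bd': "\<bar>case_prod H x\<bar> \<le> C" if "x \<in> space ?N" for x
    using bd that by (auto simp: space_pair_measure)
  have "(\<integral>x. case_prod H x \<partial>(base P \<bind> K)) = (\<integral>\<omega>. (\<integral>x. case_prod H x \<partial>K \<omega>) \<partial>base P)"
  proof (rule integral_bind[OF H bd' K, where B'=1])
    show "finite_measure (base P)" by unfold_locales
    show "AE \<omega> in base P. emeasure (K \<omega>) (space (K \<omega>)) \<le> ennreal 1"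
      using pK by (auto intro!: AE_I2 simp: prob_space.emeasure_space_1)
  qed
  also have "\<dots> = (\<integral>\<omega>. (\<integral>\<xi>'. H (?\<tau> \<omega>) \<xi>' \<partial>Q t (?\<tau> \<omega>)) \<partial>base P)"
  proof (rule Bochner_Integration.integral_cong[OF refl])
    fix \<omega> assume \<omega>: "\<omega> \<in> space (base P)"
    show "(\<integral>x. case_prod H x \<partial>K \<omega>) = (\<integral>\<xi>'. H (?\<tau> \<omega>) \<xi>' \<partial>Q t (?\<tau> \<omega>))"
      unfolding K_def by (simp add: integral_distr[OF pair[OF \<omega>] H])
  qed
  also have "\<dots> = (\<integral>\<xi>. (\<integral>\<xi>'. H (trunc t \<xi>) \<xi>' \<partial>Q t (trunc t \<xi>)) \<partial>law)"
    by (rule integral_law) (rule measurable_compose[OF trunc_measurable[OF tT]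
        integral_kernel_measurable[OF H ker(1)]])
  finally have 1: "(\<integral>x. case_prod H x \<partial>D) = (\<integral>\<xi>. (\<integral>\<xi>'. H (trunc t \<xi>) \<xi>' \<partial>Q t (trunc t \<xi>)) \<partial>law)"
    unfolding eq .
  have "(\<integral>x. case_prod H x \<partial>D) = (\<integral>\<omega>. H (?\<tau> \<omega>) (scenario P \<omega>) \<partial>base P)"
    unfolding D_def by (simp add: integral_distr[OF gm H])
  also have "\<dots> = (\<integral>\<xi>. H (trunc t \<xi>) \<xi> \<partial>law)"
  proof (rule integral_law)
    have "(\<lambda>\<xi>. (trunc t \<xi>, \<xi>)) \<in> measurable (hist P T) ?N"
      using trunc_measurable[OF tT] by measurable
    from measurable_compose[OF this H] show "(\<lambda>\<xi>. H (trunc t \<xi>) \<xi>) \<in> borel_measurable (hist P T)" by simp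
  qed
  finally show ?thesis using 1 by simp
qed

end

section \<open>Independent seeds\<close>

lemma prob_unif01: "prob_space unif01"
  unfolding unif01_def by (rule prob_space_restrict_space) auto

text \<open>
  In a product of probability spaces, redrawing one coordinate does not change the distribution. The
  bound on \<open>f\<close> makes all integrals exist.
\<close>

lemma resampling:
  fixes f :: "('i \<Rightarrow> real) \<Rightarrow> real"
  assumes I: "finite I" "i \<in> I" and f: "f \<in> borel_measurable (PiM I (\<lambda>_. unif01))"
    and bd: "\<And>z. z \<in> space (PiM I (\<lambda>_. unif01)) \<Longrightarrow> \<bar>f z\<bar> \<le> C"
  shows "integrable (PiM I (\<lambda>_. unif01)) (\<lambda>z. \<integral>y. f (z(i := y)) \<partial>unif01)"
    and "(\<integral>z. f z \<partial>PiM I (\<lambda>_. unif01)) = (\<integral>z. (\<integral>y. f (z(i := y)) \<partial>unif01) \<partial>PiM I (\<lambda>_. unif01))"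
proof -
  interpret U: prob_space unif01 by (rule prob_unif01)
  interpret product_prob_space "\<lambda>_. unif01" I by unfold_locales
  let ?Z = "PiM I (\<lambda>_. unif01)"
  define J where "J = I - {i}"
  have J: "finite J" "i \<notin> J" "I = insert i J" using I by (auto simp: J_def)
  have upd: "(\<lambda>(z, y). z(i := y)) \<in> measurable (?Z \<Otimes>\<^sub>M unif01) ?Z"
    unfolding split_beta' by (rule measurable_fun_upd[where J=I]) (use I in auto)
  have f2: "(\<lambda>(z, y). f (z(i := y))) \<in> borel_measurable (?Z \<Otimes>\<^sub>M unif01)"
    using measurable_compose[OF upd f] by (simp add: split_beta')
  have updS: "z(i := y) \<in> space ?Z" if "z \<in> space ?Z" "y \<in> space unif01" for z y
    using measurable_space[OF upd, of "(z, y)"] that by (simp add: space_pair_measure)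
  define h where "h z = (\<integral>y. f (z(i := y)) \<partial>unif01)" for z
  have fi: "integrable ?Z f"
    using f bd by (intro P.integrable_const_bound[where B=C]) auto
  have hi: "integrable ?Z h"
  proof (rule P.integrable_const_bound[where B=C])
    show "h \<in> borel_measurable ?Z" unfolding h_def using f2 by (rule U.borel_measurable_lebesgue_integral)
    have "\<bar>h z\<bar> \<le> C" if z: "z \<in> space ?Z" for z
    proof -
      have "(\<lambda>y. f (z(i := y))) \<in> borel_measurable unif01"
        using measurable_Pair2[OF f2 z] by simp
      then have "integrable unif01 (\<lambda>y. f (z(i := y)))"
        using bd updS[OF z] by (intro U.integrable_const_bound[where B=C]) auto
      then show ?thesis unfolding h_def
        using bd updS[OF z] U.integral_ge_const[of "\<lambda>y. f (z(i := y))" "- C"]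
          U.integral_le_const[of "\<lambda>y. f (z(i := y))" C] by (auto simp: abs_le_iff intro!: AE_I2) (force simp: abs_le_iff)+
    qed
    then show "AE z in ?Z. norm (h z) \<le> C" by auto
  qed
  have "(\<integral>z. h z \<partial>?Z) = (\<integral>x. (\<integral>y. h (x(i := y)) \<partial>unif01) \<partial>PiM J (\<lambda>_. unif01))"
    using product_integral_insert[OF J(1,2), of h] hi unfolding J(3) by simp
  also have "\<dots> = (\<integral>x. (\<integral>y. f (x(i := y)) \<partial>unif01) \<partial>PiM J (\<lambda>_. unif01))"
    by (simp add: h_def U.prob_space)
  also have "\<dots> = (\<integral>z. f z \<partial>?Z)"
    using product_integral_insert[OF J(1,2), of f] fi unfolding J(3) by simp
  finally show "(\<integral>z. f z \<partial>?Z) = (\<integral>z. (\<integral>y. f (z(i := y)) \<partial>unif01) \<partial>?Z)" by (simp add: h_def)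
  show "integrable ?Z (\<lambda>z. \<integral>y. f (z(i := y)) \<partial>unif01)" using hi by (simp add: h_def[abs_def])
qed

section \<open>The run as a function of the seeds\<close>

locale amd_problem = msp_problem P Xstar
  for P :: "('w, 'z::euclidean_space, 'x::euclidean_space) msp" and Xstar +
  fixes X0 :: "nat \<Rightarrow> (nat \<Rightarrow> 'z) \<Rightarrow> 'x"
    and Q :: "nat \<Rightarrow> (nat \<Rightarrow> 'z) \<Rightarrow> (nat \<Rightarrow> 'z) measure"
    and smp :: "nat \<Rightarrow> (nat \<Rightarrow> 'z) \<Rightarrow> real \<Rightarrow> 'z"
    and v :: "nat \<Rightarrow> 'x \<Rightarrow> real" and dv :: "nat \<Rightarrow> 'x \<Rightarrow> 'x"
    and \<beta> Lip \<sigma>t \<alpha> A :: "nat \<Rightarrow> real"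
    and \<mu> L2 :: real and L :: nat
  assumes dgf: "dgf_setup P v dv"
    and cond_law: "cond_law P Q"
    and sampler: "\<And>t. t \<in> {2..horizon P} \<Longrightarrow> biased_sampler P Q t (\<beta> t) (smp t)"
    and constants: "scg_constants P Q smp \<beta> Lip \<sigma>t"
    and params: "\<mu> \<ge> 0" "L2 > 0"
    and X0: "\<And>t. t \<in> {1..horizon P} \<Longrightarrow> X0 t \<in> policies P t (dgf_dom (dspace P t) (feas P t) (v t))"
    and steps: "amd_steps 1 (1/2) \<mu> L2 L \<alpha> A"
    and curvature: "\<And>\<xi> x x'. \<xi> \<in> space (hist P (horizon P)) \<Longrightarrow>
      x \<in> feas_tuples P \<Longrightarrow> x' \<in> feas_tuples P \<Longrightarrow>
      \<mu> / 2 * (tnorm P (\<lambda>t. x t - x' t))\<^sup>2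
        \<le> objective P x' \<xi> - objective P x \<xi> - (\<Sum>t = 1..horizon P. dobj P t x \<xi> \<bullet> (x' t - x t)) \<and>
      objective P x' \<xi> - objective P x \<xi> - (\<Sum>t = 1..horizon P. dobj P t x \<xi> \<bullet> (x' t - x t))
        \<le> L2 / 2 * (tnorm P (\<lambda>t. x t - x' t))\<^sup>2"
begin

abbreviation "Z \<equiv> PiM ({1..T} \<times> {0..L}) (\<lambda>_. unif01)"
abbreviation "M \<equiv> 2 * L2"
abbreviation "m \<equiv> \<mu> / 2"
abbreviation "ZH t \<equiv> Z \<Otimes>\<^sub>M hist P t"
abbreviation "bias \<equiv> bias_const P \<beta> Lip"
abbreviation "init_div \<xi> \<equiv> bregman_tuple P v dv (induced Xstar \<xi>) (induced X0 \<xi>)"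

text \<open>
  The state consists of the policies \<open>X\<close> and of the slope of the model that \<open>X-\<close> minimizes, before the
  gradient of the current iteration is added. The initial slope is the linear part of the divergence to
  \<open>X0\<close>.
\<close>

primrec run_state where
  "run_state 0 z = (X0, \<lambda>t s. - (M *\<^sub>R dv t (X0 t s)))"
| "run_state (Suc l) z =
    (let X = fst (run_state l z); S = snd (run_state l z);
         G = (\<lambda>t s. scg P smp X t s (z (t, l)));
         S' = (\<lambda>t s. S t s + \<alpha> l *\<^sub>R (G t s - m *\<^sub>R X t s));
         \<tau> = \<alpha> (Suc l) / A (Suc l)
     in (\<lambda>t s. \<tau> *\<^sub>R prox (feas P t) (v t) M (m * A l) (S' t s)
              + (1 - \<tau>) *\<^sub>R closest_point (feas P t) (X t s - (1 / M) *\<^sub>R G t s), S'))"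

definition "run_X l z = fst (run_state l z)"
definition "run_S l z = snd (run_state l z)"
definition "run_G l z t s = scg P smp (run_X l z) t s (z (t, l))"
definition "run_Xp l z t s = closest_point (feas P t) (run_X l z t s - (1 / M) *\<^sub>R run_G l z t s)"
definition "run_Xm l z t s = prox (feas P t) (v t) M (m * A l) (run_S (Suc l) z t s)"

lemma run_X_0: "run_X 0 z = X0"
  by (simp add: run_X_def)

lemma run_X_Suc: "run_X (Suc l) z t s
    = (\<alpha> (Suc l) / A (Suc l)) *\<^sub>R run_Xm l z t s + (1 - \<alpha> (Suc l) / A (Suc l)) *\<^sub>R run_Xp l z t s"
  by (simp add: run_X_def run_Xm_def run_Xp_def run_G_def run_S_def Let_def)

lemma run_S_Suc: "run_S (Suc l) z t s = run_S l z t s + \<alpha> l *\<^sub>R (run_G l z t s - m *\<^sub>R run_X l z t s)"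
  by (simp add: run_X_def run_G_def run_S_def Let_def)

lemma run_S_0: "run_S 0 z t s = - (M *\<^sub>R dv t (X0 t s))"
  by (simp add: run_S_def)

lemma run_S_sum: "run_S (Suc l) z t s
    = (\<Sum>j=0..l. \<alpha> j *\<^sub>R (run_G j z t s - m *\<^sub>R run_X j z t s)) - M *\<^sub>R dv t (X0 t s)"
  by (induction l) (simp_all add: run_S_Suc run_S_0)

text \<open>
  An iterate is a function of the seeds of earlier iterations.
\<close>

lemma run_state_cong:
  "(\<And>t j. j < l \<Longrightarrow> z (t, j) = z' (t, j)) \<Longrightarrow> run_state l z = run_state l z'"
  by (induction l) (simp_all add: Let_def)

lemma run_X_resample: "l \<le> l' \<Longrightarrow> run_X l (z((t, l') := y)) = run_X l z"
  unfolding run_X_def by (rule arg_cong[where f=fst], rule run_state_cong) auto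

lemma run_Xp_resample: "l < l' \<Longrightarrow> run_Xp l (z((t, l') := y)) = run_Xp l z"
  by (simp add: run_Xp_def[abs_def] run_G_def run_X_resample)

lemma prob_Z: "prob_space Z"
  by (rule prob_space_PiM) (rule prob_unif01)

lemma seed_measurable: "t \<in> {1..T} \<Longrightarrow> l \<le> L \<Longrightarrow> (\<lambda>z. z (t, l)) \<in> measurable Z unif01"
  by (rule measurable_component_singleton) auto

lemma step_facts:
  shows "\<alpha> 0 = 1" "A 0 = 1"
    and "l \<le> L \<Longrightarrow> \<alpha> (Suc l) > 0"
    and "l \<le> L \<Longrightarrow> A (Suc l) = A l + \<alpha> (Suc l)"
    and "l \<le> L \<Longrightarrow> M + m * A l = M * (\<alpha> (Suc l))\<^sup>2 / A (Suc l)"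
    and "l \<le> Suc L \<Longrightarrow> (\<Sum>j=0..l. \<alpha> j) = A l"
    and "l \<le> Suc L \<Longrightarrow> A l \<ge> 1" and "l \<le> Suc L \<Longrightarrow> \<alpha> l > 0"
  using amd_stepsD[OF steps] amd_steps_sum[OF steps] by auto

lemma step_ratio: "l \<le> L \<Longrightarrow> 0 \<le> \<alpha> (Suc l) / A (Suc l) \<and> \<alpha> (Suc l) / A (Suc l) \<le> 1"
  using step_facts(3,4)[of l] step_facts(7)[of l] by simp

lemma dgf_stage:
  assumes "t \<in> {1..T}"
  shows "is_dgf (dspace P t) (feas P t) (v t) (dv t)"
    and "X \<in> policies P t (dgf_dom (dspace P t) (feas P t) (v t)) \<Longrightarrow> (\<lambda>s. dv t (X s)) \<in> borel_measurable (hist P t)"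
  using dgf assms unfolding dgf_setup_def by auto

lemma X0_dom:
  assumes "t \<in> {1..T}" "s \<in> space (hist P t)"
  shows "X0 t s \<in> dgf_dom (dspace P t) (feas P t) (v t)" "X0 t s \<in> feas P t" "dv t (X0 t s) \<in> dspace P t"
proof -
  have "X0 t \<in> measurable (hist P t) (restrict_space borel (dgf_dom (dspace P t) (feas P t) (v t)))"
    using X0[OF assms(1)] unfolding policies_def .
  from measurable_space[OF this assms(2)]
  show "X0 t s \<in> dgf_dom (dspace P t) (feas P t) (v t)" by (simp add: space_restrict_space)
  then show "X0 t s \<in> feas P t" "dv t (X0 t s) \<in> dspace P t"
    using dgf_stage(1)[OF assms(1)] by (auto simp: dgf_dom_def is_dgf_def)
qed

lemma smp_measurable:
  assumes "t \<in> {1..T}" "t < T"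
  shows "case_prod (smp (Suc t)) \<in> measurable (hist P t \<Otimes>\<^sub>M unif01) (supp_alg P (Suc t))"
proof -
  have "Suc t \<in> {2..T}" using assms by auto
  from sampler[OF this] show ?thesis unfolding biased_sampler_def by simp
qed

lemma smp_supp:
  assumes "t \<in> {1..T}" "t < T" "s \<in> space (hist P t)" "u \<in> space unif01"
  shows "smp (Suc t) s u \<in> supp P (Suc t)"
  using measurable_space[OF smp_measurable[OF assms(1,2)], of "(s, u)"] assms(3,4)
  by (simp add: space_pair_measure)

lemma dobj_bounded:
  assumes "feasible_policy P X" "t \<in> {1..T}" "\<xi> \<in> space (hist P T)"
  shows "norm (grad_of t X \<xi>) \<le> Lip t"
proof -
  let ?x = "restrict (induced X \<xi>) {1..T}"
  have "norm (dobj P t ?x \<xi>) \<le> Lip t"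
    using constants assms(2,3) restrict_induced_feas_tuples[OF assms(1,3)] unfolding scg_constants_def by blast
  moreover have "dobj P t ?x \<xi> = grad_of t X \<xi>"
    by (rule dobj_cong) (use assms in auto)
  ultimately show ?thesis by simp
qed

lemma scg_in_dspace:
  assumes "feasible_policy P X" "t \<in> {1..T}" "s \<in> space (hist P t)" "u \<in> space unif01"
  shows "scg P smp X t s u \<in> dspace P t" and "norm (scg P smp X t s u) \<le> Lip t"
proof -
  obtain \<xi> where \<xi>: "\<xi> \<in> space (hist P T)" "scg P smp X t s u = grad_of t X \<xi>"
    using scg_eq_dobj[OF assms(1-3)] smp_supp[OF assms(2) _ assms(3,4)] by metis
  show "scg P smp X t s u \<in> dspace P t"
    unfolding \<xi>(2) by (rule dobj_eq(2)[OF assms(2) \<xi>(1) induced_in_dspaces[OF assms(1) \<xi>(1)]])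
  show "norm (scg P smp X t s u) \<le> Lip t"
    unfolding \<xi>(2) by (rule dobj_bounded[OF assms(1,2) \<xi>(1)])
qed

lemma restrict_borelD: "f \<in> measurable N (restrict_space borel E) \<Longrightarrow> f \<in> borel_measurable N"
  by (simp add: measurable_restrict_space2_iff)

lemma run_G_measurable:
  assumes X: "jointly_feasible Z P (run_X l)" and t: "t \<in> {1..T}" and l: "l \<le> L"
  shows "(\<lambda>(z, s). run_G l z t s) \<in> measurable (ZH t) (restrict_space borel (dspace P t))"
  unfolding measurable_restrict_space2_iff
proof
  have u: "(\<lambda>q. fst q (t, l)) \<in> measurable (ZH t) unif01"
    by (rule measurable_compose[OF measurable_fst seed_measurable[OF t l]])
  show "(\<lambda>(z, s). run_G l z t s) \<in> borel_measurable (ZH t)"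
    unfolding run_G_def split_beta'
    by (rule scg_jointly_measurable[where smp=smp, OF X t _ measurable_fst measurable_snd u])
      (rule smp_measurable[OF t])
  show "(\<lambda>(z, s). run_G l z t s) \<in> space (ZH t) \<rightarrow> dspace P t"
    using scg_in_dspace(1)[OF jointly_feasible_policy[OF X] t _ measurable_space[OF seed_measurable[OF t l]]]
    by (auto simp: space_pair_measure run_G_def)
qed

lemma run_S_step_measurable:
  assumes X: "jointly_feasible Z P (run_X l)" and t: "t \<in> {1..T}" and l: "l \<le> L"
    and S: "(\<lambda>(z, s). run_S l z t s) \<in> measurable (ZH t) (restrict_space borel (dspace P t))"
  shows "(\<lambda>(z, s). run_S (Suc l) z t s) \<in> measurable (ZH t) (restrict_space borel (dspace P t))"
proof -
  note G = run_G_measurable[OF X t l]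
  have Xm: "(\<lambda>(z, s). run_X l z t s) \<in> measurable (ZH t) (restrict_space borel (dspace P t))"
    using feas_to_dspace[OF t] X t unfolding jointly_feasible_def by blast
  have sub: "subspace (dspace P t)" using dspace_subspace t by simp
  show ?thesis unfolding measurable_restrict_space2_iff
  proof
    show "(\<lambda>(z, s). run_S (Suc l) z t s) \<in> borel_measurable (ZH t)"
      using restrict_borelD[OF G] restrict_borelD[OF Xm] restrict_borelD[OF S]
      unfolding split_beta' run_S_Suc by measurable
    show "(\<lambda>(z, s). run_S (Suc l) z t s) \<in> space (ZH t) \<rightarrow> dspace P t"
      using measurable_space[OF G] measurable_space[OF Xm] measurable_space[OF S] sub
      by (auto simp: run_S_Suc split_beta' space_restrict_space intro!: subspace_add subspace_scale subspace_diff)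
  qed
qed

lemma run_Xp_step_measurable:
  assumes X: "jointly_feasible Z P (run_X l)" and t: "t \<in> {1..T}" and l: "l \<le> L"
  shows "(\<lambda>(z, s). run_Xp l z t s) \<in> measurable (ZH t) (restrict_space borel (feas P t))"
  unfolding measurable_restrict_space2_iff
proof
  have 1: "(\<lambda>(z, s). run_X l z t s) \<in> borel_measurable (ZH t)"
    using X t restrict_borelD unfolding jointly_feasible_def by blast
  have 2: "(\<lambda>q. case q of (z, s) \<Rightarrow> run_X l z t s - (1 / M) *\<^sub>R run_G l z t s) \<in> borel_measurable (ZH t)"
    using 1 restrict_borelD[OF run_G_measurable[OF X t l]] unfolding split_beta' by measurable
  have "continuous_on UNIV (closest_point (feas P t))"
    using feas_facts[OF t] by (intro continuous_on_closest_point)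
  then have "closest_point (feas P t) \<in> borel_measurable borel" by (rule borel_measurable_continuous_onI)
  from measurable_compose[OF 2 this]
  show "(\<lambda>(z, s). run_Xp l z t s) \<in> borel_measurable (ZH t)"
    by (simp add: run_Xp_def split_beta')
  show "(\<lambda>(z, s). run_Xp l z t s) \<in> space (ZH t) \<rightarrow> feas P t"
    using feas_facts[OF t] closest_point_in_set by (auto simp: run_Xp_def)
qed

lemma run_Xm_step_measurable:
  assumes X: "jointly_feasible Z P (run_X l)" and t: "t \<in> {1..T}" and l: "l \<le> L"
    and S: "(\<lambda>(z, s). run_S l z t s) \<in> measurable (ZH t) (restrict_space borel (dspace P t))"
  shows "(\<lambda>(z, s). run_Xm l z t s) \<in> measurable (ZH t) (restrict_space borel (feas P t))"
  unfolding measurable_restrict_space2_iff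
proof
  note f = feas_facts[OF t] and d = dgf_stage(1)[OF t]
  have sub: "subspace (dspace P t)" using dspace_subspace t by simp
  have c: "m * A l \<ge> 0" using params step_facts(7)[of l] l by simp
  have "continuous_on (dspace P t) (prox (feas P t) (v t) M (m * A l))"
    using continuous_on_prox[OF d sub f(1,4,3,2) _ c] params by simp
  then have "prox (feas P t) (v t) M (m * A l) \<in> borel_measurable (restrict_space borel (dspace P t))"
    by (rule borel_measurable_continuous_on_restrict)
  from measurable_compose[OF run_S_step_measurable[OF X t l S] this]
  show "(\<lambda>(z, s). run_Xm l z t s) \<in> borel_measurable (ZH t)"
    by (simp add: run_Xm_def split_beta')
  have "continuous_on (feas P t) (v t)" using d by (simp add: is_dgf_def)
  then have "prox (feas P t) (v t) M (m * A l) a \<in> feas P t" for a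
    using prox_is_arg_min[OF _ f(3,2), of "v t" M "m * A l" a] by (simp add: is_arg_min_def)
  then show "(\<lambda>(z, s). run_Xm l z t s) \<in> space (ZH t) \<rightarrow> feas P t"
    by (auto simp: run_Xm_def)
qed

text \<open>
  Projections and proximal maps are continuous, and the oracle is measurable in history and seed by
  \<open>scg_jointly_measurable\<close>; this carries joint measurability through the recursion.
\<close>

lemma run_measurable:
  assumes "l \<le> Suc L"
  shows "jointly_feasible Z P (run_X l) \<and> (\<forall>t\<in>{1..T}.
    (\<lambda>(z, s). run_S l z t s) \<in> measurable (ZH t) (restrict_space borel (dspace P t)))"
  using assms
proof (induction l)
  case 0
  have "(\<lambda>(z, s). X0 t s) \<in> measurable (ZH t) (restrict_space borel (feas P t))" if t: "t \<in> {1..T}" for t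
  proof -
    have "X0 t \<in> measurable (hist P t) (restrict_space borel (feas P t))"
      using X0[OF t] X0_dom(2)[OF t] unfolding policies_def measurable_restrict_space2_iff by auto
    from measurable_compose[OF measurable_snd this] show ?thesis by (simp add: split_beta')
  qed
  then have "jointly_feasible Z P (run_X 0)" unfolding jointly_feasible_def run_X_0 by blast
  moreover have "(\<lambda>(z, s). run_S 0 z t s) \<in> measurable (ZH t) (restrict_space borel (dspace P t))"
    if t: "t \<in> {1..T}" for t
    unfolding measurable_restrict_space2_iff
  proof
    have "(\<lambda>q. dv t (X0 t (snd q))) \<in> borel_measurable (ZH t)"
      by (rule measurable_compose[OF measurable_snd dgf_stage(2)[OF t X0[OF t]]])
    then show "(\<lambda>(z, s). run_S 0 z t s) \<in> borel_measurable (ZH t)"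
      unfolding split_beta' run_S_0 by measurable
    show "(\<lambda>(z, s). run_S 0 z t s) \<in> space (ZH t) \<rightarrow> dspace P t"
      using X0_dom(3)[OF t] dspace_subspace[of t] t
      by (auto simp: run_S_0 space_pair_measure intro!: subspace_neg subspace_scale)
  qed
  ultimately show ?case by blast
next
  case (Suc l)
  then have l: "l \<le> L" and X: "jointly_feasible Z P (run_X l)"
    and S: "\<And>t. t \<in> {1..T} \<Longrightarrow> (\<lambda>(z, s). run_S l z t s) \<in> measurable (ZH t) (restrict_space borel (dspace P t))"
    by auto
  have "(\<lambda>(z, s). run_X (Suc l) z t s) \<in> measurable (ZH t) (restrict_space borel (feas P t))"
    if t: "t \<in> {1..T}" for t
  proof -
    note xp = run_Xp_step_measurable[OF X t l] and xm = run_Xm_step_measurable[OF X t l S[OF t]]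
    show ?thesis unfolding measurable_restrict_space2_iff
    proof
      show "(\<lambda>(z, s). run_X (Suc l) z t s) \<in> borel_measurable (ZH t)"
        using restrict_borelD[OF xp] restrict_borelD[OF xm] unfolding split_beta' run_X_Suc by measurable
      show "(\<lambda>(z, s). run_X (Suc l) z t s) \<in> space (ZH t) \<rightarrow> feas P t"
        using measurable_space[OF xp] measurable_space[OF xm] step_ratio[OF l]
        by (auto simp: run_X_Suc split_beta' space_restrict_space intro!: convexD[OF feas_facts(4)[OF t]])
    qed
  qed
  then show ?case using run_S_step_measurable[OF X _ l S] by (auto simp: jointly_feasible_def)
qed

lemma run_X_feasible: "l \<le> Suc L \<Longrightarrow> jointly_feasible Z P (run_X l)"
  using run_measurable by blast

lemma run_Xp_feasible: "l \<le> L \<Longrightarrow> jointly_feasible Z P (run_Xp l)"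
  using run_Xp_step_measurable[OF run_X_feasible] unfolding jointly_feasible_def by auto

text \<open>
  The oracle evaluates policies at histories only, where runs are determined.
\<close>

lemma scg_cong:
  assumes X: "\<And>t s. t \<in> {1..T} \<Longrightarrow> s \<in> space (hist P t) \<Longrightarrow> X t s = X' t s"
    and t: "t \<in> {1..T}" and s: "s \<in> space (hist P t)" and u: "u \<in> space unif01"
  shows "scg P smp X t s u = scg P smp X' t s u"
proof -
  have "(if t = 1 then 0 else X (t - 1) (trunc (t - 1) s)) = (if t = 1 then 0 else X' (t - 1) (trunc (t - 1) s))"
  proof (cases "t = 1")
    case False
    then have "t - 1 \<in> {1..T}" using t by auto
    then show ?thesis using X[of "t - 1"] trunc_space[of "t - 1" t s P] s by simp
  qed simp
  moreover have "X (Suc t) (s(Suc t := smp (Suc t) s u)) = X' (Suc t) (s(Suc t := smp (Suc t) s u))" if "t < T"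
  proof (rule X)
    show "Suc t \<in> {1..T}" using that by auto
    show "s(Suc t := smp (Suc t) s u) \<in> space (hist P (Suc t))"
      using s smp_supp[OF t that s u] unfolding space_hist by (auto simp: PiE_iff extensional_def)
  qed
  ultimately show ?thesis using X[OF t s] by (simp add: scg_def Let_def)
qed

lemma dual_step_prox_obj:
  assumes l: "l \<le> Suc L"
  shows "is_arg_min (\<lambda>y. M * bregman (v t) (dv t) y (X0 t s) +
      (\<Sum>j = 0..l. \<alpha> j * (run_G j z t s \<bullet> (y - run_X j z t s) + m / 2 * (norm (y - run_X j z t s))\<^sup>2))) S x
    \<longleftrightarrow> is_arg_min (prox_obj (v t) M (m * A l) (run_S (Suc l) z t s)) S x"
proof -
  define F where "F y = M * bregman (v t) (dv t) y (X0 t s) +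
      (\<Sum>j = 0..l. \<alpha> j * (run_G j z t s \<bullet> (y - run_X j z t s) + m / 2 * (norm (y - run_X j z t s))\<^sup>2))" for y
  from prox_obj_expand[OF step_facts(6)[OF l], of M "v t" "dv t" "X0 t s" "\<lambda>j. run_G j z t s" "\<lambda>j. run_X j z t s" m]
  obtain k where "\<And>y. F y = prox_obj (v t) M (m * A l) (run_S (Suc l) z t s) y + k"
    unfolding run_S_sum F_def by blast
  from is_arg_min_add_const[of F, OF this] show ?thesis by (simp add: F_def[abs_def])
qed

text \<open>
  By induction on the iteration all gradients coincide, and both minimizers are unique.
\<close>

lemma run_unique:
  assumes run: "amd_run P smp v dv 1 (1/2) \<mu> L2 L \<alpha> A X0 \<zeta> X Xp Xm"
    and z: "z \<in> space Z" "\<And>t l. t \<in> {1..T} \<Longrightarrow> l \<le> L \<Longrightarrow> \<zeta> t l = z (t, l)"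
    and l: "l \<le> L" and t: "t \<in> {1..T}" and s: "s \<in> space (hist P t)"
  shows "Xp l t s = run_Xp l z t s"
proof -
  have u: "z (t, l) \<in> space unif01" if "t \<in> {1..T}" "l \<le> L" for t l
    using measurable_space[OF seed_measurable[OF that] z(1)] .
  have r0: "X 0 t s = X0 t s" if "t \<in> {1..T}" "s \<in> space (hist P t)" for t s
    using run that unfolding amd_run_def Let_def by blast
  have rp: "is_arg_min (\<lambda>x. scg P smp (X l) t s (\<zeta> t l) \<bullet> (x - X l t s) + M / 2 * (norm (x - X l t s))\<^sup>2)
      (\<lambda>x. x \<in> feas P t) (Xp l t s)"
   and rm: "is_arg_min (\<lambda>x. M * bregman (v t) (dv t) x (X0 t s) +
      (\<Sum>j = 0..l. \<alpha> j * (scg P smp (X j) t s (\<zeta> t j) \<bullet> (x - X j t s) + m / 2 * (norm (x - X j t s))\<^sup>2)))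
      (\<lambda>x. x \<in> feas P t) (Xm l t s)"
   and rs: "X (Suc l) t s = (\<alpha> (Suc l) / A (Suc l)) *\<^sub>R Xm l t s + (1 - \<alpha> (Suc l) / A (Suc l)) *\<^sub>R Xp l t s"
   if "l \<le> L" "t \<in> {1..T}" "s \<in> space (hist P t)" for l t s
  proof -
    have e: "(1 + 1) * L2 = M" "(1 - 1 / 2) * \<mu> = m" by simp_all
    note r = run[unfolded amd_run_def Let_def e, rule_format, OF that(2,3), THEN conjunct2, rule_format, OF that(1)]
    from r show "is_arg_min (\<lambda>x. scg P smp (X l) t s (\<zeta> t l) \<bullet> (x - X l t s) + M / 2 * (norm (x - X l t s))\<^sup>2)
      (\<lambda>x. x \<in> feas P t) (Xp l t s)" by blast
    from r show "is_arg_min (\<lambda>x. M * bregman (v t) (dv t) x (X0 t s) +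
      (\<Sum>j = 0..l. \<alpha> j * (scg P smp (X j) t s (\<zeta> t j) \<bullet> (x - X j t s) + m / 2 * (norm (x - X j t s))\<^sup>2)))
      (\<lambda>x. x \<in> feas P t) (Xm l t s)" by blast
    from r show "X (Suc l) t s = (\<alpha> (Suc l) / A (Suc l)) *\<^sub>R Xm l t s + (1 - \<alpha> (Suc l) / A (Suc l)) *\<^sub>R Xp l t s"
      by simp
  qed
  have grad: "scg P smp (X j) t s (\<zeta> t j) = run_G j z t s"
    if "\<And>t s. t \<in> {1..T} \<Longrightarrow> s \<in> space (hist P t) \<Longrightarrow> X j t s = run_X j z t s"
      "j \<le> L" "t \<in> {1..T}" "s \<in> space (hist P t)" for j t s
    unfolding run_G_def z(2)[OF that(3,2)] by (rule scg_cong[OF that(1) that(3,4) u[OF that(3,2)]])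
  have p: "Xp j t s = run_Xp j z t s"
    if "\<And>t s. t \<in> {1..T} \<Longrightarrow> s \<in> space (hist P t) \<Longrightarrow> X j t s = run_X j z t s"
      "j \<le> L" "t \<in> {1..T}" "s \<in> space (hist P t)" for j t s
  proof -
    have e: "scg P smp (X j) t s (\<zeta> t j) = run_G j z t s" by (rule grad) (use that in auto)
    have "X j t s = run_X j z t s" using that by blast
    then show ?thesis
      using gradient_step_closest_point[OF feas_facts(4,5)[OF that(3)] _ rp[OF that(2-4), unfolded e]] params
      by (simp add: run_Xp_def)
  qed
  have "l \<le> Suc L \<Longrightarrow> \<forall>j\<le>l. \<forall>t\<in>{1..T}. \<forall>s\<in>space (hist P t). X j t s = run_X j z t s" for l
  proof (induction l)
    case 0 then show ?case using r0 by (simp add: run_X_0)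
  next
    case (Suc l)
    then have IH: "\<And>j t s. j \<le> l \<Longrightarrow> t \<in> {1..T} \<Longrightarrow> s \<in> space (hist P t) \<Longrightarrow> X j t s = run_X j z t s" and l: "l \<le> L" by auto
    have "X (Suc l) t s = run_X (Suc l) z t s" if t: "t \<in> {1..T}" and s: "s \<in> space (hist P t)" for t s
    proof -
      note f = feas_facts[OF t] and d = dgf_stage(1)[OF t]
      have sub: "subspace (dspace P t)" using dspace_subspace t by simp
      have c: "m * A l \<ge> 0" using params step_facts(7)[of l] l by simp
      have "(\<Sum>j = 0..l. \<alpha> j * (scg P smp (X j) t s (\<zeta> t j) \<bullet> (x - X j t s) + m / 2 * (norm (x - X j t s))\<^sup>2))
        = (\<Sum>j = 0..l. \<alpha> j * (run_G j z t s \<bullet> (x - run_X j z t s) + m / 2 * (norm (x - run_X j z t s))\<^sup>2))" for x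
        by (rule sum.cong) (use IH[OF _ t s] grad[OF IH _ t s] l in auto)
      then have am: "is_arg_min (\<lambda>x. M * bregman (v t) (dv t) x (X0 t s) +
        (\<Sum>j = 0..l. \<alpha> j * (run_G j z t s \<bullet> (x - run_X j z t s) + m / 2 * (norm (x - run_X j z t s))\<^sup>2)))
        (\<lambda>x. x \<in> feas P t) (Xm l t s)" using rm[OF l t s] by simp
      from am l have "is_arg_min (prox_obj (v t) M (m * A l) (run_S (Suc l) z t s)) (\<lambda>x. x \<in> feas P t) (Xm l t s)"
        by (subst (asm) dual_step_prox_obj) auto
      moreover have "run_S (Suc l) z t s \<in> dspace P t"
        using measurable_space[OF bspec[OF conjunct2[OF run_measurable[of "Suc l"]] t], of "(z, s)"] l z(1) s
        by (simp add: space_pair_measure space_restrict_space)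
      ultimately have "Xm l t s = run_Xm l z t s"
        unfolding run_Xm_def using prox_unique[OF d sub f(1,4,3) _ c] params by simp
      moreover have "Xp l t s = run_Xp l z t s" by (rule p) (use IH l t s in auto)
      ultimately show ?thesis unfolding rs[OF l t s] run_X_Suc by simp
    qed
    then show ?case using IH by (auto simp: le_Suc_eq)
  qed
  from this[of l] p l t s show ?thesis by simp
qed

section \<open>The pathwise bound\<close>

text \<open>
  \<open>stage_regret\<close> at one history, where the iterates are points of the decision space.
\<close>

lemma run_regret:
  assumes z: "z \<in> space Z" and t: "t \<in> {1..T}" and s: "s \<in> space (hist P t)" and y: "y \<in> feas P t"
  shows "(\<Sum>l=0..L. A l * (run_G l z t s \<bullet> (run_Xp l z t s - run_X l z t s) + M / 2 * (norm (run_Xp l z t s - run_X l z t s))\<^sup>2))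
      - (\<Sum>l<L. A l * (run_G (Suc l) z t s \<bullet> (run_Xp l z t s - run_X (Suc l) z t s)))
    \<le> M * bregman (v t) (dv t) y (X0 t s)
      + (\<Sum>l=0..L. \<alpha> l * (run_G l z t s \<bullet> (y - run_X l z t s) + m / 2 * (norm (y - run_X l z t s))\<^sup>2))"
proof -
  note f = feas_facts[OF t] and d = dgf_stage(1)[OF t]
  have sub: "subspace (dspace P t)" using dspace_subspace t by simp
  have u: "z (t, l) \<in> space unif01" if "l \<le> L" for l
    using measurable_space[OF seed_measurable[OF t that] z] .
  have pol: "feasible_policy P (run_X l z)" if "l \<le> Suc L" for l
    using jointly_feasible_policy[OF run_X_feasible[OF that] z] .
  have "run_X 0 z t s = X0 t s" by (simp add: run_X_0)
  note R = stage_regret[OF d sub f(1,4), of M m \<alpha> A L "\<lambda>l. run_G l z t s" "\<lambda>l. run_X l z t s"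
      "\<lambda>l. run_Xp l z t s" "\<lambda>l. run_Xm l z t s" y, unfolded \<open>run_X 0 z t s = X0 t s\<close>]
  show ?thesis
  proof (rule R)
    show "M > 0" "m \<ge> 0" "\<alpha> 0 = 1" "A 0 = 1" "y \<in> feas P t" using params step_facts(1,2) y by auto
    show "0 < \<alpha> (Suc l) \<and> A (Suc l) = A l + \<alpha> (Suc l) \<and> 0 < A l \<and> M + m * A l = M * (\<alpha> (Suc l))\<^sup>2 / A (Suc l)"
      if "l < L" for l using step_facts(3-5,7)[of l] that by auto
    show "sum \<alpha> {0..l} = A l" if "l \<le> L" for l using step_facts(6)[of l] that by simp
    show "run_G l z t s \<in> dspace P t" if "l \<le> L" for l
      unfolding run_G_def using scg_in_dspace(1)[OF pol t s u[OF that]] that by simp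
    show "X0 t s \<in> dgf_dom (dspace P t) (feas P t) (v t)" by (rule X0_dom(1)[OF t s])
    show "run_X l z t s \<in> feas P t" if "l \<le> L" for l using policy_value[OF pol t s] that by simp
    show "is_arg_min (\<lambda>y. run_G l z t s \<bullet> (y - run_X l z t s) + M / 2 * (norm (y - run_X l z t s))\<^sup>2) (\<lambda>y. y \<in> feas P t)
       (run_Xp l z t s)" if "l \<le> L" for l
      unfolding run_Xp_def using params by (intro gradient_step_is_arg_min f) auto
    show "is_arg_min (\<lambda>y. M * bregman (v t) (dv t) y (X0 t s) +
         (\<Sum>j = 0..l. \<alpha> j * (run_G j z t s \<bullet> (y - run_X j z t s) + m / 2 * (norm (y - run_X j z t s))\<^sup>2)))
       (\<lambda>y. y \<in> feas P t) (run_Xm l z t s)" if "l \<le> L" for l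
      unfolding dual_step_prox_obj[OF le_SucI[OF that]] run_Xm_def
      using prox_is_arg_min[OF _ f(3,2)] d by (simp add: is_dgf_def)
    show "run_X (Suc l) z t s = (\<alpha> (Suc l) / A (Suc l)) *\<^sub>R run_Xm l z t s + (1 - \<alpha> (Suc l) / A (Suc l)) *\<^sub>R run_Xp l z t s"
      if "l < L" for l by (rule run_X_Suc)
  qed
qed

lemma policy_curvature:
  assumes X: "feasible_policy P X" and Y: "feasible_policy P Y" and \<xi>: "\<xi> \<in> space (hist P T)"
  shows "cost_of X \<xi> + (\<Sum>t=1..T. grad_of t X \<xi> \<bullet> (induced Y \<xi> t - induced X \<xi> t)
        + \<mu> / 2 * (norm (induced Y \<xi> t - induced X \<xi> t))\<^sup>2) \<le> cost_of Y \<xi>" (is ?lower)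
    and "cost_of Y \<xi> \<le> cost_of X \<xi>
       + (\<Sum>t=1..T. grad_of t X \<xi> \<bullet> (induced Y \<xi> t - induced X \<xi> t)
        + L2 / 2 * (norm (induced Y \<xi> t - induced X \<xi> t))\<^sup>2)" (is ?upper)
proof -
  let ?x = "restrict (induced X \<xi>) {1..T}" and ?y = "restrict (induced Y \<xi>) {1..T}"
  have f: "objective P ?x \<xi> = cost_of X \<xi>" "objective P ?y \<xi> = cost_of Y \<xi>"
    by (rule objective_cong; simp)+
  have "(\<Sum>t = 1..T. dobj P t ?x \<xi> \<bullet> (?y t - ?x t))
      = (\<Sum>t = 1..T. grad_of t X \<xi> \<bullet> (induced Y \<xi> t - induced X \<xi> t))"
    by (rule sum.cong[OF refl]) (subst dobj_cong[of ?x "induced X \<xi>"]; simp)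
  moreover have "(tnorm P (\<lambda>t. ?x t - ?y t))\<^sup>2 = (\<Sum>t=1..T. (norm (induced Y \<xi> t - induced X \<xi> t))\<^sup>2)"
  proof -
    have "(tnorm P (\<lambda>t. ?x t - ?y t))\<^sup>2 = (\<Sum>t=1..T. (norm (?x t - ?y t))\<^sup>2)"
      unfolding tnorm_def L2_set_def by (rule real_sqrt_pow2) (rule sum_nonneg, simp)
    also have "\<dots> = (\<Sum>t=1..T. (norm (induced Y \<xi> t - induced X \<xi> t))\<^sup>2)"
      by (rule sum.cong) (auto simp: norm_minus_commute)
    finally show ?thesis .
  qed
  ultimately show ?lower ?upper
    using curvature[OF \<xi> restrict_induced_feas_tuples[OF X \<xi>] restrict_induced_feas_tuples[OF Y \<xi>]]
    unfolding f by (simp_all add: sum.distrib sum_distrib_left)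
qed

definition "err l z \<xi> t = run_G l z t (trunc t \<xi>) - grad_of t (run_X l z) \<xi>"

text \<open>
  \<open>run_regret\<close>, summed over the stages, contains the gradients \<open>g\<close> of the oracle, and
  \<open>accelerated_telescoping\<close> the pathwise gradients \<open>h\<close>; in the sum they occur as \<open>g - h\<close> only. The
  coefficients of the squared norms are what the curvature bounds leave after the models of the
  algorithm are paid for: \<open>\<mu> / 2 - m / 2 = \<mu> / 4\<close>, \<open>M / 2 - L2 / 2 = L2 / 2\<close> and \<open>\<mu> / 2\<close>.
\<close>

lemma pathwise_bound:
  assumes z: "z \<in> space Z" and \<xi>: "\<xi> \<in> space (hist P T)"
  defines "x \<equiv> \<lambda>l t. induced (run_X l z) \<xi> t" and "p \<equiv> \<lambda>l t. induced (run_Xp l z) \<xi> t"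
    and "y \<equiv> \<lambda>t. induced Xstar \<xi> t"
  shows "A L * (cost_of (run_Xp L z) \<xi> - cost_of Xstar \<xi>)
    \<le> M * init_div \<xi>
      + (\<Sum>l=0..L. \<alpha> l * (\<Sum>t=1..T. err l z \<xi> t \<bullet> (y t - x l t) - \<mu> / 4 * (norm (y t - x l t))\<^sup>2))
      + (\<Sum>l=0..L. A l * (\<Sum>t=1..T. err l z \<xi> t \<bullet> (x l t - p l t) - L2 / 2 * (norm (p l t - x l t))\<^sup>2))
      + (\<Sum>l<L. A l * (\<Sum>t=1..T. err (Suc l) z \<xi> t \<bullet> (p l t - x (Suc l) t)
            - \<mu> / 2 * (norm (p l t - x (Suc l) t))\<^sup>2))"
proof -
  define g where "g l t = run_G l z t (trunc t \<xi>)" for l t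
  define h where "h l t = grad_of t (run_X l z) \<xi>" for l t
  define I1 where "I1 l = (\<Sum>t=1..T. h l t \<bullet> (p l t - x l t) + L2 / 2 * (norm (p l t - x l t))\<^sup>2)" for l
  define I2 where "I2 l = (\<Sum>t=1..T. h (Suc l) t \<bullet> (p l t - x (Suc l) t) + \<mu> / 2 * (norm (p l t - x (Suc l) t))\<^sup>2)" for l
  define I3 where "I3 l = (\<Sum>t=1..T. h l t \<bullet> (y t - x l t) + \<mu> / 2 * (norm (y t - x l t))\<^sup>2)" for l
  define R1 where "R1 l = (\<Sum>t=1..T. g l t \<bullet> (p l t - x l t) + M / 2 * (norm (p l t - x l t))\<^sup>2)" for l
  define R2 where "R2 l = (\<Sum>t=1..T. g (Suc l) t \<bullet> (p l t - x (Suc l) t))" for l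
  define R3 where "R3 l = (\<Sum>t=1..T. g l t \<bullet> (y t - x l t) + m / 2 * (norm (y t - x l t))\<^sup>2)" for l
  have fX: "feasible_policy P (run_X l z)" if "l \<le> L" for l
    using jointly_feasible_policy[OF run_X_feasible z] that by simp
  have fXp: "feasible_policy P (run_Xp l z)" if "l \<le> L" for l
    using jointly_feasible_policy[OF run_Xp_feasible z] that by simp
  have F: "A L * (cost_of (run_Xp L z) \<xi> - cost_of Xstar \<xi>)
     \<le> (\<Sum>l=0..L. A l * I1 l) - (\<Sum>l=0..L. \<alpha> l * I3 l) - (\<Sum>l<L. A l * I2 l)"
  proof (rule accelerated_telescoping[where fx="\<lambda>l. cost_of (run_X l z) \<xi>"])
    show "cost_of (run_Xp l z) \<xi> \<le> cost_of (run_X l z) \<xi> + I1 l" if "l \<le> L" for l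
      using policy_curvature(2)[OF fX[OF that] fXp[OF that] \<xi>] by (simp add: I1_def h_def x_def p_def)
    show "cost_of (run_X (Suc l) z) \<xi> + I2 l \<le> cost_of (run_Xp l z) \<xi>" if "l < L" for l
      using policy_curvature(1)[OF fX[of "Suc l"] fXp[of l] \<xi>] that by (simp add: I2_def h_def x_def p_def)
    show "cost_of (run_X l z) \<xi> + I3 l \<le> cost_of Xstar \<xi>" if "l \<le> L" for l
      using policy_curvature(1)[OF fX[OF that] Xstar_feasible \<xi>] by (simp add: I3_def h_def x_def y_def)
    show "A 0 = \<alpha> 0" using step_facts(1,2) by simp
    show "A (Suc l) = A l + \<alpha> (Suc l)" if "l < L" for l using step_facts(4)[of l] that by simp
    show "0 \<le> \<alpha> l" if "l \<le> L" for l using step_facts(8)[of l] that by simp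
    show "0 \<le> A l" if "l \<le> L" for l using step_facts(7)[of l] that by simp
  qed
  have S: "(\<Sum>l=0..L. A l * R1 l) - (\<Sum>l<L. A l * R2 l)
     \<le> M * init_div \<xi> + (\<Sum>l=0..L. \<alpha> l * R3 l)"
  proof -
    have "(\<Sum>t=1..T. (\<Sum>l=0..L. A l * (g l t \<bullet> (p l t - x l t) + M / 2 * (norm (p l t - x l t))\<^sup>2))
        - (\<Sum>l<L. A l * (g (Suc l) t \<bullet> (p l t - x (Suc l) t))))
      \<le> (\<Sum>t=1..T. M * bregman (v t) (dv t) (y t) (induced X0 \<xi> t)
        + (\<Sum>l=0..L. \<alpha> l * (g l t \<bullet> (y t - x l t) + m / 2 * (norm (y t - x l t))\<^sup>2)))"
    proof (rule sum_mono)
      fix t assume t: "t \<in> {1..T}"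
      have s: "trunc t \<xi> \<in> space (hist P t)" using trunc_space[OF _ \<xi>] t by simp
      show "(\<Sum>l=0..L. A l * (g l t \<bullet> (p l t - x l t) + M / 2 * (norm (p l t - x l t))\<^sup>2))
        - (\<Sum>l<L. A l * (g (Suc l) t \<bullet> (p l t - x (Suc l) t)))
        \<le> M * bregman (v t) (dv t) (y t) (induced X0 \<xi> t)
        + (\<Sum>l=0..L. \<alpha> l * (g l t \<bullet> (y t - x l t) + m / 2 * (norm (y t - x l t))\<^sup>2))"
        using run_regret[OF z t s, of "y t"] policy_value[OF Xstar_feasible t s]
        by (simp add: g_def p_def x_def y_def induced_def)
    qed
    then show ?thesis
      unfolding R1_def R2_def R3_def sum_distrib_left bregman_tuple_def bregman_def y_def
      by (simp add: sum.distrib sum_subtractf sum.swap[of _ "{0..L}" "{Suc 0..T}"] sum.swap[of _ "{..<L}" "{Suc 0..T}"]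
          sum_distrib_left right_diff_distrib)
  qed
  have e3: "R3 l - I3 l = (\<Sum>t=1..T. err l z \<xi> t \<bullet> (y t - x l t) - \<mu> / 4 * (norm (y t - x l t))\<^sup>2)" for l
    unfolding R3_def I3_def sum_subtractf[symmetric]
    by (intro sum.cong) (auto simp: err_def g_def h_def inner_diff_left)
  have e1: "I1 l - R1 l = (\<Sum>t=1..T. err l z \<xi> t \<bullet> (x l t - p l t) - L2 / 2 * (norm (p l t - x l t))\<^sup>2)" for l
    unfolding R1_def I1_def sum_subtractf[symmetric]
    by (intro sum.cong) (auto simp: err_def g_def h_def inner_diff_left inner_diff_right algebra_simps)
  have e2: "R2 l - I2 l = (\<Sum>t=1..T. err (Suc l) z \<xi> t \<bullet> (p l t - x (Suc l) t)
            - \<mu> / 2 * (norm (p l t - x (Suc l) t))\<^sup>2)" for l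
    unfolding R2_def I2_def sum_subtractf[symmetric]
    by (intro sum.cong) (auto simp: err_def g_def h_def inner_diff_left)
  show ?thesis using F S unfolding e1[symmetric] e2[symmetric] e3[symmetric]
    by (simp add: right_diff_distrib sum_subtractf)
qed

end

section \<open>Taking expectations\<close>

text \<open>
  The bias-variance decomposition of the mean square distance to a point \<open>c\<close>.
\<close>

lemma integral_sq_dist_mean:
  fixes S :: "'a \<Rightarrow> 'b::euclidean_space"
  assumes N: "prob_space N" and S: "S \<in> borel_measurable N" and bd: "\<And>u. u \<in> space N \<Longrightarrow> norm (S u) \<le> C"
  shows "(\<integral>u. (norm (S u - c))\<^sup>2 \<partial>N)
    = (\<integral>u. (norm (S u - (\<integral>u'. S u' \<partial>N)))\<^sup>2 \<partial>N) + (norm ((\<integral>u. S u \<partial>N) - c))\<^sup>2"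
proof -
  interpret prob_space N by (rule N)
  let ?m = "\<integral>u. S u \<partial>N"
  have Si: "integrable N S" using S bd by (intro integrable_const_bound[where B=C]) auto
  have sq: "integrable N (\<lambda>u. (norm (S u - ?m))\<^sup>2)"
  proof (rule integrable_const_bound[where B="(C + norm ?m)\<^sup>2"])
    show "AE u in N. norm ((norm (S u - ?m))\<^sup>2) \<le> (C + norm ?m)\<^sup>2"
    proof (rule AE_I2)
      fix u assume "u \<in> space N"
      then have "norm (S u - ?m) \<le> C + norm ?m" using bd[of u] norm_triangle_ineq4[of "S u" ?m] by linarith
      then show "norm ((norm (S u - ?m))\<^sup>2) \<le> (C + norm ?m)\<^sup>2" by (simp add: power_mono)
    qed
    show "(\<lambda>u. (norm (S u - ?m))\<^sup>2) \<in> borel_measurable N" using S by measurable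
  qed
  have e: "(norm (S u - c))\<^sup>2 = (norm (S u - ?m))\<^sup>2 + 2 * ((S u - ?m) \<bullet> (?m - c)) + (norm (?m - c))\<^sup>2" for u
    unfolding power2_norm_eq_inner
    by (simp add: inner_diff_left inner_diff_right inner_commute algebra_simps)
  have mean: "(\<integral>u. 2 * ((S u - ?m) \<bullet> (?m - c)) \<partial>N) = 0"
    using Si by (simp add: prob_space)
  have "(\<integral>u. (norm (S u - c))\<^sup>2 \<partial>N)
    = (\<integral>u. (norm (S u - ?m))\<^sup>2 \<partial>N) + (\<integral>u. 2 * ((S u - ?m) \<bullet> (?m - c)) \<partial>N) + (\<integral>u. (norm (?m - c))\<^sup>2 \<partial>N)"
    unfolding e using sq Si by (subst Bochner_Integration.integral_add, auto)+
  then show ?thesis using mean by (simp add: prob_space)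
qed

context msp_problem
begin

lemma feas_bound:
  obtains K where "K \<ge> 0" "\<And>t x. t \<in> {1..T} \<Longrightarrow> x \<in> feas P t \<Longrightarrow> norm x \<le> K"
proof -
  have "bounded (\<Union>t\<in>{1..T}. feas P t)"
    using feas_facts(3) by (intro bounded_UN) (auto intro: compact_imp_bounded)
  then obtain K where "\<And>x. x \<in> (\<Union>t\<in>{1..T}. feas P t) \<Longrightarrow> norm x \<le> K" by (auto simp: bounded_iff)
  then show ?thesis using that[of "max K 0"] by fastforce
qed

lemma jointly_feasible_const:
  assumes "feasible_policy P X"
  shows "jointly_feasible N P (\<lambda>_. X)"
  unfolding jointly_feasible_def
proof
  fix t assume "t \<in> {1..T}"
  then have "X t \<in> measurable (hist P t) (restrict_space borel (feas P t))"
    using assms unfolding feasible_policy_def policies_def by blast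
  from measurable_compose[OF measurable_snd this]
  show "(\<lambda>(p, s). X t s) \<in> measurable (N \<Otimes>\<^sub>M hist P t) (restrict_space borel (feas P t))"
    by (simp add: split_beta')
qed

lemma dobj_path_measurable:
  assumes "feasible_policy P X" "t \<in> {1..T}"
  shows "(\<lambda>\<xi>. grad_of t X \<xi>) \<in> borel_measurable (hist P T)"
  using dobj_jointly_measurable[OF jointly_feasible_const[OF assms(1)] assms(2), of "\<lambda>\<xi>. \<xi>" "hist P T" "hist P T" "\<lambda>\<xi>. \<xi>"]
  by simp

lemma objective_path_measurable:
  assumes "feasible_policy P X"
  shows "(\<lambda>\<xi>. cost_of X \<xi>) \<in> borel_measurable (hist P T)"
  using objective_jointly_measurable[OF jointly_feasible_const[OF assms], of "\<lambda>\<xi>. \<xi>" "hist P T" "hist P T" "\<lambda>\<xi>. \<xi>"]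
  by simp

text \<open>
  Through this lemma the bound of \<open>pathwise_bound\<close>, which is integrated over \<open>base P\<close>, leads to integrals
  over the law of the path.
\<close>

lemma bounded_path_function:
  fixes f :: "(nat \<Rightarrow> 'z) \<Rightarrow> real"
  assumes f: "f \<in> borel_measurable (hist P T)" and bd: "\<And>\<xi>. \<xi> \<in> space (hist P T) \<Longrightarrow> \<bar>f \<xi>\<bar> \<le> C"
  shows "integrable law f" and "integrable (base P) (\<lambda>\<omega>. f (scenario P \<omega>))"
    and "has_bochner_integral (base P) (\<lambda>\<omega>. f (scenario P \<omega>)) (\<integral>\<xi>. f \<xi> \<partial>law)"
proof -
  show "integrable law f" using f bd by (intro law.integrable_const_bound[where B=C]) auto
  show i: "integrable (base P) (\<lambda>\<omega>. f (scenario P \<omega>))"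
    using measurable_compose[OF scenario_measurable f] bd scenario_space
    by (intro base.integrable_const_bound[where B=C]) auto
  show "has_bochner_integral (base P) (\<lambda>\<omega>. f (scenario P \<omega>)) (\<integral>\<xi>. f \<xi> \<partial>law)"
    using i integral_law[OF f] by (simp add: has_bochner_integral_iff)
qed

end

context amd_problem
begin

text \<open>
  \<open>mean_grad\<close> is the block of the gradient of the expected cost, as a function of the history, and
  \<open>oracle_dev\<close> the error of the oracle against it, which consists of bias and noise.
\<close>

definition "mean_grad l z t s = cond_grad P Q (run_X l z) t s"
definition "oracle_dev l z t s = run_G l z t s - mean_grad l z t s"

abbreviation "dev_summand l W \<kappa> t z \<xi> \<equiv>
  oracle_dev l z t (trunc t \<xi>) \<bullet> W z t (trunc t \<xi>) - \<kappa> * (norm (W z t (trunc t \<xi>)))\<^sup>2"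

text \<open>
  Directions are differences of policies; boundedness makes all integrals below exist.
\<close>

definition direction where
  "direction W \<longleftrightarrow> (\<forall>t\<in>{1..T}. (\<lambda>(z, s). W z t s :: 'x) \<in> borel_measurable (ZH t) \<and>
     (\<exists>C. \<forall>z\<in>space Z. \<forall>s\<in>space (hist P t). norm (W z t s) \<le> C))"

lemma direction_diff:
  assumes X: "jointly_feasible Z P X" and Y: "jointly_feasible Z P Y"
  shows "direction (\<lambda>z t s. X z t s - Y z t s)"
  unfolding direction_def
proof (intro ballI conjI)
  fix t assume t: "t \<in> {1..T}"
  have "(\<lambda>(z, s). X z t s) \<in> borel_measurable (ZH t)" "(\<lambda>(z, s). Y z t s) \<in> borel_measurable (ZH t)"
    using X Y t restrict_borelD unfolding jointly_feasible_def by blast+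
  then show "(\<lambda>(z, s). X z t s - Y z t s) \<in> borel_measurable (ZH t)"
    unfolding split_beta' by measurable
  obtain K where "K \<ge> 0" and K: "\<And>t x. t \<in> {1..T} \<Longrightarrow> x \<in> feas P t \<Longrightarrow> norm x \<le> K"
    using feas_bound by blast
  have "norm (X z t s - Y z t s) \<le> K + K" if "z \<in> space Z" "s \<in> space (hist P t)" for z s
    using K[OF t policy_value[OF jointly_feasible_policy[OF X that(1)] t that(2)]]
      K[OF t policy_value[OF jointly_feasible_policy[OF Y that(1)] t that(2)]]
      norm_triangle_ineq4[of "X z t s" "Y z t s"] by linarith
  then show "\<exists>C. \<forall>z\<in>space Z. \<forall>s\<in>space (hist P t). norm (X z t s - Y z t s) \<le> C" by blast
qed

lemma seed_space: "z \<in> space Z \<Longrightarrow> t \<in> {1..T} \<Longrightarrow> l \<le> L \<Longrightarrow> z (t, l) \<in> space unif01"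
  using measurable_space[OF seed_measurable] .

lemma run_X_policy: "z \<in> space Z \<Longrightarrow> l \<le> Suc L \<Longrightarrow> feasible_policy P (run_X l z)"
  using jointly_feasible_policy[OF run_X_feasible] .

lemma run_Xp_policy: "z \<in> space Z \<Longrightarrow> l \<le> L \<Longrightarrow> feasible_policy P (run_Xp l z)"
  using jointly_feasible_policy[OF run_Xp_feasible] .

lemma run_G_bounded:
  "z \<in> space Z \<Longrightarrow> l \<le> L \<Longrightarrow> t \<in> {1..T} \<Longrightarrow> s \<in> space (hist P t) \<Longrightarrow> norm (run_G l z t s) \<le> Lip t"
  unfolding run_G_def using scg_in_dspace(2)[OF run_X_policy _ _ seed_space] by simp

lemma cond_grad_bounded:
  assumes X: "feasible_policy P X" and t: "t \<in> {1..T}" and s: "s \<in> space (hist P t)"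
    and m: "(\<lambda>\<xi>. grad_of t X \<xi>) \<in> borel_measurable (hist P T)"
  shows "norm (cond_grad P Q X t s) \<le> Lip t" and "integrable (Q t s) (\<lambda>\<xi>. grad_of t X \<xi>)"
proof -
  note ker = cond_law_kernel[OF cond_law t]
  interpret q: prob_space "Q t s" by (rule ker(2)[OF s])
  have sp: "space (Q t s) = space (hist P T)" using ker(3)[OF s] by (rule sets_eq_imp_space_eq)
  have b: "norm (grad_of t X \<xi>) \<le> Lip t" if "\<xi> \<in> space (Q t s)" for \<xi>
    using dobj_bounded[OF X t] that sp by simp
  show i: "integrable (Q t s) (\<lambda>\<xi>. grad_of t X \<xi>)"
    using b m measurable_cong_sets[OF ker(3)[OF s] refl]
    by (intro q.integrable_const_bound[where B="Lip t"]) auto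
  have "norm (cond_grad P Q X t s) \<le> (\<integral>\<xi>. norm (grad_of t X \<xi>) \<partial>Q t s)"
    unfolding cond_grad_def by (rule integral_norm_bound)
  also have "\<dots> \<le> Lip t"
    using b i by (intro q.integral_le_const) (auto intro!: AE_I2 integrable_norm)
  finally show "norm (cond_grad P Q X t s) \<le> Lip t" .
qed

lemma mean_grad_measurable:
  assumes l: "l \<le> L" and t: "t \<in> {1..T}"
  shows "(\<lambda>(z, s). mean_grad l z t s) \<in> borel_measurable (ZH t)"
proof -
  have "(\<lambda>q. grad_of t (run_X l (fst (fst q))) (snd q)) \<in> borel_measurable ((ZH t) \<Otimes>\<^sub>M hist P T)"
    by (rule dobj_jointly_measurable[OF run_X_feasible t]) (use l in auto)
  then have "(\<lambda>(p, \<xi>). grad_of t (run_X l (fst p)) \<xi>) \<in> borel_measurable ((ZH t) \<Otimes>\<^sub>M hist P T)"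
    by (simp add: split_beta')
  moreover have "(\<lambda>p. Q t (snd p)) \<in> measurable (ZH t) (subprob_algebra (hist P T))"
    by (rule measurable_compose[OF measurable_snd cond_law_kernel(1)[OF cond_law t]])
  ultimately have "(\<lambda>p. \<integral>\<xi>. grad_of t (run_X l (fst p)) \<xi> \<partial>Q t (snd p)) \<in> borel_measurable (ZH t)"
    by (rule integral_kernel_measurable)
  then show ?thesis by (simp add: mean_grad_def cond_grad_def split_beta')
qed

lemma mean_grad_bounded:
  "z \<in> space Z \<Longrightarrow> l \<le> L \<Longrightarrow> t \<in> {1..T} \<Longrightarrow> s \<in> space (hist P t) \<Longrightarrow> norm (mean_grad l z t s) \<le> Lip t"
  unfolding mean_grad_def using cond_grad_bounded(1)[OF run_X_policy _ _ dobj_path_measurable[OF run_X_policy]] by simp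

lemma dev_measurable:
  assumes l: "l \<le> L" and t: "t \<in> {1..T}"
  shows "(\<lambda>(z, s). oracle_dev l z t s) \<in> borel_measurable (ZH t)"
  using borel_measurable_diff[OF restrict_borelD[OF run_G_measurable[OF run_X_feasible[OF le_SucI[OF l]] t l]] mean_grad_measurable[OF l t]]
  by (simp add: oracle_dev_def split_beta')

lemma dev_bounded:
  assumes "z \<in> space Z" "l \<le> L" "t \<in> {1..T}" "s \<in> space (hist P t)"
  shows "norm (oracle_dev l z t s) \<le> 2 * Lip t"
  using run_G_bounded[OF assms] mean_grad_bounded[OF assms] norm_triangle_ineq4[of "run_G l z t s" "mean_grad l z t s"]
  unfolding oracle_dev_def by linarith

lemma along_path_measurable:
  assumes f: "(\<lambda>(z, s). f z s) \<in> borel_measurable (ZH t)" and t: "t \<le> T"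
  shows "(\<lambda>(z, \<xi>). f z (trunc t \<xi>)) \<in> borel_measurable (ZH T)"
proof -
  have "(\<lambda>q. (fst q, trunc t (snd q))) \<in> measurable (ZH T) (ZH t)"
    by (intro measurable_Pair measurable_fst measurable_compose[OF measurable_snd trunc_measurable[OF t]])
  from measurable_compose[OF this f] show ?thesis by (simp add: split_beta')
qed

text \<open>
  A direction at stage \<open>t\<close> is a function of the history up to \<open>t\<close>. Against such functions the pathwise
  gradient has the same mean as its conditional mean.
\<close>

lemma err_integral:
  assumes z: "z \<in> space Z" and l: "l \<le> L" and t: "t \<in> {1..T}" and W: "direction W"
  shows "has_bochner_integral (base P)
      (\<lambda>\<omega>. err l z (scenario P \<omega>) t \<bullet> W z t (trunc t (scenario P \<omega>)) - \<kappa> * (norm (W z t (trunc t (scenario P \<omega>))))\<^sup>2)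
      (\<integral>\<xi>. dev_summand l W \<kappa> t z \<xi> \<partial>law)"
proof -
  have tT: "t \<le> T" using t by simp
  have tr: "\<xi> \<in> space (hist P T) \<Longrightarrow> trunc t \<xi> \<in> space (hist P t)" for \<xi> using trunc_space[OF tT] .
  obtain C0 where C0: "\<And>s. s \<in> space (hist P t) \<Longrightarrow> norm (W z t s) \<le> C0"
    and Wm: "(\<lambda>(z, s). W z t s) \<in> borel_measurable (ZH t)"
    using W t z unfolding direction_def by blast
  define C where "C = max C0 0"
  have C: "C \<ge> 0" "\<And>s. s \<in> space (hist P t) \<Longrightarrow> norm (W z t s) \<le> C" using C0 by (fastforce simp: C_def)+
  define w where "w \<xi> = W z t (trunc t \<xi>)" for \<xi>
  define g where "g \<xi> = run_G l z t (trunc t \<xi>)" for \<xi>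
  define h where "h \<xi> = grad_of t (run_X l z) \<xi>" for \<xi>
  define c where "c \<xi> = mean_grad l z t (trunc t \<xi>)" for \<xi>
  have wm: "w \<in> borel_measurable (hist P T)" unfolding w_def
    using measurable_Pair2[OF along_path_measurable[OF Wm tT] z] by simp
  have gm: "g \<in> borel_measurable (hist P T)" unfolding g_def
    using measurable_Pair2[OF along_path_measurable[OF restrict_borelD[OF run_G_measurable[OF run_X_feasible t l]] tT] z] l by simp
  have cm: "c \<in> borel_measurable (hist P T)" unfolding c_def
    using measurable_Pair2[OF along_path_measurable[OF mean_grad_measurable[OF l t] tT] z] by simp
  have hm: "h \<in> borel_measurable (hist P T)" unfolding h_def
    by (rule dobj_path_measurable[OF run_X_policy[OF z] t]) (use l in simp)
  have wb: "norm (w \<xi>) \<le> C" and gb: "norm (g \<xi>) \<le> Lip t" and hb: "norm (h \<xi>) \<le> Lip t" and cb: "norm (c \<xi>) \<le> Lip t"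
    if "\<xi> \<in> space (hist P T)" for \<xi>
    using C(2)[OF tr[OF that]] run_G_bounded[OF z l t tr[OF that]] mean_grad_bounded[OF z l t tr[OF that]]
      dobj_bounded[OF run_X_policy[OF z] t that, of l] l
    by (simp_all add: w_def g_def h_def c_def)
  have inb: "\<bar>f \<xi> \<bullet> w \<xi>\<bar> \<le> Lip t * C" if "\<xi> \<in> space (hist P T)" "norm (f \<xi>) \<le> Lip t" for f :: "_ \<Rightarrow> 'x" and \<xi>
  proof -
    have "\<bar>f \<xi> \<bullet> w \<xi>\<bar> \<le> norm (f \<xi>) * norm (w \<xi>)" by (rule Cauchy_Schwarz_ineq2)
    also have "\<dots> \<le> Lip t * C" using wb[OF that(1)] that(2) by (intro mult_mono) (auto intro: order_trans[OF norm_ge_zero])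
    finally show ?thesis .
  qed
  have i: "integrable law (\<lambda>\<xi>. f \<xi> \<bullet> w \<xi>)" "has_bochner_integral (base P) (\<lambda>\<omega>. f (scenario P \<omega>) \<bullet> w (scenario P \<omega>)) (\<integral>\<xi>. f \<xi> \<bullet> w \<xi> \<partial>law)"
    if "f \<in> borel_measurable (hist P T)" "\<And>\<xi>. \<xi> \<in> space (hist P T) \<Longrightarrow> norm (f \<xi>) \<le> Lip t" for f
    using that wm inb by (intro bounded_path_function[where C="Lip t * C"]; simp)+
  have isq: "integrable law (\<lambda>\<xi>. (norm (w \<xi>))\<^sup>2)"
      "has_bochner_integral (base P) (\<lambda>\<omega>. (norm (w (scenario P \<omega>)))\<^sup>2) (\<integral>\<xi>. (norm (w \<xi>))\<^sup>2 \<partial>law)"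
    using wm wb by (intro bounded_path_function[where C="C\<^sup>2"]; simp add: power_mono)+
  have swap: "(\<integral>\<xi>. c \<xi> \<bullet> w \<xi> \<partial>law) = (\<integral>\<xi>. h \<xi> \<bullet> w \<xi> \<partial>law)"
  proof -
    have "(\<integral>\<xi>. c \<xi> \<bullet> w \<xi> \<partial>law) = (\<integral>\<xi>. (\<integral>\<xi>'. h \<xi>' \<bullet> W z t (trunc t \<xi>) \<partial>Q t (trunc t \<xi>)) \<partial>law)"
    proof (rule Bochner_Integration.integral_cong[OF refl])
      fix \<xi> assume "\<xi> \<in> space law"
      then have s: "trunc t \<xi> \<in> space (hist P t)" using tr by simp
      have "integrable (Q t (trunc t \<xi>)) h"
        using cond_grad_bounded(2)[OF run_X_policy[OF z le_SucI[OF l]] t s dobj_path_measurable[OF run_X_policy[OF z le_SucI[OF l]] t]]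
        by (simp only: h_def[abs_def])
      then show "c \<xi> \<bullet> w \<xi> = (\<integral>\<xi>'. h \<xi>' \<bullet> W z t (trunc t \<xi>) \<partial>Q t (trunc t \<xi>))"
        by (simp add: c_def mean_grad_def cond_grad_def w_def h_def[abs_def])
    qed
    also have "\<dots> = (\<integral>\<xi>. h \<xi> \<bullet> W z t (trunc t \<xi>) \<partial>law)"
    proof (rule disintegration[OF cond_law t, where C="Lip t * C"])
      have Wz: "(\<lambda>s. W z t s) \<in> borel_measurable (hist P t)" using measurable_Pair2[OF Wm z] by simp
      show "(\<lambda>(s, \<xi>). h \<xi> \<bullet> W z t s) \<in> borel_measurable (hist P t \<Otimes>\<^sub>M hist P T)"
        using Wz hm unfolding split_beta' by measurable
      fix s \<xi> assume s: "s \<in> space (hist P t)" "\<xi> \<in> space (hist P T)"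
      have "\<bar>h \<xi> \<bullet> W z t s\<bar> \<le> norm (h \<xi>) * norm (W z t s)" by (rule Cauchy_Schwarz_ineq2)
      also have "\<dots> \<le> Lip t * C" using C(2)[OF s(1)] hb[OF s(2)]
        by (intro mult_mono) (auto intro: order_trans[OF norm_ge_zero])
      finally show "\<bar>h \<xi> \<bullet> W z t s\<bar> \<le> Lip t * C" .
    qed
    finally show ?thesis by (simp add: w_def)
  qed
  have "has_bochner_integral (base P)
      (\<lambda>\<omega>. g (scenario P \<omega>) \<bullet> w (scenario P \<omega>) - h (scenario P \<omega>) \<bullet> w (scenario P \<omega>) - \<kappa> * (norm (w (scenario P \<omega>)))\<^sup>2)
      ((\<integral>\<xi>. g \<xi> \<bullet> w \<xi> \<partial>law) - (\<integral>\<xi>. h \<xi> \<bullet> w \<xi> \<partial>law) - \<kappa> * (\<integral>\<xi>. (norm (w \<xi>))\<^sup>2 \<partial>law))"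
    by (intro has_bochner_integral_diff has_bochner_integral_mult_right i(2) isq(2) gm hm gb hb)
  also have "(\<integral>\<xi>. g \<xi> \<bullet> w \<xi> \<partial>law) - (\<integral>\<xi>. h \<xi> \<bullet> w \<xi> \<partial>law) - \<kappa> * (\<integral>\<xi>. (norm (w \<xi>))\<^sup>2 \<partial>law)
      = (\<integral>\<xi>. g \<xi> \<bullet> w \<xi> - c \<xi> \<bullet> w \<xi> - \<kappa> * (norm (w \<xi>))\<^sup>2 \<partial>law)"
    unfolding swap[symmetric] using i(1)[OF gm gb] i(1)[OF cm cb] isq(1) by simp
  finally show ?thesis
    by (simp add: err_def oracle_dev_def g_def h_def w_def c_def inner_diff_left)
qed

definition "dev_term l W \<kappa> z \<xi> =
  (\<Sum>t=1..T. dev_summand l W \<kappa> t z \<xi>)"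

lemma dev_summand_measurable:
  assumes l: "l \<le> L" and t: "t \<in> {1..T}" and W: "direction W"
  shows "(\<lambda>(z, \<xi>). dev_summand l W \<kappa> t z \<xi>)
      \<in> borel_measurable (ZH T)"
    and "\<exists>C. \<forall>z\<in>space Z. \<forall>\<xi>\<in>space (hist P T).
      \<bar>dev_summand l W \<kappa> t z \<xi>\<bar> \<le> C"
proof -
  have tT: "t \<le> T" using t by simp
  obtain C0 where C0: "\<And>z s. z \<in> space Z \<Longrightarrow> s \<in> space (hist P t) \<Longrightarrow> norm (W z t s) \<le> C0"
    and Wm: "(\<lambda>(z, s). W z t s) \<in> borel_measurable (ZH t)"
    using W t unfolding direction_def by blast
  show "(\<lambda>(z, \<xi>). dev_summand l W \<kappa> t z \<xi>)
      \<in> borel_measurable (ZH T)"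
    using along_path_measurable[OF Wm tT] along_path_measurable[OF dev_measurable[OF l t] tT]
    unfolding split_beta' by measurable
  have "\<bar>dev_summand l W \<kappa> t z \<xi>\<bar> \<le> 2 * Lip t * C0 + \<bar>\<kappa>\<bar> * C0\<^sup>2"
    if "z \<in> space Z" "\<xi> \<in> space (hist P T)" for z \<xi>
  proof -
    have s: "trunc t \<xi> \<in> space (hist P t)" by (rule trunc_space[OF tT that(2)])
    have "\<bar>oracle_dev l z t (trunc t \<xi>) \<bullet> W z t (trunc t \<xi>)\<bar> \<le> norm (oracle_dev l z t (trunc t \<xi>)) * norm (W z t (trunc t \<xi>))"
      by (rule Cauchy_Schwarz_ineq2)
    also have "\<dots> \<le> 2 * Lip t * C0"
      using C0[OF that(1) s] dev_bounded[OF that(1) l t s] order_trans[OF norm_ge_zero dev_bounded[OF that(1) l t s]]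
      by (intro mult_mono) auto
    finally have 1: "\<bar>oracle_dev l z t (trunc t \<xi>) \<bullet> W z t (trunc t \<xi>)\<bar> \<le> 2 * Lip t * C0" .
    have "\<bar>\<kappa> * (norm (W z t (trunc t \<xi>)))\<^sup>2\<bar> \<le> \<bar>\<kappa>\<bar> * C0\<^sup>2"
      using C0[OF that(1) s] by (simp add: abs_mult mult_left_mono power_mono)
    with 1 show ?thesis by linarith
  qed
  then show "\<exists>C. \<forall>z\<in>space Z. \<forall>\<xi>\<in>space (hist P T).
      \<bar>dev_summand l W \<kappa> t z \<xi>\<bar> \<le> C" by blast
qed

lemma err_sum_integral:
  assumes z: "z \<in> space Z" and l: "l \<le> L" and W: "direction W"
  shows "has_bochner_integral (base P)
      (\<lambda>\<omega>. \<Sum>t=1..T. err l z (scenario P \<omega>) t \<bullet> W z t (trunc t (scenario P \<omega>)) - \<kappa> * (norm (W z t (trunc t (scenario P \<omega>))))\<^sup>2)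
      (\<integral>\<xi>. dev_term l W \<kappa> z \<xi> \<partial>law)"
proof -
  have "integrable law (\<lambda>\<xi>. dev_summand l W \<kappa> t z \<xi>)"
    if t: "t \<in> {1..T}" for t
  proof -
    note d = dev_summand_measurable[OF l t W, of \<kappa>]
    from d(2) z obtain C where C: "\<And>\<xi>. \<xi> \<in> space (hist P T) \<Longrightarrow>
      \<bar>dev_summand l W \<kappa> t z \<xi>\<bar> \<le> C" by blast
    show ?thesis
      using measurable_Pair2[OF d(1) z] C by (intro bounded_path_function(1)[where C=C]) simp_all
  qed
  then have e: "(\<integral>\<xi>. dev_term l W \<kappa> z \<xi> \<partial>law)
     = (\<Sum>t=1..T. \<integral>\<xi>. dev_summand l W \<kappa> t z \<xi> \<partial>law)"
    unfolding dev_term_def by (rule Bochner_Integration.integral_sum)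
  show ?thesis unfolding e by (intro has_bochner_integral_sum err_integral[OF z l _ W]) auto
qed

text \<open>The directions to which the algorithm exposes the gradient error.\<close>

definition "W_opt l z t s = Xstar t s - run_X l z t s"
definition "W_step l z t s = run_X l z t s - run_Xp l z t s"
definition "W_old l z t s = run_Xp l z t s - run_X (Suc l) z t s"

lemma directions:
  "l \<le> L \<Longrightarrow> direction (W_opt l)" "l \<le> L \<Longrightarrow> direction (W_step l)" "l < L \<Longrightarrow> direction (W_old l)"
  unfolding W_opt_def[abs_def] W_step_def[abs_def] W_old_def[abs_def]
  by (intro direction_diff jointly_feasible_const[OF Xstar_feasible] run_X_feasible run_Xp_feasible; simp)+

text \<open>
  The curvature bounds around \<open>Xstar\<close> estimate the gap by the bounded gradient there and the bounded sets of
  decisions; the estimate is uniform in the policy.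
\<close>

lemma gap_bounded:
  obtains C where "\<And>X \<xi>. feasible_policy P X \<Longrightarrow> \<xi> \<in> space (hist P T) \<Longrightarrow>
    \<bar>cost_of X \<xi> - cost_of Xstar \<xi>\<bar> \<le> C"
proof -
  obtain K where K: "K \<ge> 0" "\<And>t x. t \<in> {1..T} \<Longrightarrow> x \<in> feas P t \<Longrightarrow> norm x \<le> K" using feas_bound by blast
  have "\<bar>cost_of X \<xi> - cost_of Xstar \<xi>\<bar>
      \<le> (\<Sum>t=1..T. Lip t * (2 * K) + L2 / 2 * (2 * K)\<^sup>2)"
    if X: "feasible_policy P X" and \<xi>: "\<xi> \<in> space (hist P T)" for X \<xi>
  proof -
    define h where "h t = grad_of t Xstar \<xi>" for t
    define w where "w t = induced X \<xi> t - induced Xstar \<xi> t" for t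
    have w: "norm (w t) \<le> 2 * K" if "t \<in> {1..T}" for t
      using K(2)[OF that induced_value[OF X that \<xi>]] K(2)[OF that induced_value[OF Xstar_feasible that \<xi>]]
        norm_triangle_ineq4[of "induced X \<xi> t" "induced Xstar \<xi> t"] unfolding w_def by linarith
    have h: "\<bar>h t \<bullet> w t\<bar> \<le> Lip t * (2 * K)" if t: "t \<in> {1..T}" for t
    proof -
      have "\<bar>h t \<bullet> w t\<bar> \<le> norm (h t) * norm (w t)" by (rule Cauchy_Schwarz_ineq2)
      also have "\<dots> \<le> Lip t * (2 * K)"
        using w[OF t] dobj_bounded[OF Xstar_feasible t \<xi>] unfolding h_def
        by (intro mult_mono) (auto intro: order_trans[OF norm_ge_zero])
      finally show ?thesis .
    qed
    have "cost_of X \<xi> - cost_of Xstar \<xi>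
       \<le> (\<Sum>t=1..T. h t \<bullet> w t + L2 / 2 * (norm (w t))\<^sup>2)"
      using policy_curvature(2)[OF Xstar_feasible X \<xi>] by (simp add: h_def w_def)
    also have "\<dots> \<le> (\<Sum>t=1..T. Lip t * (2 * K) + L2 / 2 * (2 * K)\<^sup>2)"
    proof (rule sum_mono)
      fix t assume t: "t \<in> {1..T}"
      have "L2 / 2 * (norm (w t))\<^sup>2 \<le> L2 / 2 * (2 * K)\<^sup>2"
        using w[OF t] params by (intro mult_left_mono power_mono) auto
      then show "h t \<bullet> w t + L2 / 2 * (norm (w t))\<^sup>2 \<le> Lip t * (2 * K) + L2 / 2 * (2 * K)\<^sup>2"
        using h[OF t] by linarith
    qed
    finally have up: "cost_of X \<xi> - cost_of Xstar \<xi>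
       \<le> (\<Sum>t=1..T. Lip t * (2 * K) + L2 / 2 * (2 * K)\<^sup>2)" .
    have "- (\<Sum>t=1..T. Lip t * (2 * K) + L2 / 2 * (2 * K)\<^sup>2) = (\<Sum>t=1..T. - (Lip t * (2 * K) + L2 / 2 * (2 * K)\<^sup>2))"
      by (rule sum_negf[symmetric])
    also have "\<dots> \<le> (\<Sum>t=1..T. h t \<bullet> w t + \<mu> / 2 * (norm (w t))\<^sup>2)"
    proof (rule sum_mono)
      fix t assume t: "t \<in> {1..T}"
      have "0 \<le> \<mu> / 2 * (norm (w t))\<^sup>2" "0 \<le> L2 / 2 * (2 * K)\<^sup>2" using params by simp_all
      then show "- (Lip t * (2 * K) + L2 / 2 * (2 * K)\<^sup>2) \<le> h t \<bullet> w t + \<mu> / 2 * (norm (w t))\<^sup>2"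
        using h[OF t] by linarith
    qed
    also have "\<dots> \<le> cost_of X \<xi> - cost_of Xstar \<xi>"
      using policy_curvature(1)[OF Xstar_feasible X \<xi>] by (simp add: h_def w_def)
    finally show ?thesis using up unfolding abs_le_iff by linarith
  qed
  then show ?thesis using that by blast
qed

lemma gap_expectation_bound:
  assumes z: "z \<in> space Z"
    and D: "integrable (base P) (\<lambda>\<omega>. init_div (scenario P \<omega>))"
  shows "A L * gapU P Xstar (run_Xp L z)
    \<le> M * (\<integral>\<omega>. init_div (scenario P \<omega>) \<partial>base P)
      + (\<Sum>l=0..L. \<alpha> l * (\<integral>\<xi>. dev_term l (W_opt l) (\<mu> / 4) z \<xi> \<partial>law))
      + (\<Sum>l=0..L. A l * (\<integral>\<xi>. dev_term l (W_step l) (L2 / 2) z \<xi> \<partial>law))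
      + (\<Sum>l<L. A l * (\<integral>\<xi>. dev_term (Suc l) (W_old l) (\<mu> / 2) z \<xi> \<partial>law))"
proof -
  define E where "E l W \<kappa> \<xi> = (\<Sum>t=1..T. err l z \<xi> t \<bullet> W z t (trunc t \<xi>) - \<kappa> * (norm (W z t (trunc t \<xi>)))\<^sup>2)"
    for l W \<kappa> \<xi>
  define B where "B \<xi> = init_div \<xi>" for \<xi>
  define R where "R \<xi> = M * B \<xi> + (\<Sum>l=0..L. \<alpha> l * E l (W_opt l) (\<mu> / 4) \<xi>)
      + (\<Sum>l=0..L. A l * E l (W_step l) (L2 / 2) \<xi>) + (\<Sum>l<L. A l * E (Suc l) (W_old l) (\<mu> / 2) \<xi>)" for \<xi>
  have R: "has_bochner_integral (base P) (\<lambda>\<omega>. R (scenario P \<omega>))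
     (M * (\<integral>\<omega>. B (scenario P \<omega>) \<partial>base P)
      + (\<Sum>l=0..L. \<alpha> l * (\<integral>\<xi>. dev_term l (W_opt l) (\<mu> / 4) z \<xi> \<partial>law))
      + (\<Sum>l=0..L. A l * (\<integral>\<xi>. dev_term l (W_step l) (L2 / 2) z \<xi> \<partial>law))
      + (\<Sum>l<L. A l * (\<integral>\<xi>. dev_term (Suc l) (W_old l) (\<mu> / 2) z \<xi> \<partial>law)))"
    unfolding R_def E_def
    by (intro has_bochner_integral_add has_bochner_integral_sum has_bochner_integral_mult_right
        err_sum_integral[OF z] has_bochner_integral_integrable) (use D directions in \<open>auto simp: B_def\<close>)
  obtain C where C: "\<And>X \<xi>. feasible_policy P X \<Longrightarrow> \<xi> \<in> space (hist P T) \<Longrightarrow>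
    \<bar>cost_of X \<xi> - cost_of Xstar \<xi>\<bar> \<le> C" using gap_bounded by blast
  define F where "F \<xi> = cost_of (run_Xp L z) \<xi> - cost_of Xstar \<xi>" for \<xi>
  have Fm: "F \<in> borel_measurable (hist P T)"
    unfolding F_def using objective_path_measurable[OF run_Xp_policy[OF z]] objective_path_measurable[OF Xstar_feasible] by simp
  have "\<bar>F \<xi>\<bar> \<le> C" if "\<xi> \<in> space (hist P T)" for \<xi>
    using C[OF run_Xp_policy[OF z order_refl] that] by (simp add: F_def)
  then have Fi: "integrable (base P) (\<lambda>\<omega>. F (scenario P \<omega>))"
    by (rule bounded_path_function(2)[OF Fm])
  have "A L * gapU P Xstar (run_Xp L z) = (\<integral>\<omega>. A L * F (scenario P \<omega>) \<partial>base P)"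
    unfolding gapU_def F_def by simp
  also have "\<dots> \<le> (\<integral>\<omega>. R (scenario P \<omega>) \<partial>base P)"
  proof (rule integral_mono)
    show "integrable (base P) (\<lambda>\<omega>. A L * F (scenario P \<omega>))" using Fi by simp
    show "integrable (base P) (\<lambda>\<omega>. R (scenario P \<omega>))" using R by (simp add: has_bochner_integral_iff)
    fix \<omega> assume "\<omega> \<in> space (base P)"
    then show "A L * F (scenario P \<omega>) \<le> R (scenario P \<omega>)"
      using pathwise_bound[OF z scenario_space]
      by (simp add: F_def R_def E_def B_def W_opt_def W_step_def W_old_def induced_def norm_minus_commute)
  qed
  finally show ?thesis using has_bochner_integral_integral_eq[OF R] by (simp add: B_def)
qed

text \<open>
  Exchange the two expectations. For a fixed path, the summand of stage \<open>t\<close> may be averaged over the seed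
  \<open>(t, l)\<close> before the other seeds, by \<open>resampling\<close>.
\<close>

lemma expectation_by_resampling:
  fixes \<phi> :: "nat \<Rightarrow> (nat \<times> nat \<Rightarrow> real) \<Rightarrow> (nat \<Rightarrow> 'z) \<Rightarrow> real"
  assumes l: "l \<le> L"
    and m: "\<And>t. t \<in> {1..T} \<Longrightarrow> (\<lambda>(z, \<xi>). \<phi> t z \<xi>) \<in> borel_measurable (ZH T)"
    and bd: "\<And>t. t \<in> {1..T} \<Longrightarrow> \<exists>C. \<forall>z\<in>space Z. \<forall>\<xi>\<in>space (hist P T). \<bar>\<phi> t z \<xi>\<bar> \<le> C"
    and c: "\<And>z \<xi>. z \<in> space Z \<Longrightarrow> \<xi> \<in> space (hist P T) \<Longrightarrow>
      (\<Sum>t=1..T. \<integral>y. \<phi> t (z((t, l) := y)) \<xi> \<partial>unif01) \<le> c"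
  shows "integrable Z (\<lambda>z. \<integral>\<xi>. (\<Sum>t=1..T. \<phi> t z \<xi>) \<partial>law)"
    and "(\<integral>z. (\<integral>\<xi>. (\<Sum>t=1..T. \<phi> t z \<xi>) \<partial>law) \<partial>Z) \<le> c"
proof -
  interpret Zp: prob_space Z by (rule prob_Z)
  interpret ZL: pair_prob_space Z law ..
  from bd have "\<exists>C. \<forall>t\<in>{1..T}. \<forall>z\<in>space Z. \<forall>\<xi>\<in>space (hist P T). \<bar>\<phi> t z \<xi>\<bar> \<le> C t"
    by (intro bchoice) auto
  then obtain C where C: "\<And>t z \<xi>. t \<in> {1..T} \<Longrightarrow> z \<in> space Z \<Longrightarrow> \<xi> \<in> space (hist P T) \<Longrightarrow> \<bar>\<phi> t z \<xi>\<bar> \<le> C t" by blast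
  have sets: "sets (Z \<Otimes>\<^sub>M law) = sets (ZH T)" by (rule sets_pair_measure_cong) simp_all
  have int: "integrable (Z \<Otimes>\<^sub>M law) (\<lambda>(z, \<xi>). \<Sum>t=1..T. \<phi> t z \<xi>)"
  proof (rule ZL.P.integrable_const_bound[where B="\<Sum>t=1..T. C t"])
    have "(\<lambda>(z, \<xi>). \<Sum>t=1..T. \<phi> t z \<xi>) \<in> borel_measurable (ZH T)"
      using m unfolding split_beta' by (intro borel_measurable_sum) simp
    then show "(\<lambda>(z, \<xi>). \<Sum>t=1..T. \<phi> t z \<xi>) \<in> borel_measurable (Z \<Otimes>\<^sub>M law)"
      using measurable_cong_sets[OF sets refl] by blast
    show "AE q in Z \<Otimes>\<^sub>M law. norm (case q of (z, \<xi>) \<Rightarrow> \<Sum>t=1..T. \<phi> t z \<xi>) \<le> (\<Sum>t=1..T. C t)"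
    proof (rule AE_I2)
      fix q assume "q \<in> space (Z \<Otimes>\<^sub>M law)"
      then obtain z \<xi> where q: "q = (z, \<xi>)" "z \<in> space Z" "\<xi> \<in> space (hist P T)" by (auto simp: space_pair_measure)
      have "\<bar>\<Sum>t=1..T. \<phi> t z \<xi>\<bar> \<le> (\<Sum>t=1..T. \<bar>\<phi> t z \<xi>\<bar>)" by (rule sum_abs)
      also have "\<dots> \<le> (\<Sum>t=1..T. C t)" using C q by (intro sum_mono) auto
      finally show "norm (case q of (z, \<xi>) \<Rightarrow> \<Sum>t=1..T. \<phi> t z \<xi>) \<le> (\<Sum>t=1..T. C t)" using q by simp
    qed
  qed
  show "integrable Z (\<lambda>z. \<integral>\<xi>. (\<Sum>t=1..T. \<phi> t z \<xi>) \<partial>law)"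
    using ZL.integrable_fst'[OF int] by simp
  have inner: "(\<integral>z. (\<Sum>t=1..T. \<phi> t z \<xi>) \<partial>Z) \<le> c" if \<xi>: "\<xi> \<in> space (hist P T)" for \<xi>
  proof -
    have fm: "(\<lambda>z. \<phi> t z \<xi>) \<in> borel_measurable Z" if "t \<in> {1..T}" for t
      using measurable_Pair1[OF m[OF that] \<xi>] by simp
    have fi: "integrable Z (\<lambda>z. \<phi> t z \<xi>)" if t: "t \<in> {1..T}" for t
      using fm[OF t] C[OF t _ \<xi>] by (intro Zp.integrable_const_bound[where B="C t"]) auto
    have ri: "integrable Z (\<lambda>z. \<integral>y. \<phi> t (z((t, l) := y)) \<xi> \<partial>unif01)"
      and re: "(\<integral>z. \<phi> t z \<xi> \<partial>Z) = (\<integral>z. (\<integral>y. \<phi> t (z((t, l) := y)) \<xi> \<partial>unif01) \<partial>Z)" if t: "t \<in> {1..T}" for t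
      using resampling[OF _ _ fm[OF t] C[OF t _ \<xi>], of "(t, l)"] t l by auto
    have "(\<integral>z. (\<Sum>t=1..T. \<phi> t z \<xi>) \<partial>Z) = (\<Sum>t=1..T. \<integral>z. \<phi> t z \<xi> \<partial>Z)"
      using fi by (rule Bochner_Integration.integral_sum)
    also have "\<dots> = (\<Sum>t=1..T. \<integral>z. (\<integral>y. \<phi> t (z((t, l) := y)) \<xi> \<partial>unif01) \<partial>Z)"
      using re by (rule sum.cong[OF refl])
    also have "\<dots> = (\<integral>z. (\<Sum>t=1..T. \<integral>y. \<phi> t (z((t, l) := y)) \<xi> \<partial>unif01) \<partial>Z)"
      using ri by (rule Bochner_Integration.integral_sum[symmetric])
    also have "\<dots> \<le> c"
      using ri c \<xi> by (intro Zp.integral_le_const) (auto intro!: AE_I2 Bochner_Integration.integrable_sum)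
    finally show ?thesis .
  qed
  have "(\<integral>z. (\<integral>\<xi>. (\<Sum>t=1..T. \<phi> t z \<xi>) \<partial>law) \<partial>Z) = (\<integral>\<xi>. (\<integral>z. (\<Sum>t=1..T. \<phi> t z \<xi>) \<partial>Z) \<partial>law)"
    using ZL.Fubini_integral[OF int] by simp
  also have "\<dots> \<le> c"
    using ZL.integrable_snd[OF int] inner by (intro law.integral_le_const) (auto intro!: AE_I2)
  finally show "(\<integral>z. (\<integral>\<xi>. (\<Sum>t=1..T. \<phi> t z \<xi>) \<partial>law) \<partial>Z) \<le> c" .
qed

section \<open>Convergence rates\<close>

lemma scg_constants_at:
  assumes X: "feasible_policy P X" and t: "t \<in> {1..T}" and s: "s \<in> space (hist P t)"
  shows "norm ((\<integral>u. scg P smp X t s u \<partial>unif01) - cond_grad P Q X t s) \<le> bias t" (is ?bias)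
    and "(\<integral>u. (norm (scg P smp X t s u - (\<integral>u'. scg P smp X t s u' \<partial>unif01)))\<^sup>2 \<partial>unif01) \<le> (\<sigma>t t)\<^sup>2" (is ?var)
proof -
  have "t \<le> T" using t by simp
  then obtain \<xi> where \<xi>: "\<xi> \<in> space (hist P T)" "trunc t \<xi> = s" using extend_history[OF _ s] by blast
  have "norm ((\<integral>u. scg P smp X t (trunc t \<xi>) u \<partial>unif01) - cond_grad P Q X t (trunc t \<xi>)) \<le> bias t
    \<and> (\<integral>u. (norm (scg P smp X t (trunc t \<xi>) u - (\<integral>u'. scg P smp X t (trunc t \<xi>) u' \<partial>unif01)))\<^sup>2 \<partial>unif01) \<le> (\<sigma>t t)\<^sup>2"
    using constants X t \<xi>(1) unfolding scg_constants_def by blast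
  then show ?bias ?var
    unfolding \<xi>(2) by blast+
qed

lemma scg_seed_measurable:
  assumes X: "feasible_policy P X" and t: "t \<in> {1..T}" and s: "s \<in> space (hist P t)"
  shows "scg P smp X t s \<in> borel_measurable unif01"
  using scg_jointly_measurable[where smp=smp and N=unif01 and s="\<lambda>_. s" and p="\<lambda>u. u" and u="\<lambda>u. u" and N'=unif01,
      OF jointly_feasible_const[OF X] t smp_measurable[OF t]] s by simp

text \<open>
  The new seed enters through the oracle of the current iteration only; the policies at which it is
  evaluated belong to the past.
\<close>

lemma dev_resample: "oracle_dev l (z((t, l) := y)) t s = scg P smp (run_X l z) t s y - mean_grad l z t s"
  by (simp add: oracle_dev_def run_G_def mean_grad_def run_X_resample)

text \<open>
  In the mean over the seed the noise vanishes, and the bias is at most \<open>bias t\<close>.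
\<close>

lemma fresh_seed_mean:
  assumes z: "z \<in> space Z" and l: "l \<le> L" and t: "t \<in> {1..T}" and s: "s \<in> space (hist P t)"
  shows "(\<integral>y. oracle_dev l (z((t, l) := y)) t s \<bullet> w - k \<partial>unif01) \<le> bias t * norm w - k"
proof -
  interpret U: prob_space unif01 by (rule prob_unif01)
  have X: "feasible_policy P (run_X l z)" using run_X_policy[OF z] l by simp
  have S: "integrable unif01 (scg P smp (run_X l z) t s)"
    using scg_seed_measurable[OF X t s] scg_in_dspace(2)[OF X t s]
    by (intro U.integrable_const_bound[where B="Lip t"]) auto
  have "(\<integral>y. oracle_dev l (z((t, l) := y)) t s \<bullet> w - k \<partial>unif01)
     = ((\<integral>u. scg P smp (run_X l z) t s u \<partial>unif01) - cond_grad P Q (run_X l z) t s) \<bullet> w - k"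
    unfolding dev_resample mean_grad_def inner_diff_left using S by (simp add: U.prob_space)
  also have "\<dots> \<le> norm ((\<integral>u. scg P smp (run_X l z) t s u \<partial>unif01) - cond_grad P Q (run_X l z) t s) * norm w - k"
    using norm_cauchy_schwarz by (intro diff_right_mono)
  also have "\<dots> \<le> bias t * norm w - k"
    using scg_constants_at(1)[OF X t s] by (intro diff_right_mono mult_right_mono) auto
  finally show ?thesis .
qed

lemma fresh_seed_square:
  assumes z: "z \<in> space Z" and l: "l \<le> L" and t: "t \<in> {1..T}" and s: "s \<in> space (hist P t)"
  shows "(\<integral>y. (norm (oracle_dev l (z((t, l) := y)) t s))\<^sup>2 \<partial>unif01) \<le> (bias t)\<^sup>2 + (\<sigma>t t)\<^sup>2"
proof -
  have X: "feasible_policy P (run_X l z)" using run_X_policy[OF z] l by simp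
  let ?S = "scg P smp (run_X l z) t s"
  have "(\<integral>y. (norm (oracle_dev l (z((t, l) := y)) t s))\<^sup>2 \<partial>unif01)
     = (\<integral>u. (norm (?S u - (\<integral>u'. ?S u' \<partial>unif01)))\<^sup>2 \<partial>unif01) + (norm ((\<integral>u. ?S u \<partial>unif01) - cond_grad P Q (run_X l z) t s))\<^sup>2"
    unfolding dev_resample mean_grad_def
    using scg_in_dspace(2)[OF X t s] by (intro integral_sq_dist_mean[OF prob_unif01 scg_seed_measurable[OF X t s]])
  also have "\<dots> \<le> (\<sigma>t t)\<^sup>2 + (bias t)\<^sup>2"
    using scg_constants_at[OF X t s] by (intro add_mono power_mono) auto
  finally show ?thesis by simp
qed

text \<open>
  \<open>inv\<close> expresses that the direction is fixed before the seeds of iteration \<open>l\<close> are drawn, so that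
  \<open>fresh_seed_mean\<close> applies to it.
\<close>

lemma expected_dev_term:
  assumes l: "l \<le> L" and W: "direction W" and inv: "\<And>z t y. W (z((t, l) := y)) = W z"
    and c: "\<And>z \<xi>. z \<in> space Z \<Longrightarrow> \<xi> \<in> space (hist P T) \<Longrightarrow>
      (\<Sum>t=1..T. bias t * norm (W z t (trunc t \<xi>)) - \<kappa> * (norm (W z t (trunc t \<xi>)))\<^sup>2) \<le> c"
  shows "integrable Z (\<lambda>z. \<integral>\<xi>. dev_term l W \<kappa> z \<xi> \<partial>law)"
    and "(\<integral>z. (\<integral>\<xi>. dev_term l W \<kappa> z \<xi> \<partial>law) \<partial>Z) \<le> c"
proof -
  let ?\<phi> = "\<lambda>t z \<xi>. dev_summand l W \<kappa> t z \<xi>"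
  have "(\<Sum>t=1..T. \<integral>y. ?\<phi> t (z((t, l) := y)) \<xi> \<partial>unif01) \<le> c" if z: "z \<in> space Z" and \<xi>: "\<xi> \<in> space (hist P T)" for z \<xi>
  proof -
    have "(\<Sum>t=1..T. \<integral>y. ?\<phi> t (z((t, l) := y)) \<xi> \<partial>unif01)
       \<le> (\<Sum>t=1..T. bias t * norm (W z t (trunc t \<xi>)) - \<kappa> * (norm (W z t (trunc t \<xi>)))\<^sup>2)"
      unfolding inv by (intro sum_mono fresh_seed_mean[OF z l] trunc_space[OF _ \<xi>]) auto
    then show ?thesis using c[OF z \<xi>] by simp
  qed
  from expectation_by_resampling[of l ?\<phi>, OF l dev_summand_measurable[OF l _ W] this]
  show "integrable Z (\<lambda>z. \<integral>\<xi>. dev_term l W \<kappa> z \<xi> \<partial>law)"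
    "(\<integral>z. (\<integral>\<xi>. dev_term l W \<kappa> z \<xi> \<partial>law) \<partial>Z) \<le> c"
    unfolding dev_term_def by blast+
qed

definition "dev_sq l z \<xi> = (\<Sum>t=1..T. (norm (oracle_dev l z t (trunc t \<xi>)))\<^sup>2 / (2 * L2))"

lemma dev_sq_summand:
  assumes l: "l \<le> L" and t: "t \<in> {1..T}"
  shows "(\<lambda>(z, \<xi>). (norm (oracle_dev l z t (trunc t \<xi>)))\<^sup>2 / (2 * L2)) \<in> borel_measurable (ZH T)"
    and "\<exists>C. \<forall>z\<in>space Z. \<forall>\<xi>\<in>space (hist P T). \<bar>(norm (oracle_dev l z t (trunc t \<xi>)))\<^sup>2 / (2 * L2)\<bar> \<le> C"
proof -
  have tT: "t \<le> T" using t by simp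
  show "(\<lambda>(z, \<xi>). (norm (oracle_dev l z t (trunc t \<xi>)))\<^sup>2 / (2 * L2)) \<in> borel_measurable (ZH T)"
    using along_path_measurable[OF dev_measurable[OF l t] tT] unfolding split_beta' by measurable
  have "\<bar>(norm (oracle_dev l z t (trunc t \<xi>)))\<^sup>2 / (2 * L2)\<bar> \<le> (2 * Lip t)\<^sup>2 / (2 * L2)"
    if "z \<in> space Z" "\<xi> \<in> space (hist P T)" for z \<xi>
  proof -
    have "(norm (oracle_dev l z t (trunc t \<xi>)))\<^sup>2 \<le> (2 * Lip t)\<^sup>2"
      using dev_bounded[OF that(1) l t trunc_space[OF tT that(2)]] by (rule power_mono) simp
    then have "(norm (oracle_dev l z t (trunc t \<xi>)))\<^sup>2 / (2 * L2) \<le> (2 * Lip t)\<^sup>2 / (2 * L2)"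
      using params by (intro divide_right_mono) auto
    then show ?thesis using params by (subst abs_of_nonneg) auto
  qed
  then show "\<exists>C. \<forall>z\<in>space Z. \<forall>\<xi>\<in>space (hist P T). \<bar>(norm (oracle_dev l z t (trunc t \<xi>)))\<^sup>2 / (2 * L2)\<bar> \<le> C" by blast
qed

lemma expected_dev_sq:
  assumes l: "l \<le> L"
  shows "integrable Z (\<lambda>z. \<integral>\<xi>. dev_sq l z \<xi> \<partial>law)"
    and "(\<integral>z. (\<integral>\<xi>. dev_sq l z \<xi> \<partial>law) \<partial>Z)
      \<le> ((\<Sum>t=1..T. (bias t)\<^sup>2) + (\<Sum>t=1..T. (\<sigma>t t)\<^sup>2)) / (2 * L2)"
proof -
  let ?\<phi> = "\<lambda>t z \<xi>. (norm (oracle_dev l z t (trunc t \<xi>)))\<^sup>2 / (2 * L2)"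
  let ?c = "((\<Sum>t=1..T. (bias t)\<^sup>2) + (\<Sum>t=1..T. (\<sigma>t t)\<^sup>2)) / (2 * L2)"
  have "(\<Sum>t=1..T. \<integral>y. ?\<phi> t (z((t, l) := y)) \<xi> \<partial>unif01) \<le> ?c" if z: "z \<in> space Z" and \<xi>: "\<xi> \<in> space (hist P T)" for z \<xi>
  proof -
    have "(\<Sum>t=1..T. \<integral>y. ?\<phi> t (z((t, l) := y)) \<xi> \<partial>unif01)
       \<le> (\<Sum>t=1..T. ((bias t)\<^sup>2 + (\<sigma>t t)\<^sup>2) / (2 * L2))"
    proof (rule sum_mono)
      fix t assume t: "t \<in> {1..T}"
      have "trunc t \<xi> \<in> space (hist P t)" using t by (intro trunc_space[OF _ \<xi>]) auto
      from fresh_seed_square[OF z l t this]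
      show "(\<integral>y. ?\<phi> t (z((t, l) := y)) \<xi> \<partial>unif01) \<le> ((bias t)\<^sup>2 + (\<sigma>t t)\<^sup>2) / (2 * L2)"
        using params by (simp add: divide_right_mono)
    qed
    then show ?thesis by (simp add: sum.distrib sum_divide_distrib[symmetric])
  qed
  from expectation_by_resampling[of l ?\<phi>, OF l dev_sq_summand[OF l] this]
  show "integrable Z (\<lambda>z. \<integral>\<xi>. dev_sq l z \<xi> \<partial>law)" "(\<integral>z. (\<integral>\<xi>. dev_sq l z \<xi> \<partial>law) \<partial>Z) \<le> ?c"
    unfolding dev_sq_def by blast+
qed

text \<open>
  Young's inequality, for a direction that may depend on the seeds of the current iteration.
\<close>

lemma dev_term_le_dev_sq:
  assumes z: "z \<in> space Z" and l: "l \<le> L" and W: "direction W"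
  shows "(\<integral>\<xi>. dev_term l W (L2 / 2) z \<xi> \<partial>law) \<le> (\<integral>\<xi>. dev_sq l z \<xi> \<partial>law)"
proof (rule integral_mono)
  have i: "integrable law (\<lambda>\<xi>. \<phi> z \<xi>)"
    if m: "(\<lambda>(z, \<xi>). \<phi> z \<xi>) \<in> borel_measurable (ZH T)"
      and b: "\<exists>C. \<forall>z\<in>space Z. \<forall>\<xi>\<in>space (hist P T). \<bar>\<phi> z \<xi>\<bar> \<le> C" for \<phi> :: "_ \<Rightarrow> _ \<Rightarrow> real"
  proof -
    from b z obtain C where C: "\<And>\<xi>. \<xi> \<in> space (hist P T) \<Longrightarrow> \<bar>\<phi> z \<xi>\<bar> \<le> C" by blast
    show ?thesis
      using measurable_Pair2[OF m z] C by (intro bounded_path_function(1)[where C=C]) simp_all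
  qed
  show "integrable law (dev_term l W (L2 / 2) z)"
    unfolding dev_term_def[abs_def]
    by (intro Bochner_Integration.integrable_sum i dev_summand_measurable[OF l _ W])
  show "integrable law (dev_sq l z)"
    unfolding dev_sq_def[abs_def]
    by (intro Bochner_Integration.integrable_sum i dev_sq_summand[OF l])
  fix \<xi>
  show "dev_term l W (L2 / 2) z \<xi> \<le> dev_sq l z \<xi>"
    unfolding dev_term_def dev_sq_def
  proof (rule sum_mono)
    fix t
    show "oracle_dev l z t (trunc t \<xi>) \<bullet> W z t (trunc t \<xi>) - L2 / 2 * (norm (W z t (trunc t \<xi>)))\<^sup>2
       \<le> (norm (oracle_dev l z t (trunc t \<xi>)))\<^sup>2 / (2 * L2)"
      using young_inner[of "L2 / 2" "oracle_dev l z t (trunc t \<xi>)" "W z t (trunc t \<xi>)"] params by simp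
  qed
qed

lemma gap_integrable: "integrable Z (\<lambda>z. gapU P Xstar (run_Xp L z))"
proof -
  interpret Zp: prob_space Z by (rule prob_Z)
  obtain C where C: "\<And>X \<xi>. feasible_policy P X \<Longrightarrow> \<xi> \<in> space (hist P T) \<Longrightarrow>
    \<bar>cost_of X \<xi> - cost_of Xstar \<xi>\<bar> \<le> C" using gap_bounded by blast
  let ?F = "\<lambda>z \<omega>. cost_of (run_Xp L z) (scenario P \<omega>)
     - cost_of Xstar (scenario P \<omega>)"
  have sc: "(\<lambda>q. scenario P (snd q)) \<in> measurable (Z \<Otimes>\<^sub>M base P) (hist P T)"
    by (rule measurable_compose[OF measurable_snd scenario_measurable])
  have m: "(\<lambda>(z, \<omega>). ?F z \<omega>) \<in> borel_measurable (Z \<Otimes>\<^sub>M base P)"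
    using borel_measurable_diff[OF objective_jointly_measurable[OF run_Xp_feasible[OF order_refl] measurable_fst sc]
      measurable_compose[OF sc objective_path_measurable[OF Xstar_feasible]]]
    by (simp add: split_beta')
  show ?thesis
  proof (rule Zp.integrable_const_bound[where B=C])
    show "(\<lambda>z. gapU P Xstar (run_Xp L z)) \<in> borel_measurable Z"
      unfolding gapU_def using m by (rule base.borel_measurable_lebesgue_integral)
    have "\<bar>gapU P Xstar (run_Xp L z)\<bar> \<le> C" if z: "z \<in> space Z" for z
    proof -
      have b: "\<bar>?F z \<omega>\<bar> \<le> C" if "\<omega> \<in> space (base P)" for \<omega>
        by (rule C[OF run_Xp_policy[OF z order_refl] scenario_space[OF that]])
      have "integrable (base P) (?F z)"
        using measurable_Pair2[OF m z] b by (intro base.integrable_const_bound[where B=C]) auto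
      then have "(\<integral>\<omega>. ?F z \<omega> \<partial>base P) \<le> C" "- C \<le> (\<integral>\<omega>. ?F z \<omega> \<partial>base P)"
        using b by (intro base.integral_le_const base.integral_ge_const; force intro!: AE_I2 simp: abs_le_iff)+
      then show ?thesis unfolding gapU_def by (simp add: abs_le_iff)
    qed
    then show "AE z in Z. norm (gapU P Xstar (run_Xp L z)) \<le> C" by auto
  qed
qed

text \<open>
  \<open>c1\<close> and \<open>c2\<close> bound the cost of the bias in the two directions that belong to the past. How they are
  obtained is where the convex and the strongly convex case differ.
\<close>

lemma expected_gap:
  assumes D: "integrable (base P) (\<lambda>\<omega>. init_div (scenario P \<omega>))"
      "(\<integral>\<omega>. init_div (scenario P \<omega>) \<partial>base P) \<le> D2"
    and b: "b2 = (\<Sum>t=1..T. (bias t)\<^sup>2)" and s: "s2 = (\<Sum>t=1..T. (\<sigma>t t)\<^sup>2)"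
    and c1: "\<And>X Y \<xi>. feasible_policy P X \<Longrightarrow> feasible_policy P Y \<Longrightarrow> \<xi> \<in> space (hist P T) \<Longrightarrow>
      (\<Sum>t=1..T. bias t * norm (induced X \<xi> t - induced Y \<xi> t)
         - \<mu> / 4 * (norm (induced X \<xi> t - induced Y \<xi> t))\<^sup>2) \<le> c1"
    and c2: "\<And>X Y \<xi>. feasible_policy P X \<Longrightarrow> feasible_policy P Y \<Longrightarrow> \<xi> \<in> space (hist P T) \<Longrightarrow>
      (\<Sum>t=1..T. bias t * norm (induced X \<xi> t - induced Y \<xi> t)
         - \<mu> / 2 * (norm (induced X \<xi> t - induced Y \<xi> t))\<^sup>2) \<le> c2"
  shows "A L * (\<integral>z. gapU P Xstar (run_Xp L z) \<partial>Z)
    \<le> M * D2 + A L * c1 + (\<Sum>l=0..L. A l) * ((b2 + s2) / (2 * L2)) + (\<Sum>l<L. A l) * c2"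
proof -
  interpret Zp: prob_space Z by (rule prob_Z)
  have 1: "integrable Z (\<lambda>z. \<integral>\<xi>. dev_term l (W_opt l) (\<mu> / 4) z \<xi> \<partial>law)"
    "(\<integral>z. (\<integral>\<xi>. dev_term l (W_opt l) (\<mu> / 4) z \<xi> \<partial>law) \<partial>Z) \<le> c1" if l: "l \<le> L" for l
  proof -
    have "(\<Sum>t=1..T. bias t * norm (W_opt l z t (trunc t \<xi>)) - \<mu> / 4 * (norm (W_opt l z t (trunc t \<xi>)))\<^sup>2) \<le> c1"
      if "z \<in> space Z" "\<xi> \<in> space (hist P T)" for z \<xi>
      using c1[OF Xstar_feasible run_X_policy[OF that(1) le_SucI[OF l]] that(2)] by (simp add: W_opt_def induced_def)
    moreover have "W_opt l (z((t, l) := y)) = W_opt l z" for z t y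
      by (intro ext) (simp add: W_opt_def run_X_resample)
    ultimately
    show "integrable Z (\<lambda>z. \<integral>\<xi>. dev_term l (W_opt l) (\<mu> / 4) z \<xi> \<partial>law)"
      "(\<integral>z. (\<integral>\<xi>. dev_term l (W_opt l) (\<mu> / 4) z \<xi> \<partial>law) \<partial>Z) \<le> c1"
      using expected_dev_term[OF l directions(1)[OF l]] by blast+
  qed
  have 3: "integrable Z (\<lambda>z. \<integral>\<xi>. dev_term (Suc l) (W_old l) (\<mu> / 2) z \<xi> \<partial>law)"
    "(\<integral>z. (\<integral>\<xi>. dev_term (Suc l) (W_old l) (\<mu> / 2) z \<xi> \<partial>law) \<partial>Z) \<le> c2" if l: "l < L" for l
  proof -
    have "(\<Sum>t=1..T. bias t * norm (W_old l z t (trunc t \<xi>)) - \<mu> / 2 * (norm (W_old l z t (trunc t \<xi>)))\<^sup>2) \<le> c2"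
      if "z \<in> space Z" "\<xi> \<in> space (hist P T)" for z \<xi>
      using c2[OF run_Xp_policy[OF that(1), of l] run_X_policy[OF that(1), of "Suc l"] that(2)] l by (simp add: W_old_def induced_def)
    moreover have "W_old l (z((t, Suc l) := y)) = W_old l z" for z t y
      by (intro ext) (simp add: W_old_def run_X_resample run_Xp_resample)
    ultimately
    show "integrable Z (\<lambda>z. \<integral>\<xi>. dev_term (Suc l) (W_old l) (\<mu> / 2) z \<xi> \<partial>law)"
      "(\<integral>z. (\<integral>\<xi>. dev_term (Suc l) (W_old l) (\<mu> / 2) z \<xi> \<partial>law) \<partial>Z) \<le> c2"
      using expected_dev_term[OF Suc_leI[OF l] directions(3)[OF l]] by blast+
  qed
  define B where "B = (\<integral>\<omega>. init_div (scenario P \<omega>) \<partial>base P)"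
  define R where "R z = M * B + (\<Sum>l=0..L. \<alpha> l * (\<integral>\<xi>. dev_term l (W_opt l) (\<mu> / 4) z \<xi> \<partial>law))
      + (\<Sum>l=0..L. A l * (\<integral>\<xi>. dev_sq l z \<xi> \<partial>law))
      + (\<Sum>l<L. A l * (\<integral>\<xi>. dev_term (Suc l) (W_old l) (\<mu> / 2) z \<xi> \<partial>law))" for z
  have constB: "has_bochner_integral Z (\<lambda>z. M * B) (M * B)"
    using has_bochner_integral_integrable[OF Zp.integrable_const[of "M * B"]]
    unfolding Bochner_Integration.lebesgue_integral_const Zp.prob_space by simp
  have R: "has_bochner_integral Z R
     (M * B + (\<Sum>l=0..L. \<alpha> l * (\<integral>z. (\<integral>\<xi>. dev_term l (W_opt l) (\<mu> / 4) z \<xi> \<partial>law) \<partial>Z))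
      + (\<Sum>l=0..L. A l * (\<integral>z. (\<integral>\<xi>. dev_sq l z \<xi> \<partial>law) \<partial>Z))
      + (\<Sum>l<L. A l * (\<integral>z. (\<integral>\<xi>. dev_term (Suc l) (W_old l) (\<mu> / 2) z \<xi> \<partial>law) \<partial>Z)))"
    unfolding R_def[abs_def]
    by (intro has_bochner_integral_add has_bochner_integral_sum has_bochner_integral_mult_right constB
        has_bochner_integral_integrable 1 3 expected_dev_sq) auto
  have nn: "0 \<le> A l" "0 \<le> \<alpha> l" if "l \<le> L" for l
    using step_facts(7)[of l] step_facts(8)[of l] that by auto
  have "A L * (\<integral>z. gapU P Xstar (run_Xp L z) \<partial>Z) = (\<integral>z. A L * gapU P Xstar (run_Xp L z) \<partial>Z)" by simp
  also have "\<dots> \<le> (\<integral>z. R z \<partial>Z)"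
  proof (rule integral_mono)
    show "integrable Z (\<lambda>z. A L * gapU P Xstar (run_Xp L z))" using gap_integrable by simp
    show "integrable Z R" using R by (simp add: has_bochner_integral_iff)
    fix z assume z: "z \<in> space Z"
    have "(\<Sum>l=0..L. A l * (\<integral>\<xi>. dev_term l (W_step l) (L2 / 2) z \<xi> \<partial>law))
       \<le> (\<Sum>l=0..L. A l * (\<integral>\<xi>. dev_sq l z \<xi> \<partial>law))"
      using nn directions(2) by (intro sum_mono mult_left_mono dev_term_le_dev_sq[OF z]) auto
    then show "A L * gapU P Xstar (run_Xp L z) \<le> R z"
      using gap_expectation_bound[OF z D(1)] unfolding R_def B_def by linarith
  qed
  also have "\<dots> = M * B + (\<Sum>l=0..L. \<alpha> l * (\<integral>z. (\<integral>\<xi>. dev_term l (W_opt l) (\<mu> / 4) z \<xi> \<partial>law) \<partial>Z))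
      + (\<Sum>l=0..L. A l * (\<integral>z. (\<integral>\<xi>. dev_sq l z \<xi> \<partial>law) \<partial>Z))
      + (\<Sum>l<L. A l * (\<integral>z. (\<integral>\<xi>. dev_term (Suc l) (W_old l) (\<mu> / 2) z \<xi> \<partial>law) \<partial>Z))"
    by (rule has_bochner_integral_integral_eq[OF R])
  also have "\<dots> \<le> M * D2 + (\<Sum>l=0..L. \<alpha> l * c1) + (\<Sum>l=0..L. A l * ((b2 + s2) / (2 * L2))) + (\<Sum>l<L. A l * c2)"
    unfolding b s using D(2) params nn 1(2) 3(2) expected_dev_sq(2)
    by (intro add_mono sum_mono mult_left_mono) (auto simp: B_def)
  also have "\<dots> = M * D2 + A L * c1 + (\<Sum>l=0..L. A l) * ((b2 + s2) / (2 * L2)) + (\<Sum>l<L. A l) * c2"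
    unfolding sum_distrib_right[symmetric] using step_facts(6)[of L] by simp
  finally show ?thesis .
qed

text \<open>
  Without strong convexity the bias is paired with a direction by the Cauchy-Schwarz inequality over the
  stages, at a cost of at most \<open>b * D\<close>; all costs then carry the weight \<open>\<Sum>l=0..L. A l\<close>.
\<close>

lemma convex_rate:
  assumes D: "integrable (base P) (\<lambda>\<omega>. init_div (scenario P \<omega>))"
      "(\<integral>\<omega>. init_div (scenario P \<omega>) \<partial>base P) \<le> Dtil\<^sup>2"
    and b: "b \<ge> 0" "b\<^sup>2 = (\<Sum>t=1..T. (bias t)\<^sup>2)" and s: "\<sigma>\<^sup>2 = (\<Sum>t=1..T. (\<sigma>t t)\<^sup>2)"
    and \<mu>: "\<mu> = 0"
    and diam: "\<And>x x'. x \<in> feas_tuples P \<Longrightarrow> x' \<in> feas_tuples P \<Longrightarrow> tnorm P (\<lambda>t. x t - x' t) \<le> D"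
  shows "(\<integral>z. gapU P Xstar (run_Xp L z) \<partial>Z)
    \<le> 8 * L2 * Dtil\<^sup>2 / ((real L + 1) * (real L + 2))
      + 2/3 * (real L + 3) * ((b\<^sup>2 + \<sigma>\<^sup>2) / (2 * L2) + b * D)"
proof -
  have c: "(\<Sum>t=1..T. bias t * norm (induced X \<xi> t - induced Y \<xi> t)
       - k * (norm (induced X \<xi> t - induced Y \<xi> t))\<^sup>2) \<le> b * D"
    if X: "feasible_policy P X" and Y: "feasible_policy P Y" and \<xi>: "\<xi> \<in> space (hist P T)" and k: "k = 0" for X Y \<xi> and k :: real
  proof -
    have bL: "L2_set (bias) {1..T} = b"
      unfolding L2_set_def b(2)[symmetric] using b(1) by simp
    let ?x = "restrict (induced X \<xi>) {1..T}" and ?y = "restrict (induced Y \<xi>) {1..T}"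
    have "(\<Sum>t=1..T. bias t * norm (induced X \<xi> t - induced Y \<xi> t))
       \<le> (\<Sum>t=1..T. \<bar>bias t\<bar> * \<bar>norm (?x t - ?y t)\<bar>)"
      by (rule sum_mono) (auto intro: mult_right_mono)
    also have "\<dots> \<le> L2_set (bias) {1..T} * L2_set (\<lambda>t. norm (?x t - ?y t)) {1..T}"
      by (rule L2_set_mult_ineq)
    also have "\<dots> \<le> b * D"
      using diam[OF restrict_induced_feas_tuples[OF X \<xi>] restrict_induced_feas_tuples[OF Y \<xi>]] b(1)
      unfolding bL tnorm_def by (rule mult_left_mono)
    finally show ?thesis using k by simp
  qed
  have D0: "0 \<le> D"
  proof -
    obtain \<omega> where "\<omega> \<in> space (base P)" using base.not_empty by blast
    then have r: "restrict (induced Xstar (scenario P \<omega>)) {1..T} \<in> feas_tuples P"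
      by (intro restrict_induced_feas_tuples[OF Xstar_feasible] scenario_space)
    have "0 \<le> tnorm P (\<lambda>t. restrict (induced Xstar (scenario P \<omega>)) {1..T} t - restrict (induced Xstar (scenario P \<omega>)) {1..T} t)"
      by (simp add: tnorm_def)
    then show ?thesis using diam[OF r r] by linarith
  qed
  define e where "e = (b\<^sup>2 + \<sigma>\<^sup>2) / (2 * L2) + b * D"
  \<comment> \<open>The weights are estimated from above, which needs a nonnegative factor.\<close>
  have e0: "0 \<le> e" unfolding e_def using b(1) D0 params by simp
  note steps0 = steps[unfolded \<mu>]
  have AL: "0 < A L" using step_facts(7)[of L] by simp
  have "A L * (\<integral>z. gapU P Xstar (run_Xp L z) \<partial>Z)
    \<le> M * Dtil\<^sup>2 + A L * (b * D) + (\<Sum>l=0..L. A l) * ((b\<^sup>2 + \<sigma>\<^sup>2) / (2 * L2)) + (\<Sum>l<L. A l) * (b * D)"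
    by (rule expected_gap[OF D b(2) s]) (rule c; simp add: \<mu>)+
  also have "(\<Sum>l=0..L. A l) = (\<Sum>l<L. A l) + A L"
    by (simp add: atLeast0AtMost lessThan_Suc_atMost[symmetric])
  then have "A L * (b * D) + (\<Sum>l=0..L. A l) * ((b\<^sup>2 + \<sigma>\<^sup>2) / (2 * L2)) + (\<Sum>l<L. A l) * (b * D) = (\<Sum>l=0..L. A l) * e"
    unfolding e_def by (simp add: algebra_simps)
  then have "M * Dtil\<^sup>2 + A L * (b * D) + (\<Sum>l=0..L. A l) * ((b\<^sup>2 + \<sigma>\<^sup>2) / (2 * L2)) + (\<Sum>l<L. A l) * (b * D)
     = M * Dtil\<^sup>2 + (\<Sum>l=0..L. A l) * e" by linarith
  also have "\<dots> \<le> M * Dtil\<^sup>2 + (2/3 * (real L + 3) * A L) * e"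
    using amd_steps_quadratic_sum[OF steps0 params(2) order_refl] e0 by (intro add_left_mono mult_right_mono)
  finally have "(\<integral>z. gapU P Xstar (run_Xp L z) \<partial>Z) \<le> (M * Dtil\<^sup>2 + (2/3 * (real L + 3) * A L) * e) / A L"
    using AL by (simp add: pos_le_divide_eq mult.commute)
  also have "\<dots> = M * Dtil\<^sup>2 / A L + 2/3 * (real L + 3) * e"
    using AL by (simp add: add_divide_distrib)
  also have "M * Dtil\<^sup>2 / A L \<le> M * Dtil\<^sup>2 / ((real L + 1) * (real L + 2) / 4)"
  proof (rule divide_left_mono)
    have q: "A L = (\<alpha> L)\<^sup>2" "1 + real L / 2 \<le> \<alpha> L"
      using amd_steps_quadratic[OF steps0 params(2), of L] by auto
    have "(1 + real L / 2)\<^sup>2 \<le> A L" unfolding q(1) using q(2) by (intro power_mono) auto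
    then show "(real L + 1) * (real L + 2) / 4 \<le> A L" by (simp add: power2_eq_square field_simps)
    show "0 \<le> M * Dtil\<^sup>2" using params by simp
    show "0 < A L * ((real L + 1) * (real L + 2) / 4)" using AL by simp
  qed
  also have "M * Dtil\<^sup>2 / ((real L + 1) * (real L + 2) / 4) = 8 * L2 * Dtil\<^sup>2 / ((real L + 1) * (real L + 2))"
    by simp
  finally show ?thesis unfolding e_def by simp
qed

text \<open>
  Young's inequality at each stage bounds the cost of the bias by \<open>b\<^sup>2 / \<mu>\<close> and by \<open>b\<^sup>2 / (2 * \<mu>)\<close>. They sum
  to the summand \<open>3 / \<mu>\<close> of the rate, once all weights are estimated by \<open>A L / (1 - \<rho>)\<close>.
\<close>

lemma strongly_convex_rate:
  assumes D: "integrable (base P) (\<lambda>\<omega>. init_div (scenario P \<omega>))"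
      "(\<integral>\<omega>. init_div (scenario P \<omega>) \<partial>base P) \<le> Dtil\<^sup>2"
    and b: "b\<^sup>2 = (\<Sum>t=1..T. (bias t)\<^sup>2)" and s: "\<sigma>\<^sup>2 = (\<Sum>t=1..T. (\<sigma>t t)\<^sup>2)"
    and \<mu>: "\<mu> > 0" and \<rho>: "\<rho> = 1 / (1 + 1/4 * sqrt (\<mu> / L2))\<^sup>2"
  shows "(\<integral>z. gapU P Xstar (run_Xp L z) \<partial>Z)
    \<le> \<rho> ^ L * (2 * L2 * Dtil\<^sup>2) + (b\<^sup>2 + \<sigma>\<^sup>2) / 2 * (3 / \<mu> + 1 / L2) * (1 / (1 - \<rho>))"
proof -
  have c: "(\<Sum>t=1..T. bias t * norm (induced X \<xi> t - induced Y \<xi> t)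
       - k * (norm (induced X \<xi> t - induced Y \<xi> t))\<^sup>2) \<le> b\<^sup>2 / (4 * k)"
    if k: "k > 0" for X Y \<xi> and k :: real
  proof -
    have "(\<Sum>t=1..T. bias t * norm (induced X \<xi> t - induced Y \<xi> t)
       - k * (norm (induced X \<xi> t - induced Y \<xi> t))\<^sup>2) \<le> (\<Sum>t=1..T. (bias t)\<^sup>2 / (4 * k))"
    proof (rule sum_mono)
      fix t
      show "bias t * norm (induced X \<xi> t - induced Y \<xi> t)
       - k * (norm (induced X \<xi> t - induced Y \<xi> t))\<^sup>2 \<le> (bias t)\<^sup>2 / (4 * k)"
        using young_inner[OF k, of "bias t" "norm (induced X \<xi> t - induced Y \<xi> t)"] by simp
    qed
    then show ?thesis by (simp add: b sum_divide_distrib)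
  qed
  have "A L * (\<integral>z. gapU P Xstar (run_Xp L z) \<partial>Z)
    \<le> M * Dtil\<^sup>2 + A L * (b\<^sup>2 / (4 * (\<mu> / 4))) + (\<Sum>l=0..L. A l) * ((b\<^sup>2 + \<sigma>\<^sup>2) / (2 * L2))
      + (\<Sum>l<L. A l) * (b\<^sup>2 / (4 * (\<mu> / 2)))"
    by (rule expected_gap[OF D b s]) (rule c; use \<mu> in simp)+
  moreover have AL: "0 < A L" using step_facts(7)[of L] by simp
  note g = amd_steps_geometric_sum[OF steps params(2) \<mu> \<rho>]
  define S where "S = 1 / (1 - \<rho>)"
  have S: "(\<Sum>l=0..L. A l) \<le> A L * S" using g by (simp add: S_def pos_le_divide_eq mult.commute)
  have S1: "1 \<le> S" using g by (simp add: S_def)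
  have "(\<Sum>l<L. A l) \<le> (\<Sum>l=0..L. A l)"
    using AL by (simp add: atLeast0AtMost lessThan_Suc_atMost[symmetric])
  then have S': "(\<Sum>l<L. A l) \<le> A L * S" using S by simp
  have "M * Dtil\<^sup>2 * 1 \<le> M * Dtil\<^sup>2 * (\<rho> ^ L * A L)" using g(3) params by (intro mult_left_mono) auto
  moreover have "A L * (b\<^sup>2 / (4 * (\<mu> / 4))) \<le> (A L * S) * (b\<^sup>2 / (4 * (\<mu> / 4)))"
    using AL S1 \<mu> by (intro mult_right_mono) auto
  moreover have "(\<Sum>l=0..L. A l) * ((b\<^sup>2 + \<sigma>\<^sup>2) / (2 * L2)) \<le> (A L * S) * ((b\<^sup>2 + \<sigma>\<^sup>2) / (2 * L2))"
    using S params by (intro mult_right_mono) auto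
  moreover have "(\<Sum>l<L. A l) * (b\<^sup>2 / (4 * (\<mu> / 2))) \<le> (A L * S) * (b\<^sup>2 / (4 * (\<mu> / 2)))"
    using S' \<mu> by (intro mult_right_mono) auto
  moreover have "(A L * S) * (b\<^sup>2 / (4 * (\<mu> / 4))) + (A L * S) * (b\<^sup>2 / (4 * (\<mu> / 2))) = A L * (S * (b\<^sup>2 / 2 * (3 / \<mu>)))"
    using \<mu> by (simp add: field_simps)
  moreover have "A L * (S * (b\<^sup>2 / 2 * (3 / \<mu>))) \<le> A L * (S * ((b\<^sup>2 + \<sigma>\<^sup>2) / 2 * (3 / \<mu>)))"
    using AL S1 \<mu> by (intro mult_left_mono mult_right_mono) (auto simp: divide_right_mono)
  ultimately have "A L * (\<integral>z. gapU P Xstar (run_Xp L z) \<partial>Z)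
     \<le> M * Dtil\<^sup>2 * (\<rho> ^ L * A L) + A L * (S * ((b\<^sup>2 + \<sigma>\<^sup>2) / 2 * (3 / \<mu>))) + (A L * S) * ((b\<^sup>2 + \<sigma>\<^sup>2) / (2 * L2))"
    by linarith
  also have "\<dots> = A L * (\<rho> ^ L * (2 * L2 * Dtil\<^sup>2) + (b\<^sup>2 + \<sigma>\<^sup>2) / 2 * (3 / \<mu> + 1 / L2) * S)"
    using \<mu> params by (simp add: field_simps)
  finally show ?thesis using AL by (simp add: S_def)
qed

end

text \<open>
  With \<open>y = sqrt (\<mu> / L2)\<close>, expand \<open>(1 - 3/16 * y) * (1 + 1/4 * y)\<^sup>2\<close>; for \<open>y \<le> 1\<close> the linear term
  \<open>5/16 * y\<close> dominates the quadratic and the cubic one.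
\<close>

lemma geometric_rate_bound:
  assumes "0 \<le> \<mu>" "\<mu> \<le> L2" "0 < L2"
  shows "1 / (1 + 1/4 * sqrt (\<mu> / L2))\<^sup>2 \<le> 1 - 3/16 * sqrt (\<mu> / (L2::real))"
proof -
  define y where "y = sqrt (\<mu> / L2)"
  have y: "0 \<le> y" "y \<le> 1" using assms by (simp_all add: y_def)
  have "y\<^sup>2 \<le> y" "y ^ 3 \<le> y" using y power_decreasing[of 1 2 y] power_decreasing[of 1 3 y] by simp_all
  moreover have "(1 - 3/16 * y) * (1 + 1/4 * y)\<^sup>2 = 1 + 5/16 * y - 1/32 * y\<^sup>2 - 3/256 * y ^ 3"
    by (simp add: power2_eq_square power3_eq_cube algebra_simps)
  ultimately have "1 \<le> (1 - 3/16 * y) * (1 + 1/4 * y)\<^sup>2" using y by linarith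
  moreover have "0 < (1 + 1/4 * y)\<^sup>2" using y by (intro zero_less_power) simp
  ultimately show ?thesis unfolding y_def[symmetric] by (simp add: pos_divide_le_eq)
qed

theorem theorem4p3:
  fixes P :: "('w, 'z::euclidean_space, 'x::euclidean_space) msp"
    and Xstar X0 :: "nat \<Rightarrow> (nat \<Rightarrow> 'z) \<Rightarrow> 'x"
    and Q :: "nat \<Rightarrow> (nat \<Rightarrow> 'z) \<Rightarrow> (nat \<Rightarrow> 'z) measure"
    and smp :: "nat \<Rightarrow> (nat \<Rightarrow> 'z) \<Rightarrow> real \<Rightarrow> 'z"
    and v :: "nat \<Rightarrow> 'x \<Rightarrow> real" and dv :: "nat \<Rightarrow> 'x \<Rightarrow> 'x"
    and Mint :: "'v measure" and \<zeta> :: "nat \<Rightarrow> nat \<Rightarrow> 'v \<Rightarrow> real"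
    and X Xp Xm :: "'v \<Rightarrow> nat \<Rightarrow> nat \<Rightarrow> (nat \<Rightarrow> 'z) \<Rightarrow> 'x"
    and \<beta> Lip \<sigma>t \<alpha> A :: "nat \<Rightarrow> real"
    and \<mu> L2 Ltil Dtil D b \<sigma> \<rho> :: real and L :: nat
  assumes standing: "standing P Xstar"
    and dgf: "dgf_setup P v dv"
    and cond_law: "cond_law P Q"
    and sampler: "\<And>t. t \<in> {2..horizon P} \<Longrightarrow> biased_sampler P Q t (\<beta> t) (smp t)"
    and constants: "scg_constants P Q smp \<beta> Lip \<sigma>t"
    and b: "b \<ge> 0" "b\<^sup>2 = (\<Sum>t = 1..horizon P. (bias_const P \<beta> Lip t)\<^sup>2)"
    and \<sigma>: "\<sigma>\<^sup>2 = (\<Sum>t = 1..horizon P. (\<sigma>t t)\<^sup>2)"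
    and Mint: "prob_space Mint"
    and seeds: "seeds Mint (horizon P) L \<zeta>"
    and params: "\<mu> \<ge> 0" "L2 > 0"
    and X0: "\<And>t. t \<in> {1..horizon P} \<Longrightarrow> X0 t \<in> policies P t (dgf_dom (dspace P t) (feas P t) (v t))"
    and steps: "amd_steps 1 (1/2) \<mu> L2 L \<alpha> A"
    and run: "\<And>\<omega>. \<omega> \<in> space Mint \<Longrightarrow>
      amd_run P smp v dv 1 (1/2) \<mu> L2 L \<alpha> A X0 (\<lambda>t l. \<zeta> t l \<omega>) (X \<omega>) (Xp \<omega>) (Xm \<omega>)"
    and oracle_measurable: "\<And>\<omega> l t. \<omega> \<in> space Mint \<Longrightarrow> l \<le> L \<Longrightarrow> t \<in> {1..horizon P} \<Longrightarrow>
      (\<lambda>s. scg P smp (X \<omega> l) t s (\<zeta> t l \<omega>)) \<in> borel_measurable (hist P t)"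
    and curvature: "\<And>\<xi> x x'. \<xi> \<in> space (hist P (horizon P)) \<Longrightarrow>
      x \<in> feas_tuples P \<Longrightarrow> x' \<in> feas_tuples P \<Longrightarrow>
      \<mu> / 2 * (tnorm P (\<lambda>t. x t - x' t))\<^sup>2
        \<le> objective P x' \<xi> - objective P x \<xi> - (\<Sum>t = 1..horizon P. dobj P t x \<xi> \<bullet> (x' t - x t)) \<and>
      objective P x' \<xi> - objective P x \<xi> - (\<Sum>t = 1..horizon P. dobj P t x \<xi> \<bullet> (x' t - x t))
        \<le> L2 / 2 * (tnorm P (\<lambda>t. x t - x' t))\<^sup>2"
    and grad_bound: "\<And>\<xi> x. \<xi> \<in> space (hist P (horizon P)) \<Longrightarrow> x \<in> feas_tuples P \<Longrightarrow>
      tnorm P (\<lambda>t. dobj P t x \<xi>) \<le> Ltil"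
    and Dtil:
      "integrable (base P) (\<lambda>\<omega>. bregman_tuple P v dv (induced Xstar (scenario P \<omega>)) (induced X0 (scenario P \<omega>)))"
      "(\<integral>\<omega>. bregman_tuple P v dv (induced Xstar (scenario P \<omega>)) (induced X0 (scenario P \<omega>)) \<partial>base P) \<le> Dtil\<^sup>2"
    and \<rho>: "\<rho> = 1 / (1 + 1/4 * sqrt (\<mu> / L2))\<^sup>2"
  shows
    "(\<mu> = 0 \<and> (\<forall>x\<in>feas_tuples P. \<forall>x'\<in>feas_tuples P. tnorm P (\<lambda>t. x t - x' t) \<le> D) \<longrightarrow>
        integrable Mint (\<lambda>\<omega>. gapU P Xstar (Xp \<omega> L)) \<and>
        (\<integral>\<omega>. gapU P Xstar (Xp \<omega> L) \<partial>Mint)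
          \<le> 8 * L2 * Dtil\<^sup>2 / ((real L + 1) * (real L + 2))
            + 2/3 * (real L + 3) * ((b\<^sup>2 + \<sigma>\<^sup>2) / (2 * L2) + b * D)) \<and>
     (\<mu> > 0 \<longrightarrow>
        ((\<exists>x\<in>feas_tuples P. \<exists>x'\<in>feas_tuples P. x \<noteq> x') \<longrightarrow> \<rho> \<le> 1 - 3/16 * sqrt (\<mu> / L2)) \<and>
        integrable Mint (\<lambda>\<omega>. gapU P Xstar (Xp \<omega> L)) \<and>
        (\<integral>\<omega>. gapU P Xstar (Xp \<omega> L) \<partial>Mint)
          \<le> \<rho> ^ L * (2 * L2 * Dtil\<^sup>2)
            + (b\<^sup>2 + \<sigma>\<^sup>2) / 2 * (3 / \<mu> + 1 / L2) * (1 / (1 - \<rho>)))"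
proof -
  interpret amd_problem P Xstar X0 Q smp v dv \<beta> Lip \<sigma>t \<alpha> A \<mu> L2 L
    by unfold_locales (fact standing dgf cond_law sampler constants params X0 steps curvature)+
  interpret Mi: prob_space Mint by (rule Mint)
  let ?I = "{1..horizon P} \<times> {0..L}"
  \<comment> \<open>The vector of all seeds, whose law is the product measure by independence.\<close>
  define V where "V \<omega> = (\<lambda>p\<in>?I. (case p of (t, l) \<Rightarrow> \<zeta> t l) \<omega>)" for \<omega>
  have ind: "Mi.indep_vars (\<lambda>_. unif01) (\<lambda>(t, l). \<zeta> t l) ?I"
    and un: "\<And>t l. t \<in> {1..horizon P} \<Longrightarrow> l \<in> {0..L} \<Longrightarrow> distr Mint unif01 (\<zeta> t l) = unif01"
    using seeds unfolding seeds_def by auto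
  have rv: "(case p of (t, l) \<Rightarrow> \<zeta> t l) \<in> measurable Mint unif01" if "p \<in> ?I" for p
    using ind that unfolding Mi.indep_vars_def by auto
  have V: "V \<in> measurable Mint Z"
    unfolding V_def by (rule measurable_restrict) (rule rv)
  have ne: "?I \<noteq> {}" using horizon_ge by auto
  have "distr Mint Z V = PiM ?I (\<lambda>p. distr Mint unif01 (case p of (t, l) \<Rightarrow> \<zeta> t l))"
    using Mi.indep_vars_iff_distr_eq_PiM'[OF ne rv] ind unfolding V_def[abs_def] by simp
  also have "\<dots> = Z" by (rule PiM_cong) (use un in auto)
  finally have dV: "distr Mint Z V = Z" .
  have same: "gapU P Xstar (Xp \<omega> L) = gapU P Xstar (run_Xp L (V \<omega>))" if \<omega>: "\<omega> \<in> space Mint" for \<omega>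
  proof -
    have "objective P (induced (Xp \<omega> L) \<xi>) \<xi> = objective P (induced (run_Xp L (V \<omega>)) \<xi>) \<xi>"
      if \<xi>: "\<xi> \<in> space (hist P (horizon P))" for \<xi>
    proof (rule objective_cong)
      fix t assume t: "t \<in> {1..horizon P}"
      have s: "trunc t \<xi> \<in> space (hist P t)" using t by (intro trunc_space[OF _ \<xi>]) auto
      show "induced (Xp \<omega> L) \<xi> t = induced (run_Xp L (V \<omega>)) \<xi> t"
        unfolding induced_def
        by (rule run_unique[OF run[OF \<omega>] measurable_space[OF V \<omega>] _ order_refl t s]) (simp add: V_def)
    qed
    then show ?thesis unfolding gapU_def
      by (intro Bochner_Integration.integral_cong refl) (simp add: scenario_space)
  qed
  have gi: "integrable Mint (\<lambda>\<omega>. gapU P Xstar (Xp \<omega> L))"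
  proof -
    have "integrable (distr Mint Z V) (\<lambda>z. gapU P Xstar (run_Xp L z))"
      unfolding dV by (rule gap_integrable)
    from integrable_distr[OF V this] have "integrable Mint (\<lambda>\<omega>. gapU P Xstar (run_Xp L (V \<omega>)))" .
    then show ?thesis using same by (simp cong: Bochner_Integration.integrable_cong)
  qed
  have ge: "(\<integral>\<omega>. gapU P Xstar (Xp \<omega> L) \<partial>Mint) = (\<integral>z. gapU P Xstar (run_Xp L z) \<partial>Z)"
  proof -
    have "(\<integral>\<omega>. gapU P Xstar (Xp \<omega> L) \<partial>Mint) = (\<integral>\<omega>. gapU P Xstar (run_Xp L (V \<omega>)) \<partial>Mint)"
      using same by (rule Bochner_Integration.integral_cong[OF refl])
    also have "\<dots> = (\<integral>z. gapU P Xstar (run_Xp L z) \<partial>distr Mint Z V)"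
      by (rule integral_distr[OF V, symmetric]) (rule borel_measurable_integrable[OF gap_integrable])
    finally show ?thesis unfolding dV .
  qed
  \<comment> \<open>Between two distinct feasible tuples the two curvature bounds can only be compatible for \<open>\<mu> \<le> L2\<close>.\<close>
  have curv: "\<mu> \<le> L2" if x: "x \<in> feas_tuples P" "x' \<in> feas_tuples P" "x \<noteq> x'" for x x'
  proof -
    obtain \<omega> where "\<omega> \<in> space (base P)" using base.not_empty by blast
    then have "\<mu> / 2 * (tnorm P (\<lambda>t. x t - x' t))\<^sup>2 \<le> L2 / 2 * (tnorm P (\<lambda>t. x t - x' t))\<^sup>2"
      using curvature[OF scenario_space x(1,2)] by fastforce
    moreover have "0 < (tnorm P (\<lambda>t. x t - x' t))\<^sup>2"
    proof -
      have "\<exists>t\<in>{1..horizon P}. x t \<noteq> x' t"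
        using x PiE_ext[of x "{1..horizon P}" "feas P" x'] unfolding feas_tuples_def by blast
      then have "tnorm P (\<lambda>t. x t - x' t) \<noteq> 0" unfolding tnorm_def by (subst L2_set_eq_0_iff) auto
      then show ?thesis by simp
    qed
    ultimately show ?thesis by simp
  qed
  show ?thesis
  proof (intro conjI impI)
    assume a: "\<mu> = 0 \<and> (\<forall>x\<in>feas_tuples P. \<forall>x'\<in>feas_tuples P. tnorm P (\<lambda>t. x t - x' t) \<le> D)"
    show "(\<integral>\<omega>. gapU P Xstar (Xp \<omega> L) \<partial>Mint)
          \<le> 8 * L2 * Dtil\<^sup>2 / ((real L + 1) * (real L + 2))
            + 2/3 * (real L + 3) * ((b\<^sup>2 + \<sigma>\<^sup>2) / (2 * L2) + b * D)"
      unfolding ge using a by (intro convex_rate[OF Dtil b \<sigma>]) auto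
    show "integrable Mint (\<lambda>\<omega>. gapU P Xstar (Xp \<omega> L))" by (rule gi)
  next
    assume \<mu>: "\<mu> > 0"
    show "integrable Mint (\<lambda>\<omega>. gapU P Xstar (Xp \<omega> L))" by (rule gi)
    show "(\<integral>\<omega>. gapU P Xstar (Xp \<omega> L) \<partial>Mint)
          \<le> \<rho> ^ L * (2 * L2 * Dtil\<^sup>2)
            + (b\<^sup>2 + \<sigma>\<^sup>2) / 2 * (3 / \<mu> + 1 / L2) * (1 / (1 - \<rho>))"
      unfolding ge by (rule strongly_convex_rate[OF Dtil b(2) \<sigma> \<mu> \<rho>])
    assume "\<exists>x\<in>feas_tuples P. \<exists>x'\<in>feas_tuples P. x \<noteq> x'"
    then show "\<rho> \<le> 1 - 3/16 * sqrt (\<mu> / L2)"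
      unfolding \<rho> using curv params by (intro geometric_rate_bound) auto
  qed
qed

end
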